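(* Let $\alpha\in\mathbb{R}$ with $\alpha\neq-1$ and let $T_*>0$. There exists no nontrivial solution $(v,\theta)$ of the 2D inviscid Boussinesq system on $[0,T_* )$ of the form $$v(x,t)=\frac{1}{(T_*-t)^{\frac{\alpha}{\alpha+1}}}V\!\left(\frac{x}{(T_*-t)^{\frac{1}{\alpha+1}}}\right),\qquad \theta(x,t)=\frac{1}{(T_*-t)^{\frac{2\alpha+1}{\alpha+1}}}\Theta\!\left(\frac{x}{(T_*-t)^{\frac{1}{\alpha+1}}}\right),$$ if there exist $p_1,p_2\in(0,\infty]$, $p_1<p_2$, such that $\Theta\in L^{p_1}(\mathbb{R}^2)\cap L^{p_2}(\mathbb{R}^2)$, and $V\in H^m(\mathbb{R}^2)$ for some $m>2$.
   Context: The 2D inviscid Boussinesq system is $$\frac{\partial v}{\partial t}+(v\cdot\nabla)v=-\nabla p+\theta e_1,\qquad \frac{\partial\theta}{\partial t}+(v\cdot\nabla)\theta=0,\qquad \mathrm{div}\,v=0,$$ with $v(x,0)=v_0(x)$, $\theta(x,0)=\theta_0(x)$, $x\in\mathbb{R}^2$, where $v=(v_1,v_2)(x,t)$ is the velocity, $e_1=(1,0)$, $p=p(x,t)$ is the pressure and $\theta=\theta(x,t)$ is the scalar temperature. Solutions are understood in the classical sense ($v$ and $\theta$ are $C^1$ and the equations hold pointwise). "Nontrivial" means that $(v,\theta)$ is not identically $(0,0)$. $H^m$ denotes the $L^2$-based Sobolev space. For $0<p<1$, $L^p(\mathbb{R}^2)$ is the set of measurable $f$ with $\int|f|^p\,dx<\infty$.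 *)

theory Defs
  imports "HOL-Analysis.Analysis"
begin

section \<open>Function spaces\<close>

text \<open>
  Membership in the Lebesgue space with exponent \<open>p \<in> (0, \<infinity>]\<close>.  No norm is involved, so the
  definition also covers the quasi-Banach range \<open>0 < p < 1\<close>.
\<close>

definition in_Lp :: "ennreal \<Rightarrow> ('a::euclidean_space \<Rightarrow> 'b::real_normed_vector) \<Rightarrow> bool" where
  "in_Lp p f \<longleftrightarrow> f \<in> borel_measurable lebesgue \<and>
     (if p = \<infinity> then (\<exists>C. AE x in lebesgue. norm (f x) \<le> C)
      else (\<integral>\<^sup>+ x. ennreal (norm (f x) powr enn2real p) \<partial>lebesgue) < \<infinity>)"

definition fourier_integral :: "('a::euclidean_space \<Rightarrow> complex) \<Rightarrow> 'a \<Rightarrow> complex" where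
  "fourier_integral f \<xi> = (\<integral> x. cis (- (x \<bullet> \<xi>)) * f x \<partial>lebesgue)"

text \<open>
  \<open>g\<close> is the Fourier--Plancherel transform of the square integrable function \<open>f\<close>: the limit in
  \<open>L\<^sup>2\<close> of the Fourier integrals of the truncations of \<open>f\<close> to balls.
\<close>

definition is_plancherel_transform ::
    "('a::euclidean_space \<Rightarrow> complex) \<Rightarrow> ('a \<Rightarrow> complex) \<Rightarrow> bool" where
  "is_plancherel_transform f g \<longleftrightarrow> in_Lp 2 f \<and> in_Lp 2 g \<and>
     ((\<lambda>R::real. \<integral>\<^sup>+ \<xi>. ennreal ((cmod (g \<xi> -
          fourier_integral (\<lambda>x. if x \<in> ball 0 R then f x else 0) \<xi>))\<^sup>2) \<partial>lebesgue) \<longlongrightarrow> 0) at_top"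

text \<open>
  The space \<open>H\<^sup>s\<close> for real \<open>s \<ge> 0\<close>: square integrable functions \<open>f\<close> such that
  \<open>(1 + |\<xi>|\<^sup>2)\<^bsup>s/2\<^esup>\<close> times the Fourier transform of \<open>f\<close> is square integrable.
\<close>

definition in_Hs :: "real \<Rightarrow> ('a::euclidean_space \<Rightarrow> complex) \<Rightarrow> bool" where
  "in_Hs s f \<longleftrightarrow> (\<exists>g. is_plancherel_transform f g \<and>
     in_Lp 2 (\<lambda>\<xi>. (1 + (norm \<xi>)\<^sup>2) powr (s / 2) *\<^sub>R g \<xi>))"

definition in_Hs_vec :: "real \<Rightarrow> ('a::euclidean_space \<Rightarrow> real ^ 'n) \<Rightarrow> bool" where
  "in_Hs_vec s F \<longleftrightarrow> (\<forall>i. in_Hs s (\<lambda>x. complex_of_real (F x $ i)))"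

text \<open>
  The derivative is taken within \<open>S\<close>; below, \<open>S\<close> is the slab \<open>\<real>\<^sup>2 \<times> [0, T)\<close>, where this means
  one-sided time derivatives at \<open>t = 0\<close>.
\<close>

definition C1_on ::
    "'a::real_normed_vector set \<Rightarrow> ('a \<Rightarrow> 'b::real_normed_vector) \<Rightarrow> bool" where
  "C1_on S f \<longleftrightarrow> (\<exists>f' :: 'a \<Rightarrow> 'a \<Rightarrow>\<^sub>L 'b.
     (\<forall>z\<in>S. (f has_derivative blinfun_apply (f' z)) (at z within S)) \<and> continuous_on S f')"

section \<open>The Boussinesq system\<close>

definition divergence :: "(real ^ 'n \<Rightarrow> real ^ 'n) \<Rightarrow> real ^ 'n \<Rightarrow> real" where
  "divergence u x = (\<Sum>i\<in>UNIV. frechet_derivative u (at x) (axis i 1) $ i)"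

text \<open>
  The transport term \<open>(w \<cdot> \<nabla>) f\<close> at \<open>x\<close> is the Frechet derivative of \<open>f\<close> at \<open>x\<close>, applied to \<open>w\<close>.
  The pressure is only required to have a spatial gradient at every point, which is all that
  the equations ask of it.
\<close>

definition boussinesq_solution ::
    "real \<Rightarrow> (real^2 \<Rightarrow> real^2) \<Rightarrow> (real^2 \<Rightarrow> real)
      \<Rightarrow> (real^2 \<Rightarrow> real \<Rightarrow> real^2) \<Rightarrow> (real^2 \<Rightarrow> real \<Rightarrow> real) \<Rightarrow> bool" where
  "boussinesq_solution T v0 \<theta>0 v \<theta> \<longleftrightarrow>
     C1_on (UNIV \<times> {0..<T}) (\<lambda>(x, t). v x t) \<and>
     C1_on (UNIV \<times> {0..<T}) (\<lambda>(x, t). \<theta> x t) \<and>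
     (\<exists>(p :: real^2 \<Rightarrow> real \<Rightarrow> real) (grad_p :: real^2 \<Rightarrow> real \<Rightarrow> real^2).
        \<forall>x. \<forall>t\<in>{0..<T}.
          GDERIV (\<lambda>y. p y t) x :> grad_p x t \<and>
          vector_derivative (\<lambda>s. v x s) (at t within {0..<T})
            + frechet_derivative (\<lambda>y. v y t) (at x) (v x t)
            = - grad_p x t + \<theta> x t *\<^sub>R axis 1 1) \<and>
     (\<forall>x. \<forall>t\<in>{0..<T}.
        vector_derivative (\<lambda>s. \<theta> x s) (at t within {0..<T})
          + frechet_derivative (\<lambda>y. \<theta> y t) (at x) (v x t) = 0 \<and>
        divergence (\<lambda>y. v y t) x = 0) \<and>
     (\<forall>x. v x 0 = v0 x \<and> \<theta> x 0 = \<theta>0 x)"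

definition nontrivial_on ::
    "real \<Rightarrow> (real^2 \<Rightarrow> real \<Rightarrow> real^2) \<Rightarrow> (real^2 \<Rightarrow> real \<Rightarrow> real) \<Rightarrow> bool" where
  "nontrivial_on T v \<theta> \<longleftrightarrow> (\<exists>x. \<exists>t\<in>{0..<T}. v x t \<noteq> 0 \<or> \<theta> x t \<noteq> 0)"

definition self_similar ::
    "real \<Rightarrow> real \<Rightarrow> (real^2 \<Rightarrow> real^2) \<Rightarrow> (real^2 \<Rightarrow> real)
      \<Rightarrow> (real^2 \<Rightarrow> real \<Rightarrow> real^2) \<Rightarrow> (real^2 \<Rightarrow> real \<Rightarrow> real) \<Rightarrow> bool" where
  "self_similar \<alpha> T V \<Theta> v \<theta> \<longleftrightarrow> (\<forall>x. \<forall>t\<in>{0..<T}.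
     v x t = (1 / (T - t) powr (\<alpha> / (\<alpha> + 1))) *\<^sub>R V (x /\<^sub>R (T - t) powr (1 / (\<alpha> + 1))) \<and>
     \<theta> x t = 1 / (T - t) powr ((2 * \<alpha> + 1) / (\<alpha> + 1)) * \<Theta> (x /\<^sub>R (T - t) powr (1 / (\<alpha> + 1))))"

end

theory Submission
  imports Defs "HOL-Probability.Characteristic_Functions"
    "HOL-Complex_Analysis.Cauchy_Integral_Formula" "HOL-Real_Asymp.Real_Asymp"
begin

text \<open>
  Inserting the self-similar form into the system at time \<open>0\<close> turns it into steady equations for
  the profile.  With \<open>a = \<alpha>/(\<alpha>+1)\<close>, \<open>b = 1/(\<alpha>+1)\<close>, \<open>c = (2\<alpha>+1)/(\<alpha>+1)\<close> and the drift
  \<open>W(y) = b y + V(y)\<close> they read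
  \<open>a V + DV(W) = - \<nabla>P + k \<Theta> e\<^sub>1\<close>, \<open>c \<Theta> + D\<Theta>(W) = 0\<close> and \<open>div V = 0\<close>
  (lemma \<open>self_similar_profile_equations\<close>), and the initial slice also shows that \<open>V\<close> and \<open>\<Theta>\<close>
  are \<open>C\<^sup>1\<close>.  The theorem is a Liouville statement for these equations.

  \<^emph>\<open>The temperature vanishes.\<close>  The drift has constant divergence \<open>2b\<close> and at most linear growth.
  Multiplying the transport equation by \<open>p |\<Theta>|\<^sup>p/\<Theta>\<close> and integrating over the plane gives
  \<open>(c p - 2 b) \<integral>|\<Theta>|\<^sup>p = 0\<close>; this is the statement that the flow of a solution preserves the
  \<open>L\<^sup>p\<close> norm while the self-similar form makes it scale with a power of \<open>T - t\<close>.  Since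
  \<open>b \<noteq> 0\<close>, the factor is nonzero for at least one of two different exponents
  (lemma \<open>steady_transport_Lp_imp_0\<close>).

  \<^emph>\<open>The vorticity vanishes.\<close>  What remains is a self-similar Euler profile, whose vorticity
  \<open>\<omega>\<close> formally solves \<open>\<omega> + W \<cdot> \<nabla>\<omega> = 0\<close>, so that \<open>\<omega> = 0\<close> at a maximum point of \<open>|\<omega>|\<close>.  As \<open>V\<close> is
  only \<open>C\<^sup>1\<close>, \<open>\<omega>\<close> cannot be differentiated, and the argument is applied to the circulation
  \<open>\<Gamma>(y)\<close> of \<open>V\<close> around the circle of small radius \<open>\<epsilon>\<close> about \<open>y\<close>, which is a differentiable
  function of \<open>y\<close> and close to \<open>\<pi>\<epsilon>\<^sup>2\<omega>(y)\<close>.  It decays at infinity, so \<open>|\<Gamma>|\<close> has a maximum point;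
  integrating the momentum equation around the circle about that point removes the pressure and,
  because \<open>\<nabla>\<Gamma> = 0\<close> there, leaves \<open>(a + b) \<omega> = o(1)\<close> with \<open>a + b = 1\<close>
  (lemma \<open>curl2_of_self_similar_Euler_profile\<close>).

  \<^emph>\<open>The velocity vanishes.\<close>  A field on the plane without divergence and curl is the conjugate of
  an entire function, and Liouville's theorem applies because \<open>V\<close> tends to \<open>0\<close> at infinity.

  The last two steps need \<open>V\<close> to decay and \<open>DV\<close> to be bounded and uniformly continuous.  This is
  where \<open>H\<^sup>m\<close> with \<open>m > 2\<close> enters: \<open>(1 + |\<xi>|)\<close> times the Plancherel transform of \<open>V\<close> is integrable,
  so Fourier inversion (lemma \<open>fourier_inversion\<close>) bounds the first and second differences of \<open>V\<close>
  (lemma \<open>Sobolev_embedding_C1\<close>).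
\<close>

section \<open>Fourier integrals of Gaussians\<close>

lemma
  fixes f :: "'a::euclidean_space \<Rightarrow> real \<Rightarrow> 'b::{real_normed_field, banach, second_countable_topology}"
  assumes "\<And>b. b \<in> Basis \<Longrightarrow> integrable lborel (f b)"
  shows integrable_lborel_prod: "integrable lborel (\<lambda>x. \<Prod>b\<in>Basis. f b (x \<bullet> b))"
    and integral_lborel_prod:
      "(\<integral>x. (\<Prod>b\<in>Basis. f b (x \<bullet> b)) \<partial>lborel) = (\<Prod>b\<in>Basis. \<integral>x. f b x \<partial>lborel)"
proof -
  interpret product_sigma_finite "\<lambda>b::'a. lborel :: real measure" ..
  have [measurable]: "\<And>b. b \<in> Basis \<Longrightarrow> f b \<in> borel_measurable borel"
    using assms borel_measurable_integrable by force
  have eq: "(\<Prod>b\<in>Basis. f b ((\<Sum>c\<in>Basis. y c *\<^sub>R c) \<bullet> b)) = (\<Prod>b\<in>Basis. f b (y b))" for y :: "'a \<Rightarrow> real"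
    by (rule prod.cong) auto
  show "integrable lborel (\<lambda>x. \<Prod>b\<in>Basis. f b (x \<bullet> b))"
    by (subst lborel_eq, subst integrable_distr_eq)
      (auto simp: eq intro!: product_integrable_prod assms)
  show "(\<integral>x. (\<Prod>b\<in>Basis. f b (x \<bullet> b)) \<partial>lborel) = (\<Prod>b\<in>Basis. \<integral>x. f b x \<partial>lborel)"
    by (subst lborel_eq, subst integral_distr)
      (auto simp: eq intro!: product_integral_prod assms)
qed

lemma borel_measurable_cis [measurable]: "cis \<in> borel_measurable borel"
  by (intro borel_measurable_continuous_onI continuous_intros)

text \<open>
  A rescaling of the characteristic function of the standard normal distribution.
\<close>

lemma
  fixes z \<sigma> :: real
  assumes "\<sigma> > 0"
  shows integrable_cis_gaussian_real: "integrable lborel (\<lambda>t. cis (z * t) * exp (- (\<sigma> * t)\<^sup>2 / 2))"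
    and integral_cis_gaussian_real:
      "(\<integral>t. cis (z * t) * exp (- (\<sigma> * t)\<^sup>2 / 2) \<partial>lborel)
        = sqrt (2 * pi) / \<sigma> * exp (- (z / \<sigma>)\<^sup>2 / 2)"
proof -
  define h where "h s = cis (z / \<sigma> * s) * complex_of_real (exp (- s\<^sup>2 / 2))" for s
  have d: "std_normal_density s *\<^sub>R cis (z / \<sigma> * s) = h s / sqrt (2 * pi)" for s
    by (simp add: h_def std_normal_density_def scaleR_conv_of_real)
  have "integrable std_normal_distribution (\<lambda>s. cis (z / \<sigma> * s))"
    using real_distribution.axioms(1)[OF real_dist_normal_dist]
    by (intro finite_measure.integrable_const_bound[where B = 1] prob_space.finite_measure) auto
  hence "integrable lborel (\<lambda>s. std_normal_density s *\<^sub>R cis (z / \<sigma> * s))"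
    by (subst (asm) integrable_density) auto
  hence "integrable lborel (\<lambda>s. h s / sqrt (2 * pi))" unfolding d .
  hence "integrable lborel (\<lambda>s. sqrt (2 * pi) * (h s / sqrt (2 * pi)))"
    by (intro integrable_mult_right)
  hence int: "integrable lborel h" by simp
  have "(\<integral>s. cis (z / \<sigma> * s) \<partial>std_normal_distribution) = exp (- (z / \<sigma>)\<^sup>2 / 2)"
    using fun_cong[OF char_std_normal_distribution, of "z / \<sigma>"]
    by (simp add: char_def cis_conv_exp)
  hence "(\<integral>s. std_normal_density s *\<^sub>R cis (z / \<sigma> * s) \<partial>lborel) = exp (- (z / \<sigma>)\<^sup>2 / 2)"
    by (subst (asm) integral_density) auto
  hence "(\<integral>s. h s / sqrt (2 * pi) \<partial>lborel) = exp (- (z / \<sigma>)\<^sup>2 / 2)" unfolding d .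
  hence val: "(\<integral>s. h s \<partial>lborel) = sqrt (2 * pi) * exp (- (z / \<sigma>)\<^sup>2 / 2)"
    by (simp add: field_simps)
  have h: "h (0 + \<sigma> * t) = cis (z * t) * exp (- (\<sigma> * t)\<^sup>2 / 2)" for t
    using assms by (simp add: h_def)
  show "integrable lborel (\<lambda>t. cis (z * t) * exp (- (\<sigma> * t)\<^sup>2 / 2))"
    using lborel_integrable_real_affine[OF int, of \<sigma> 0] assms unfolding h by simp
  show "(\<integral>t. cis (z * t) * exp (- (\<sigma> * t)\<^sup>2 / 2) \<partial>lborel)
        = sqrt (2 * pi) / \<sigma> * exp (- (z / \<sigma>)\<^sup>2 / 2)"
    using lborel_integral_real_affine[of \<sigma> h 0] assms val unfolding h
    by (simp add: field_simps scaleR_conv_of_real)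
qed

lemma cis_sum: "finite A \<Longrightarrow> cis (sum f A) = (\<Prod>a\<in>A. cis (f a))"
  by (induction A rule: finite_induct) (auto simp: cis_mult[symmetric])

lemma
  fixes z :: "'a::euclidean_space" and \<sigma> :: real
  assumes "\<sigma> > 0"
  shows integrable_cis_gaussian: "integrable lborel (\<lambda>\<xi>. cis (z \<bullet> \<xi>) * exp (- (\<sigma> * norm \<xi>)\<^sup>2 / 2))"
    and integral_cis_gaussian:
      "(\<integral>\<xi>. cis (z \<bullet> \<xi>) * exp (- (\<sigma> * norm \<xi>)\<^sup>2 / 2) \<partial>lborel)
        = (sqrt (2 * pi) / \<sigma>) ^ DIM('a) * exp (- (norm z / \<sigma>)\<^sup>2 / 2)"
proof -
  have nrm: "(norm x)\<^sup>2 = (\<Sum>b\<in>Basis. (x \<bullet> b)\<^sup>2)" for x :: 'a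
    by (subst dot_square_norm[symmetric], subst euclidean_inner) (simp add: power2_eq_square)
  have "complex_of_real (exp (- (\<sigma> * norm \<xi>)\<^sup>2 / 2)) = (\<Prod>b\<in>Basis. exp (- (\<sigma> * (\<xi> \<bullet> b))\<^sup>2 / 2))" for \<xi> :: 'a
    by (simp add: exp_sum[symmetric] power_mult_distrib nrm sum_distrib_left sum_negf sum_divide_distrib)
  moreover have "cis (z \<bullet> \<xi>) = (\<Prod>b\<in>Basis. cis ((z \<bullet> b) * (\<xi> \<bullet> b)))" for \<xi>
    by (subst euclidean_inner) (simp add: cis_sum)
  ultimately have eq: "cis (z \<bullet> \<xi>) * complex_of_real (exp (- (\<sigma> * norm \<xi>)\<^sup>2 / 2))
      = (\<Prod>b\<in>Basis. (\<lambda>t. cis ((z \<bullet> b) * t) * exp (- (\<sigma> * t)\<^sup>2 / 2)) (\<xi> \<bullet> b))" for \<xi>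
    by (simp add: prod.distrib)
  show "integrable lborel (\<lambda>\<xi>. cis (z \<bullet> \<xi>) * exp (- (\<sigma> * norm \<xi>)\<^sup>2 / 2))"
    unfolding eq by (rule integrable_lborel_prod, rule integrable_cis_gaussian_real[OF assms])
  have "(\<Prod>b\<in>Basis. complex_of_real (exp (- ((z \<bullet> b) / \<sigma>)\<^sup>2 / 2))) = exp (- (norm z / \<sigma>)\<^sup>2 / 2)"
  proof -
    have "(\<Prod>b\<in>Basis. exp (- ((z \<bullet> b) / \<sigma>)\<^sup>2 / 2)) = exp (- (norm z / \<sigma>)\<^sup>2 / 2)"
      by (simp add: exp_sum[symmetric] power_divide nrm sum_negf sum_divide_distrib)
    thus ?thesis by (metis of_real_prod)
  qed
  thus "(\<integral>\<xi>. cis (z \<bullet> \<xi>) * exp (- (\<sigma> * norm \<xi>)\<^sup>2 / 2) \<partial>lborel)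
        = (sqrt (2 * pi) / \<sigma>) ^ DIM('a) * exp (- (norm z / \<sigma>)\<^sup>2 / 2)"
    unfolding eq
    by (subst integral_lborel_prod)
      (simp_all only: integrable_cis_gaussian_real[OF assms] integral_cis_gaussian_real[OF assms]
         prod.distrib prod_constant of_real_mult of_real_power)
qed

lemma integrable_gaussian:
  assumes "\<sigma> > 0"
  shows "integrable lborel (\<lambda>\<xi>::'a::euclidean_space. exp (- (\<sigma> * norm \<xi>)\<^sup>2 / 2))"
  using integrable_norm[OF integrable_cis_gaussian[OF assms, of 0]] by (simp add: norm_mult)

lemma integrable_mult_L2:
  fixes f g :: "'a \<Rightarrow> 'b::{real_normed_field, banach, second_countable_topology}"
  assumes [measurable]: "f \<in> borel_measurable M" "g \<in> borel_measurable M"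
    and "integrable M (\<lambda>x. (norm (f x))\<^sup>2)" "integrable M (\<lambda>x. (norm (g x))\<^sup>2)"
  shows "integrable M (\<lambda>x. f x * g x)"
proof (rule Bochner_Integration.integrable_bound)
  show "integrable M (\<lambda>x. (norm (f x))\<^sup>2 + (norm (g x))\<^sup>2)" using assms by simp
  have "norm a * norm b \<le> (norm a)\<^sup>2 + (norm b)\<^sup>2" for a b :: 'b
    using sum_squares_bound[of "norm a" "norm b"]
      mult_nonneg_nonneg[OF norm_ge_zero[of a] norm_ge_zero[of b]] by linarith
  thus "AE x in M. norm (f x * g x) \<le> norm ((norm (f x))\<^sup>2 + (norm (g x))\<^sup>2)"
    by (auto simp: norm_mult abs_of_nonneg)
qed simp

lemma fourier_integral_lborel:
  assumes [measurable]: "f \<in> borel_measurable borel"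
  shows "fourier_integral f \<xi> = (\<integral>x. cis (- (x \<bullet> \<xi>)) * f x \<partial>lborel)"
  unfolding fourier_integral_def by (rule integral_completion) measurable

lemma measurable_fourier_integral:
  assumes [measurable]: "f \<in> borel_measurable borel"
  shows "fourier_integral f \<in> borel_measurable borel"
  unfolding fourier_integral_lborel[OF assms]
  by measurable

lemma norm_fourier_integral_le:
  assumes "integrable lborel f"
  shows "norm (fourier_integral f \<xi>) \<le> (\<integral>x. norm (f x) \<partial>lborel)"
proof -
  have "f \<in> borel_measurable borel" using borel_measurable_integrable[OF assms] by simp
  thus ?thesis unfolding fourier_integral_lborel[OF \<open>f \<in> _\<close>]
    by (intro order_trans[OF integral_norm_bound]) (simp add: norm_mult)
qed

text \<open>
  Fubini: both sides are the integral of \<open>e\<^sup>-\<^sup>i\<^sup>x\<^sup>\<xi> f(x) h(\<xi>)\<close> over the product space.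
\<close>

lemma fourier_integral_multiplication:
  fixes f h :: "'a::euclidean_space \<Rightarrow> complex"
  assumes f: "integrable lborel f" and h: "integrable lborel h"
  shows "(\<integral>\<xi>. fourier_integral f \<xi> * h \<xi> \<partial>lborel) = (\<integral>x. f x * fourier_integral h x \<partial>lborel)"
proof -
  have [measurable]: "f \<in> borel_measurable borel" "h \<in> borel_measurable borel"
    using f h borel_measurable_integrable by force+
  have "integrable (lborel \<Otimes>\<^sub>M lborel) (\<lambda>(x, \<xi>). f x * h \<xi>)"
    using f h
    by (intro lborel_pair.Fubini_integrable) (auto simp: norm_mult intro!: integrable_mult_left)
  hence int: "integrable (lborel \<Otimes>\<^sub>M lborel) (\<lambda>(x, \<xi>). cis (- (x \<bullet> \<xi>)) * f x * h \<xi>)"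
    by (rule Bochner_Integration.integrable_bound) (auto simp: norm_mult)
  have "(\<integral>\<xi>. fourier_integral f \<xi> * h \<xi> \<partial>lborel)
      = (\<integral>\<xi>. (\<integral>x. cis (- (x \<bullet> \<xi>)) * f x * h \<xi> \<partial>lborel) \<partial>lborel)"
    by (simp add: fourier_integral_lborel)
  also have "\<dots> = (\<integral>x. (\<integral>\<xi>. cis (- (x \<bullet> \<xi>)) * f x * h \<xi> \<partial>lborel) \<partial>lborel)"
    using lborel_pair.Fubini_integral[OF int] by simp
  also have "(\<lambda>x \<xi>. cis (- (x \<bullet> \<xi>)) * f x * h \<xi>) = (\<lambda>x \<xi>. f x * (cis (- (\<xi> \<bullet> x)) * h \<xi>))"
    by (intro ext) (simp add: inner_commute mult_ac)
  finally show ?thesis by (simp add: fourier_integral_lborel)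
qed

section \<open>Fourier inversion for the Plancherel transform\<close>

lemma in_Lp_2_iff:
  "in_Lp 2 f \<longleftrightarrow> f \<in> borel_measurable lebesgue \<and> integrable lebesgue (\<lambda>x. (norm (f x))\<^sup>2)"
  unfolding in_Lp_def by (auto simp: integrable_iff_bounded powr_numeral)

lemma
  fixes F :: "'a::euclidean_space \<Rightarrow> 'b::{banach, second_countable_topology}"
  assumes c: "c > 0" and [measurable]: "F \<in> borel_measurable borel"
  shows lborel_integral_affine: "(\<integral>y. F y \<partial>lborel) = c ^ DIM('a) *\<^sub>R (\<integral>z. F (x + c *\<^sub>R z) \<partial>lborel)"
    and lborel_integrable_affine_iff: "integrable lborel (\<lambda>z. F (x + c *\<^sub>R z)) = integrable lborel F"
proof -
  have d: "lborel = density (distr lborel borel (\<lambda>z. x + c *\<^sub>R z)) (\<lambda>_. c ^ DIM('a))"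
    using lborel_affine[of c x] c by simp
  show "(\<integral>y. F y \<partial>lborel) = c ^ DIM('a) *\<^sub>R (\<integral>z. F (x + c *\<^sub>R z) \<partial>lborel)"
    using c by (subst d) (simp add: integral_density integral_distr)
  have "integrable lborel F \<longleftrightarrow> integrable (density (distr lborel borel (\<lambda>z. x + c *\<^sub>R z)) (\<lambda>_. c ^ DIM('a))) F"
    by (subst d) simp
  also have "\<dots> \<longleftrightarrow> integrable lborel (\<lambda>z. c ^ DIM('a) *\<^sub>R F (x + c *\<^sub>R z))"
    using c by (simp add: integrable_density integrable_distr_eq)
  also have "\<dots> \<longleftrightarrow> integrable lborel (\<lambda>z. F (x + c *\<^sub>R z))"
    using integrable_scaleR_right[of "inverse (c ^ DIM('a))" lborel "\<lambda>z. c ^ DIM('a) *\<^sub>R F (x + c *\<^sub>R z)"] c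
    by auto
  finally show "integrable lborel (\<lambda>z. F (x + c *\<^sub>R z)) = integrable lborel F" by simp
qed

text \<open>
  The multiplication formula survives the \<open>L\<^sup>2\<close> limit that defines the Plancherel transform: it
  holds for the truncations of \<open>f\<close>, the left-hand sides converge by the Cauchy--Schwarz inequality
  and the right-hand sides by dominated convergence.
\<close>

lemma plancherel_pairing:
  fixes f g h :: "'a::euclidean_space \<Rightarrow> complex"
  assumes pl: "is_plancherel_transform f g" and f_meas [measurable]: "f \<in> borel_measurable borel"
    and h1: "integrable lborel h" and h2: "integrable lborel (\<lambda>\<xi>. (cmod (h \<xi>))\<^sup>2)"
    and Fh2: "integrable lborel (\<lambda>x. (cmod (fourier_integral h x))\<^sup>2)"
  shows "(\<integral>\<xi>. g \<xi> * h \<xi> \<partial>lebesgue) = (\<integral>x. f x * fourier_integral h x \<partial>lborel)"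
proof -
  define f\<^sub>R where "f\<^sub>R R x = (if x \<in> ball 0 R then f x else 0)" for R x
  have f\<^sub>R_meas [measurable]: "f\<^sub>R R \<in> borel_measurable borel" for R
    unfolding f\<^sub>R_def by (rule measurable_If_set) auto
  have h_meas [measurable]: "h \<in> borel_measurable borel"
    using borel_measurable_integrable[OF h1] by simp
  have Fh_meas [measurable]: "fourier_integral h \<in> borel_measurable borel"
    by (rule measurable_fourier_integral) measurable
  have F\<^sub>R_meas [measurable]: "fourier_integral (f\<^sub>R R) \<in> borel_measurable borel" for R
    by (rule measurable_fourier_integral) measurable
  have g_meas [measurable]: "g \<in> borel_measurable lebesgue"
    and g2: "integrable lebesgue (\<lambda>\<xi>. (cmod (g \<xi>))\<^sup>2)"
    and f2: "integrable lborel (\<lambda>x. (cmod (f x))\<^sup>2)"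
    and lim: "((\<lambda>R. \<integral>\<^sup>+ \<xi>. ennreal ((cmod (g \<xi> - fourier_integral (f\<^sub>R R) \<xi>))\<^sup>2) \<partial>lebesgue) \<longlongrightarrow> 0) at_top"
    using pl unfolding is_plancherel_transform_def in_Lp_2_iff f\<^sub>R_def
    by (auto simp: integrable_completion)
  have h2': "integrable lebesgue (\<lambda>\<xi>. (cmod (h \<xi>))\<^sup>2)"
    using h2 by (simp add: integrable_completion)
  have leb [measurable]: "h \<in> borel_measurable lebesgue" "\<And>R. fourier_integral (f\<^sub>R R) \<in> borel_measurable lebesgue"
    by (auto intro!: measurable_completion)
  have gh: "integrable lebesgue (\<lambda>\<xi>. g \<xi> * h \<xi>)"
    by (rule integrable_mult_L2) (use g2 h2' in auto)
  have f\<^sub>R1: "integrable lborel (f\<^sub>R R)" for R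
  proof (rule Bochner_Integration.integrable_bound)
    show "integrable lborel (\<lambda>x. indicator (ball 0 R) x + (cmod (f x))\<^sup>2 :: real)"
      using f2 emeasure_lborel_ball_finite[of 0 R] by (auto intro!: integrable_real_indicator)
    have "r \<le> 1 + r\<^sup>2" for r :: real
      using zero_le_power2[of "r - 1 / 2"] by (simp add: power2_eq_square algebra_simps)
    thus "AE x in lborel. cmod (f\<^sub>R R x) \<le> norm (indicator (ball 0 R) x + (cmod (f x))\<^sup>2 :: real)"
      by (auto simp: f\<^sub>R_def abs_of_nonneg)
  qed measurable
  define I where "I R = (\<integral>x. f\<^sub>R R x * fourier_integral h x \<partial>lborel)" for R
  have F\<^sub>Rh: "integrable lborel (\<lambda>\<xi>. fourier_integral (f\<^sub>R R) \<xi> * h \<xi>)" for R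
  proof (rule Bochner_Integration.integrable_bound)
    show "integrable lborel (\<lambda>\<xi>. (\<integral>x. norm (f\<^sub>R R x) \<partial>lborel) *\<^sub>R h \<xi>)"
      using h1 by auto
    show "AE \<xi> in lborel. norm (fourier_integral (f\<^sub>R R) \<xi> * h \<xi>) \<le> norm ((\<integral>x. norm (f\<^sub>R R x) \<partial>lborel) *\<^sub>R h \<xi>)"
      using norm_fourier_integral_le[OF f\<^sub>R1]
      by (auto simp: norm_mult abs_of_nonneg intro!: mult_right_mono)
  qed measurable
  have I: "I R = (\<integral>\<xi>. fourier_integral (f\<^sub>R R) \<xi> * h \<xi> \<partial>lebesgue)" for R
    unfolding I_def fourier_integral_multiplication[OF f\<^sub>R1 h1, symmetric]
    by (rule integral_completion[symmetric]) measurable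
  have bound: "(ennreal (cmod ((\<integral>\<xi>. g \<xi> * h \<xi> \<partial>lebesgue) - I R)))\<^sup>2
      \<le> (\<integral>\<^sup>+ \<xi>. ennreal ((cmod (g \<xi> - fourier_integral (f\<^sub>R R) \<xi>))\<^sup>2) \<partial>lebesgue)
        * (\<integral>\<^sup>+ \<xi>. ennreal ((cmod (h \<xi>))\<^sup>2) \<partial>lebesgue)" for R
  proof -
    have "integrable lebesgue (\<lambda>\<xi>. fourier_integral (f\<^sub>R R) \<xi> * h \<xi>)"
      using F\<^sub>Rh by (subst integrable_completion) auto
    hence *: "(\<integral>\<xi>. g \<xi> * h \<xi> \<partial>lebesgue) - I R = (\<integral>\<xi>. (g \<xi> - fourier_integral (f\<^sub>R R) \<xi>) * h \<xi> \<partial>lebesgue)"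
      and **: "integrable lebesgue (\<lambda>\<xi>. (g \<xi> - fourier_integral (f\<^sub>R R) \<xi>) * h \<xi>)"
      unfolding I using gh by (auto simp: left_diff_distrib)
    have "ennreal (cmod ((\<integral>\<xi>. g \<xi> * h \<xi> \<partial>lebesgue) - I R))
        \<le> (\<integral>\<^sup>+ \<xi>. ennreal (cmod (g \<xi> - fourier_integral (f\<^sub>R R) \<xi>)) * ennreal (cmod (h \<xi>)) \<partial>lebesgue)"
      unfolding * using integral_norm_bound_ennreal[OF **] by (simp add: norm_mult ennreal_mult)
    hence "(ennreal (cmod ((\<integral>\<xi>. g \<xi> * h \<xi> \<partial>lebesgue) - I R)))\<^sup>2
        \<le> (\<integral>\<^sup>+ \<xi>. ennreal (cmod (g \<xi> - fourier_integral (f\<^sub>R R) \<xi>)) * ennreal (cmod (h \<xi>)) \<partial>lebesgue)\<^sup>2"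
      by (rule power_mono) simp
    also note Cauchy_Schwarz_nn_integral
    finally show ?thesis by (simp add: ennreal_power)
  qed
  have "(\<integral>\<^sup>+ \<xi>. ennreal ((cmod (h \<xi>))\<^sup>2) \<partial>lebesgue) < \<infinity>"
    using h2' by (auto simp: integrable_iff_bounded)
  hence "((\<lambda>R. (\<integral>\<^sup>+ \<xi>. ennreal ((cmod (g \<xi> - fourier_integral (f\<^sub>R R) \<xi>))\<^sup>2) \<partial>lebesgue)
        * (\<integral>\<^sup>+ \<xi>. ennreal ((cmod (h \<xi>))\<^sup>2) \<partial>lebesgue)) \<longlongrightarrow> 0 * (\<integral>\<^sup>+ \<xi>. ennreal ((cmod (h \<xi>))\<^sup>2) \<partial>lebesgue)) at_top"
    by (intro tendsto_mult_ennreal lim tendsto_const) auto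
  hence lim0: "((\<lambda>R. (\<integral>\<^sup>+ \<xi>. ennreal ((cmod (g \<xi> - fourier_integral (f\<^sub>R R) \<xi>))\<^sup>2) \<partial>lebesgue)
        * (\<integral>\<^sup>+ \<xi>. ennreal ((cmod (h \<xi>))\<^sup>2) \<partial>lebesgue)) \<longlongrightarrow> 0) at_top"
    by simp
  have "((\<lambda>R. (ennreal (cmod ((\<integral>\<xi>. g \<xi> * h \<xi> \<partial>lebesgue) - I R)))\<^sup>2) \<longlongrightarrow> 0) at_top"
    by (rule tendsto_sandwich[OF always_eventually always_eventually tendsto_const lim0])
      (auto intro: bound)
  hence "((\<lambda>R. ennreal ((cmod ((\<integral>\<xi>. g \<xi> * h \<xi> \<partial>lebesgue) - I R))\<^sup>2)) \<longlongrightarrow> ennreal 0) at_top"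
    by (simp add: ennreal_power)
  hence "((\<lambda>R. (cmod ((\<integral>\<xi>. g \<xi> * h \<xi> \<partial>lebesgue) - I R))\<^sup>2) \<longlongrightarrow> 0) at_top"
    by (subst (asm) tendsto_ennreal_iff) auto
  hence "((\<lambda>R. sqrt ((cmod ((\<integral>\<xi>. g \<xi> * h \<xi> \<partial>lebesgue) - I R))\<^sup>2)) \<longlongrightarrow> sqrt 0) at_top"
    by (rule tendsto_real_sqrt)
  hence "((\<lambda>R. (\<integral>\<xi>. g \<xi> * h \<xi> \<partial>lebesgue) - I R) \<longlongrightarrow> 0) at_top"
    by (simp add: tendsto_norm_zero_iff)
  from tendsto_diff[OF tendsto_const this, of "\<integral>\<xi>. g \<xi> * h \<xi> \<partial>lebesgue"]
  have lim1: "(I \<longlongrightarrow> (\<integral>\<xi>. g \<xi> * h \<xi> \<partial>lebesgue)) at_top" by simp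
  have lim2: "(I \<longlongrightarrow> (\<integral>x. f x * fourier_integral h x \<partial>lborel)) at_top"
    unfolding I_def
  proof (rule integral_dominated_convergence_at_top)
    show "integrable lborel (\<lambda>x. norm (f x * fourier_integral h x))"
      by (intro integrable_norm integrable_mult_L2) (use f2 Fh2 in auto)
    show "AE x in lborel. ((\<lambda>R. f\<^sub>R R x * fourier_integral h x) \<longlongrightarrow> f x * fourier_integral h x) at_top"
    proof (rule AE_I2, rule tendsto_eventually)
      fix x show "\<forall>\<^sub>F R in at_top. f\<^sub>R R x * fourier_integral h x = f x * fourier_integral h x"
        using eventually_gt_at_top[of "norm x"] by eventually_elim (auto simp: f\<^sub>R_def)
    qed
    show "\<forall>\<^sub>F R in at_top. AE x in lborel. norm (f\<^sub>R R x * fourier_integral h x) \<le> norm (f x * fourier_integral h x)"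
      by (auto simp: f\<^sub>R_def intro!: always_eventually)
  qed measurable
  show ?thesis by (rule tendsto_unique[OF _ lim1 lim2]) simp
qed

lemma norm_cis_diff_le: "cmod (cis s - cis t) \<le> \<bar>s - t\<bar>"
proof -
  have "cmod (cis s - cis t) = cmod (cis t * (exp (\<i> * of_real (s - t)) - 1))"
    by (simp add: cis_conv_exp[symmetric] cis_mult right_diff_distrib del: of_real_diff)
  also have "\<dots> = cmod (exp (\<i> * of_real (s - t)) - 1)" by (simp add: norm_mult)
  also have "\<dots> \<le> \<bar>s - t\<bar>" using iexp_approx1[of "s - t" 0] by simp
  finally show ?thesis .
qed

text \<open>
  Pair the transform \<open>g\<close> with the damped character \<open>h(\<xi>) = e\<^sup>i\<^sup>x\<^sup>\<xi> exp(-\<sigma>\<^sup>2|\<xi>|\<^sup>2/2)\<close>, whose Fourier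
  integral is a Gaussian \<open>K(x - y)\<close> concentrating at \<open>y = x\<close> as \<open>\<sigma> \<rightarrow> 0\<close>.  Since \<open>f\<close> is not known
  to be bounded, the convolution with \<open>K\<close> is split at distance \<open>1\<close> from \<open>x\<close>: near \<open>x\<close> continuity
  gives the limit, and far from \<open>x\<close> the kernel is a vanishing multiple of a fixed Gaussian, which
  can be integrated against the square integrable \<open>f\<close>.
\<close>

lemma fourier_inversion:
  fixes f g :: "'a::euclidean_space \<Rightarrow> complex"
  assumes pl: "is_plancherel_transform f g" and cont: "continuous_on UNIV f"
    and g1: "integrable lebesgue g"
  shows "(\<integral>\<xi>. g \<xi> * cis (x \<bullet> \<xi>) \<partial>lebesgue) = (2 * pi) ^ DIM('a) * f x"
proof -
  have f_meas [measurable]: "f \<in> borel_measurable borel"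
    using cont by (rule borel_measurable_continuous_onI)
  have g_meas [measurable]: "g \<in> borel_measurable lebesgue"
    and f2: "integrable lborel (\<lambda>x. (cmod (f x))\<^sup>2)"
    using pl unfolding is_plancherel_transform_def in_Lp_2_iff
    by (auto simp: integrable_completion)
  define n where "n = DIM('a)"
  define E :: "real \<Rightarrow> 'a \<Rightarrow> real" where "E \<sigma> z = exp (- (\<sigma> * norm z)\<^sup>2 / 2)" for \<sigma> z
  define K :: "real \<Rightarrow> 'a \<Rightarrow> real" where "K \<sigma> z = (sqrt (2 * pi) / \<sigma>) ^ n * exp (- (norm z / \<sigma>)\<^sup>2 / 2)" for \<sigma> z
  define h where "h \<sigma> \<xi> = cis (x \<bullet> \<xi>) * complex_of_real (E \<sigma> \<xi>)" for \<sigma> \<xi>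
  have E_meas [measurable]: "E \<sigma> \<in> borel_measurable borel" for \<sigma> unfolding E_def by measurable
  have K_meas [measurable]: "K \<sigma> \<in> borel_measurable borel" for \<sigma> unfolding K_def by measurable
  have h_meas [measurable]: "h \<sigma> \<in> borel_measurable borel" for \<sigma> unfolding h_def by measurable
  have E_int: "integrable lborel (E \<sigma>)" if "\<sigma> > 0" for \<sigma>
    using integrable_gaussian[OF that] by (simp add: E_def[abs_def])
  have E_sq: "(E \<sigma> z)\<^sup>2 = E (sqrt 2 * \<sigma>) z" for \<sigma> z
    by (simp add: E_def power2_eq_square exp_add[symmetric] algebra_simps)
  have Fh: "fourier_integral (h \<sigma>) y = K \<sigma> (x - y)" if "\<sigma> > 0" for \<sigma> y
  proof -
    have "cis (- (\<xi> \<bullet> y)) * h \<sigma> \<xi> = cis ((x - y) \<bullet> \<xi>) * complex_of_real (exp (- (\<sigma> * norm \<xi>)\<^sup>2 / 2))" for \<xi>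
      by (simp add: h_def E_def inner_diff_left inner_commute[of \<xi>] cis_mult mult.assoc[symmetric])
    thus ?thesis
      using integral_cis_gaussian[OF that, of "x - y"] by (simp add: fourier_integral_lborel K_def n_def)
  qed
  have shift: "integrable lborel (\<lambda>y. F (x - y))" if "integrable lborel F" "\<And>z. F (- z) = F z" for F :: "'a \<Rightarrow> real"
  proof -
    have [measurable]: "F \<in> borel_measurable borel" using borel_measurable_integrable[OF that(1)] by simp
    have "integrable lborel (\<lambda>z. F (- x + 1 *\<^sub>R z))"
      using that(1) by (subst lborel_integrable_affine_iff) auto
    moreover have "F (- x + 1 *\<^sub>R z) = F (x - z)" for z using that(2)[of "x - z"] by simp
    ultimately show ?thesis by simp
  qed
  have K_sq: "integrable lborel (\<lambda>y. (K \<sigma> (x - y))\<^sup>2)" if "\<sigma> > 0" for \<sigma>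
  proof -
    have eq: "(K \<sigma> z)\<^sup>2 = ((sqrt (2 * pi) / \<sigma>) ^ n)\<^sup>2 * E (sqrt 2 * (1 / \<sigma>)) z" for z
      unfolding E_sq[symmetric] by (simp add: K_def E_def power_mult_distrib)
    have "integrable lborel (\<lambda>y. E (sqrt 2 * (1 / \<sigma>)) (x - y))"
      using that by (intro shift E_int) (auto simp: E_def)
    thus ?thesis unfolding eq by (intro integrable_mult_right)
  qed
  have key: "(\<integral>\<xi>. g \<xi> * h \<sigma> \<xi> \<partial>lebesgue) = (\<integral>y. f y * K \<sigma> (x - y) \<partial>lborel)" if "\<sigma> > 0" for \<sigma>
  proof -
    have "integrable lborel (h \<sigma>)"
    proof (rule Bochner_Integration.integrable_bound)
      show "integrable lborel (E \<sigma>)" using E_int[OF that] .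
      show "AE \<xi> in lborel. cmod (h \<sigma> \<xi>) \<le> norm (E \<sigma> \<xi>)" by (simp add: h_def norm_mult)
    qed simp
    moreover have "integrable lborel (\<lambda>\<xi>. (cmod (h \<sigma> \<xi>))\<^sup>2)"
      using that by (simp add: h_def norm_mult E_sq E_int)
    moreover have "integrable lborel (\<lambda>y. (cmod (fourier_integral (h \<sigma>) y))\<^sup>2)"
      using K_sq[OF that] by (simp add: Fh[OF that])
    ultimately show ?thesis
      using plancherel_pairing[OF pl f_meas] by (simp add: Fh[OF that])
  qed
  define \<sigma> :: "nat \<Rightarrow> real" where "\<sigma> k = 1 / (real k + 1)" for k
  have \<sigma>_pos: "\<sigma> k > 0" for k by (simp add: \<sigma>_def)
  have \<sigma>_lim: "\<sigma> \<longlonglongrightarrow> 0" unfolding \<sigma>_def using LIMSEQ_inverse_real_of_nat by (simp add: inverse_eq_divide add.commute)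
  have lim_g: "(\<lambda>k. \<integral>\<xi>. g \<xi> * h (\<sigma> k) \<xi> \<partial>lebesgue) \<longlonglongrightarrow> (\<integral>\<xi>. g \<xi> * cis (x \<bullet> \<xi>) \<partial>lebesgue)"
  proof (rule integral_dominated_convergence)
    show "integrable lebesgue (\<lambda>\<xi>. cmod (g \<xi>))" using g1 by simp
    have 1: "(\<lambda>\<xi>. cis (x \<bullet> \<xi>)) \<in> borel_measurable borel" by measurable
    show "(\<lambda>\<xi>. g \<xi> * cis (x \<bullet> \<xi>)) \<in> borel_measurable lebesgue"
      using 1 by (intro borel_measurable_times g_meas measurable_completion) simp
    show "(\<lambda>\<xi>. g \<xi> * h (\<sigma> k) \<xi>) \<in> borel_measurable lebesgue" for k
      by (intro borel_measurable_times g_meas measurable_completion) simp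
    show "AE \<xi> in lebesgue. (\<lambda>k. g \<xi> * h (\<sigma> k) \<xi>) \<longlonglongrightarrow> g \<xi> * cis (x \<bullet> \<xi>)"
    proof (rule AE_I2)
      fix \<xi>
      have "(\<lambda>k. g \<xi> * (cis (x \<bullet> \<xi>) * complex_of_real (exp (- (\<sigma> k * norm \<xi>)\<^sup>2 / 2))))
          \<longlonglongrightarrow> g \<xi> * (cis (x \<bullet> \<xi>) * complex_of_real (exp (- (0 * norm \<xi>)\<^sup>2 / 2)))"
        by (intro tendsto_intros \<sigma>_lim) auto
      thus "(\<lambda>k. g \<xi> * h (\<sigma> k) \<xi>) \<longlonglongrightarrow> g \<xi> * cis (x \<bullet> \<xi>)" by (simp add: h_def E_def)
    qed
    show "AE \<xi> in lebesgue. norm (g \<xi> * h (\<sigma> k) \<xi>) \<le> cmod (g \<xi>)" for k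
      by (auto simp: h_def E_def norm_mult intro!: mult_left_le)
  qed
  define f\<^sub>1 where "f\<^sub>1 y = (if y \<in> ball x 1 then f y else 0)" for y
  define f\<^sub>2 where "f\<^sub>2 y = (if y \<in> ball x 1 then 0 else f y)" for y
  have [measurable]: "f\<^sub>1 \<in> borel_measurable borel" "f\<^sub>2 \<in> borel_measurable borel"
    unfolding f\<^sub>1_def f\<^sub>2_def by (auto intro!: measurable_If_set)
  have fK: "integrable lborel (\<lambda>y. f y * complex_of_real (K \<sigma> (x - y)))" if "\<sigma> > 0" for \<sigma>
    by (rule integrable_mult_L2) (use f2 K_sq[OF that] in auto)
  have split: "(\<integral>y. f y * K \<sigma> (x - y) \<partial>lborel)
      = (\<integral>y. f\<^sub>1 y * K \<sigma> (x - y) \<partial>lborel) + (\<integral>y. f\<^sub>2 y * K \<sigma> (x - y) \<partial>lborel)" if "\<sigma> > 0" for \<sigma>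
  proof -
    have 1: "integrable lborel (\<lambda>y. f\<^sub>1 y * complex_of_real (K \<sigma> (x - y)))"
      by (rule Bochner_Integration.integrable_bound[OF fK[OF that]]) (auto simp: f\<^sub>1_def)
    have 2: "integrable lborel (\<lambda>y. f\<^sub>2 y * complex_of_real (K \<sigma> (x - y)))"
      by (rule Bochner_Integration.integrable_bound[OF fK[OF that]]) (auto simp: f\<^sub>2_def)
    have "f y * complex_of_real (K \<sigma> (x - y))
        = f\<^sub>1 y * complex_of_real (K \<sigma> (x - y)) + f\<^sub>2 y * complex_of_real (K \<sigma> (x - y))" for y
      by (simp add: f\<^sub>1_def f\<^sub>2_def)
    thus ?thesis by (simp only: Bochner_Integration.integral_add[OF 1 2])
  qed
  have near: "(\<lambda>k. \<integral>y. f\<^sub>1 y * K (\<sigma> k) (x - y) \<partial>lborel) \<longlonglongrightarrow> (2 * pi) ^ n * f x"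
  proof -
    have "compact (f ` cball x 1)"
      by (rule compact_continuous_image) (use cont continuous_on_subset in auto)
    then obtain B where B: "\<And>y. y \<in> cball x 1 \<Longrightarrow> cmod (f y) \<le> B"
      by (metis bounded_iff compact_imp_bounded imageI)
    have Bf: "cmod (f\<^sub>1 y) \<le> B" for y
      using B[of y] B[of x] by (auto simp: f\<^sub>1_def intro: order_trans[OF norm_ge_zero])
    have eq: "(\<integral>y. f\<^sub>1 y * K (\<sigma> k) (x - y) \<partial>lborel)
        = sqrt (2 * pi) ^ n * (\<integral>z. f\<^sub>1 (x + \<sigma> k *\<^sub>R z) * E 1 z \<partial>lborel)" for k
    proof -
      have "\<sigma> k ^ n *\<^sub>R (f\<^sub>1 (x + \<sigma> k *\<^sub>R z) * complex_of_real (K (\<sigma> k) (x - (x + \<sigma> k *\<^sub>R z))))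
          = sqrt (2 * pi) ^ n * (f\<^sub>1 (x + \<sigma> k *\<^sub>R z) * E 1 z)" for z
        using \<sigma>_pos[of k] by (simp add: K_def E_def scaleR_conv_of_real power_divide)
      hence "(\<integral>z. \<sigma> k ^ n *\<^sub>R (f\<^sub>1 (x + \<sigma> k *\<^sub>R z) * complex_of_real (K (\<sigma> k) (x - (x + \<sigma> k *\<^sub>R z)))) \<partial>lborel)
          = (\<integral>z. sqrt (2 * pi) ^ n * (f\<^sub>1 (x + \<sigma> k *\<^sub>R z) * E 1 z) \<partial>lborel)"
        by simp
      thus ?thesis
        by (subst lborel_integral_affine[OF \<sigma>_pos[of k], where x = x]) (simp_all add: n_def)
    qed
    have "(\<lambda>k. \<integral>z. f\<^sub>1 (x + \<sigma> k *\<^sub>R z) * complex_of_real (E 1 z) \<partial>lborel) \<longlonglongrightarrow> (\<integral>z. f x * complex_of_real (E 1 z) \<partial>lborel)"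
    proof (rule integral_dominated_convergence)
      show "integrable lborel (\<lambda>z. B * E 1 z)" using E_int[of 1] by simp
      show "AE z in lborel. (\<lambda>k. f\<^sub>1 (x + \<sigma> k *\<^sub>R z) * complex_of_real (E 1 z)) \<longlonglongrightarrow> f x * complex_of_real (E 1 z)"
      proof (rule AE_I2, intro tendsto_intros)
        fix z
        have lim: "(\<lambda>k. x + \<sigma> k *\<^sub>R z) \<longlonglongrightarrow> x"
          using tendsto_add[OF tendsto_const tendsto_scaleR[OF \<sigma>_lim tendsto_const], of x z] by simp
        have "isCont f x" using cont by (simp add: continuous_on_eq_continuous_at)
        from isCont_tendsto_compose[OF this lim]
        have "(\<lambda>k. f (x + \<sigma> k *\<^sub>R z)) \<longlonglongrightarrow> f x" .
        moreover have "\<forall>\<^sub>F k in sequentially. x + \<sigma> k *\<^sub>R z \<in> ball x 1"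
          by (rule topological_tendstoD[OF lim]) auto
        hence "\<forall>\<^sub>F k in sequentially. f (x + \<sigma> k *\<^sub>R z) = f\<^sub>1 (x + \<sigma> k *\<^sub>R z)"
          by eventually_elim (auto simp: f\<^sub>1_def)
        ultimately show "(\<lambda>k. f\<^sub>1 (x + \<sigma> k *\<^sub>R z)) \<longlonglongrightarrow> f x" by (rule Lim_transform_eventually)
      qed
      show "AE z in lborel. cmod (f\<^sub>1 (x + \<sigma> k *\<^sub>R z) * complex_of_real (E 1 z)) \<le> B * E 1 z" for k
        by (auto simp: norm_mult E_def intro!: mult_right_mono Bf)
    qed measurable
    hence lim: "(\<lambda>k. \<integral>y. f\<^sub>1 y * K (\<sigma> k) (x - y) \<partial>lborel)
        \<longlonglongrightarrow> sqrt (2 * pi) ^ n * (\<integral>z. f x * complex_of_real (E 1 z) \<partial>lborel)"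
      unfolding eq by (intro tendsto_intros)
    have "(\<integral>z. complex_of_real (E 1 z) \<partial>lborel) = sqrt (2 * pi) ^ n"
      using integral_cis_gaussian[of 1 "0::'a"] by (simp add: E_def n_def)
    hence "(\<integral>z. f x * complex_of_real (E 1 z) \<partial>lborel) = f x * sqrt (2 * pi) ^ n"
      by simp
    moreover have "of_real a ^ n * (c * of_real a ^ n) = of_real ((a * a) ^ n) * c" for a and c :: complex
      by (simp add: power_mult_distrib)
    from this[of "sqrt (2 * pi)" "f x"]
    have "of_real (sqrt (2 * pi) ^ n) * (f x * sqrt (2 * pi) ^ n) = (2 * pi) ^ n * f x" by simp
    ultimately have "sqrt (2 * pi) ^ n * (\<integral>z. f x * complex_of_real (E 1 z) \<partial>lborel) = (2 * pi) ^ n * f x"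
      by (simp only:)
    thus ?thesis using lim by (simp only:)
  qed
  have far: "(\<lambda>k. \<integral>y. f\<^sub>2 y * K (\<sigma> k) (x - y) \<partial>lborel) \<longlonglongrightarrow> 0"
  proof -
    define a where "a k = sqrt (2 * pi) ^ n * 4 ^ n * (((real k + 1)\<^sup>2 / 4) ^ n / exp ((real k + 1)\<^sup>2 / 4))" for k
    have "filterlim (\<lambda>k. (real k + 1)\<^sup>2 / 4) at_top sequentially" by real_asymp
    hence "a \<longlonglongrightarrow> sqrt (2 * pi) ^ n * 4 ^ n * 0"
      unfolding a_def by (intro tendsto_mult_left filterlim_compose[OF tendsto_power_div_exp_0])
    hence a0: "a \<longlonglongrightarrow> 0" by simp
    define M where "M = (\<integral>y. cmod (f y) * E (1 / sqrt 2) (x - y) \<partial>lborel)"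
    have Mint: "integrable lborel (\<lambda>y. cmod (f y) * E (1 / sqrt 2) (x - y))"
    proof (rule integrable_mult_L2)
      show "integrable lborel (\<lambda>y. (norm (E (1 / sqrt 2) (x - y)))\<^sup>2)"
        using shift[OF E_int[of 1]] by (simp add: E_sq) (simp add: E_def)
    qed (use f2 in auto)
    \<comment> \<open>Half of the exponent \<open>|z|\<^sup>2/(2\<sigma>\<^sup>2)\<close> is at least \<open>1/(4\<sigma>\<^sup>2)\<close>, which beats \<open>\<sigma>\<^sup>-\<^sup>n\<close>; the other half is at least \<open>|z|\<^sup>2/4\<close>.\<close>
    have Kle: "K (\<sigma> k) z \<le> a k * E (1 / sqrt 2) z" if "norm z \<ge> 1" for z k
    proof -
      define s where "s = (real k + 1)\<^sup>2"
      have s1: "s \<ge> 1" unfolding s_def by simp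
      have "(norm z)\<^sup>2 \<ge> 1" using that by simp
      hence "s * (norm z)\<^sup>2 / 4 \<ge> s / 4" "s * (norm z)\<^sup>2 / 4 \<ge> (norm z)\<^sup>2 / 4"
        using s1 mult_left_mono[of 1 "(norm z)\<^sup>2" s] mult_right_mono[of 1 s "(norm z)\<^sup>2"] by auto
      hence "- (s * (norm z)\<^sup>2) / 2 \<le> - (s / 4) + - ((norm z)\<^sup>2 / 4)" by linarith
      hence "exp (- (s * (norm z)\<^sup>2) / 2) \<le> exp (- (s / 4)) * exp (- ((norm z)\<^sup>2 / 4))"
        by (simp add: exp_add[symmetric])
      moreover have "(real k + 1) ^ n \<le> s ^ n"
        unfolding s_def by (intro power_mono) (auto simp: power2_eq_square)
      ultimately have "(real k + 1) ^ n * exp (- (s * (norm z)\<^sup>2) / 2)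
          \<le> s ^ n * (exp (- (s / 4)) * exp (- ((norm z)\<^sup>2 / 4)))"
        using s1 by (intro mult_mono) auto
      hence "sqrt (2 * pi) ^ n * ((real k + 1) ^ n * exp (- (s * (norm z)\<^sup>2) / 2))
          \<le> sqrt (2 * pi) ^ n * (s ^ n * (exp (- (s / 4)) * exp (- ((norm z)\<^sup>2 / 4))))"
        by (intro mult_left_mono) auto
      moreover have "K (\<sigma> k) z = sqrt (2 * pi) ^ n * ((real k + 1) ^ n * exp (- (s * (norm z)\<^sup>2) / 2))"
        by (simp add: K_def \<sigma>_def s_def power_mult_distrib mult_ac)
      moreover have "a k = sqrt (2 * pi) ^ n * 4 ^ n * ((s / 4) ^ n / exp (s / 4))"
        by (simp only: a_def s_def)
      hence "a k * E (1 / sqrt 2) z = sqrt (2 * pi) ^ n * (s ^ n * (exp (- (s / 4)) * exp (- ((norm z)\<^sup>2 / 4))))"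
        by (simp add: E_def power_divide exp_minus field_simps)
      ultimately show ?thesis by simp
    qed
    have a_nonneg: "a k \<ge> 0" for k by (simp add: a_def)
    have bd: "cmod (\<integral>y. f\<^sub>2 y * K (\<sigma> k) (x - y) \<partial>lborel) \<le> a k * M" for k
    proof -
      have "cmod (\<integral>y. f\<^sub>2 y * K (\<sigma> k) (x - y) \<partial>lborel) \<le> (\<integral>y. a k * (cmod (f y) * E (1 / sqrt 2) (x - y)) \<partial>lborel)"
      proof (rule order_trans[OF integral_norm_bound integral_mono])
        show "integrable lborel (\<lambda>y. cmod (f\<^sub>2 y * complex_of_real (K (\<sigma> k) (x - y))))"
          by (rule integrable_norm, rule Bochner_Integration.integrable_bound[OF fK[OF \<sigma>_pos]]) (auto simp: f\<^sub>2_def)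
        show "integrable lborel (\<lambda>y. a k * (cmod (f y) * E (1 / sqrt 2) (x - y)))" using Mint by simp
        fix y
        have "cmod (f\<^sub>2 y * complex_of_real (K (\<sigma> k) (x - y))) \<le> cmod (f y) * (a k * E (1 / sqrt 2) (x - y))"
        proof (cases "y \<in> ball x 1")
          case True
          thus ?thesis by (simp add: f\<^sub>2_def a_nonneg E_def)
        next
          case False
          hence "1 \<le> norm (x - y)" by (simp add: dist_norm)
          moreover have "0 \<le> K (\<sigma> k) (x - y)" using \<sigma>_pos[of k] by (simp add: K_def)
          ultimately show ?thesis using Kle[of "x - y" k] False
            by (auto simp: f\<^sub>2_def norm_mult intro!: mult_left_mono)
        qed
        thus "cmod (f\<^sub>2 y * complex_of_real (K (\<sigma> k) (x - y))) \<le> a k * (cmod (f y) * E (1 / sqrt 2) (x - y))"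
          by (simp add: mult_ac)
      qed
      thus ?thesis by (simp add: M_def)
    qed
    have "(\<lambda>k. a k * M) \<longlonglongrightarrow> 0" using tendsto_mult_right[OF a0, of M] by simp
    thus ?thesis by (rule Lim_null_comparison[OF always_eventually, rotated]) (intro allI bd)
  qed
  have "(\<lambda>k. \<integral>\<xi>. g \<xi> * h (\<sigma> k) \<xi> \<partial>lebesgue) \<longlonglongrightarrow> (2 * pi) ^ n * f x + 0"
    unfolding key[OF \<sigma>_pos] split[OF \<sigma>_pos] by (intro tendsto_add near far)
  from LIMSEQ_unique[OF lim_g this] show ?thesis by (simp add: n_def)
qed

section \<open>Sobolev embedding\<close>

lemma integrable_one_plus_sq_powr_real:
  assumes "r > 1 / 2"
  shows "integrable lborel (\<lambda>t::real. (1 + t\<^sup>2) powr - r)"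
proof (rule Bochner_Integration.integrable_bound)
  define h :: "real \<Rightarrow> real" where "h t = indicator {1..} t *\<^sub>R t powr (- (2 * r))" for t
  have [measurable]: "h \<in> borel_measurable borel" unfolding h_def by measurable
  have "(\<lambda>t. t powr (- (2 * r))) integrable_on {1::real..}"
    using has_integral_powr_to_inf[of "- (2 * r)" 1] assms by (auto simp: integrable_on_def)
  hence "set_integrable lebesgue {1..} (\<lambda>t::real. t powr (- (2 * r)))"
    by (intro nonnegative_absolutely_integrable_1) auto
  hence h: "integrable lborel h"
    unfolding set_integrable_def h_def[abs_def, symmetric] by (subst (asm) integrable_completion) auto
  hence h': "integrable lborel (\<lambda>t. h (- t))"
    using lborel_integrable_real_affine[OF h, of "-1" 0] by simp
  show "integrable lborel (\<lambda>t. indicator {-1..1} t + h t + h (- t))"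
    using h h' by (auto intro!: integrable_real_indicator)
  have le: "(1 + t\<^sup>2) powr - r \<le> indicator {-1..1} t + h t + h (- t)" for t
  proof -
    have h0: "h s \<ge> 0" for s by (simp add: h_def)
    consider "\<bar>t\<bar> \<le> 1" | "t > 1" | "t < -1" by linarith
    thus ?thesis
    proof cases
      case 1
      have "(1 + t\<^sup>2) powr - r \<le> 1 powr - r" using assms by (intro powr_mono2') auto
      thus ?thesis using 1 h0[of t] h0[of "- t"] by (simp add: indicator_def abs_le_iff)
    next
      case 2
      have "(1 + t\<^sup>2) powr - r \<le> (t powr 2) powr - r" using assms 2 by (intro powr_mono2') auto
      also have "(t powr 2) powr - r = t powr (- (2 * r))" by (simp only: powr_powr mult_minus_right)
      also have "\<dots> = h t" using 2 by (simp add: h_def)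
      finally show ?thesis using 2 h0[of "- t"] by simp
    next
      case 3
      have "(1 + t\<^sup>2) powr - r \<le> ((- t) powr 2) powr - r" using assms 3 by (intro powr_mono2') auto
      also have "((- t) powr 2) powr - r = (- t) powr (- (2 * r))" by (simp only: powr_powr mult_minus_right)
      also have "\<dots> = h (- t)" using 3 by (simp add: h_def)
      finally show ?thesis using 3 h0[of t] by simp
    qed
  qed
  have "0 \<le> (1 + t\<^sup>2) powr - r" for t by simp
  thus "AE t in lborel. norm ((1 + t\<^sup>2) powr - r) \<le> norm (indicator {-1..1} t + h t + h (- t))"
    using le by (auto intro: order_trans[OF le abs_ge_self])
qed measurable

text \<open>
  Each factor \<open>1 + x\<^sub>b\<^sup>2\<close> is at most \<open>1 + |x|\<^sup>2\<close>, so the function is dominated by a product of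
  one-dimensional functions with exponent \<open>q/n > 1/2\<close>, where \<open>n\<close> is the dimension.
\<close>

lemma integrable_one_plus_norm_sq_powr:
  assumes "q > DIM('a) / 2"
  shows "integrable lborel (\<lambda>x::'a::euclidean_space. (1 + (norm x)\<^sup>2) powr - q)"
proof (rule Bochner_Integration.integrable_bound)
  define r where "r = q / DIM('a)"
  have r: "r > 1 / 2" using assms by (simp add: r_def field_simps)
  have D: "real DIM('a) * r = q" by (simp add: r_def)
  show "integrable lborel (\<lambda>x::'a. \<Prod>b\<in>Basis. (1 + (x \<bullet> b)\<^sup>2) powr - r)"
    by (rule integrable_lborel_prod, rule integrable_one_plus_sq_powr_real[OF r])
  have "(1 + (norm x)\<^sup>2) powr - q \<le> (\<Prod>b\<in>Basis. (1 + (x \<bullet> b)\<^sup>2) powr - r)" for x :: 'a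
  proof -
    have "(1 + (norm x)\<^sup>2) powr - q = ((1 + (norm x)\<^sup>2) powr - r) ^ DIM('a)"
    proof -
      have "0 < 1 + (norm x)\<^sup>2" by (simp add: add_pos_nonneg)
      hence "((1 + (norm x)\<^sup>2) powr - r) ^ DIM('a) = ((1 + (norm x)\<^sup>2) powr - r) powr real DIM('a)"
        by (subst powr_realpow) auto
      also have "\<dots> = (1 + (norm x)\<^sup>2) powr - q" by (simp only: powr_powr D[symmetric]) (simp add: mult.commute)
      finally show ?thesis by simp
    qed
    also have "\<dots> = (\<Prod>b\<in>(Basis::'a set). (1 + (norm x)\<^sup>2) powr - r)" by simp
    also have "\<dots> \<le> (\<Prod>b\<in>Basis. (1 + (x \<bullet> b)\<^sup>2) powr - r)"
    proof (rule prod_mono, intro conjI)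
      fix b :: 'a assume "b \<in> Basis"
      hence "(x \<bullet> b)\<^sup>2 \<le> (norm x)\<^sup>2" using Basis_le_norm[of b x] by (simp add: abs_le_square_iff[symmetric])
      thus "(1 + (norm x)\<^sup>2) powr - r \<le> (1 + (x \<bullet> b)\<^sup>2) powr - r"
        using r by (intro powr_mono2') (auto simp: add_pos_nonneg)
    qed simp
    finally show ?thesis .
  qed
  thus "AE x in lborel. norm ((1 + (norm (x::'a))\<^sup>2) powr - q) \<le> norm (\<Prod>b\<in>Basis. (1 + (x \<bullet> b)\<^sup>2) powr - r)"
    by (auto intro: order_trans[OF _ abs_ge_self])
qed measurable

text \<open>
  By the Cauchy--Schwarz inequality against \<open>(1 + |\<xi>|\<^sup>2)\<^bsup>(1-m)/2\<^esup>\<close>, which is square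
  integrable exactly because \<open>m - 1 > n/2\<close> in dimension \<open>n\<close>.
\<close>

lemma weighted_L2_imp_integrable:
  fixes g :: "'a::euclidean_space \<Rightarrow> complex"
  assumes g [measurable]: "g \<in> borel_measurable lebesgue"
    and "in_Lp 2 (\<lambda>\<xi>. (1 + (norm \<xi>)\<^sup>2) powr (m / 2) *\<^sub>R g \<xi>)" and m: "m > DIM('a) / 2 + 1"
  shows "integrable lebesgue (\<lambda>\<xi>. (1 + norm \<xi>) * cmod (g \<xi>))"
proof (rule Bochner_Integration.integrable_bound)
  define w :: "'a \<Rightarrow> real" where "w \<xi> = 1 + (norm \<xi>)\<^sup>2" for \<xi>
  have w: "w \<xi> \<ge> 1" for \<xi> by (simp add: w_def)
  have wm: "(\<lambda>\<xi>. w \<xi> powr p) \<in> borel_measurable lebesgue" for p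
    by (rule measurable_completion) (simp add: w_def)
  have nm: "(norm :: 'a \<Rightarrow> real) \<in> borel_measurable lebesgue"
    by (rule measurable_completion) simp
  have "integrable lebesgue (\<lambda>\<xi>. (w \<xi> powr (m / 2) * cmod (g \<xi>)) * w \<xi> powr ((1 - m) / 2))"
  proof (rule integrable_mult_L2)
    show "integrable lebesgue (\<lambda>\<xi>. (norm (w \<xi> powr (m / 2) * cmod (g \<xi>)))\<^sup>2)"
      using assms(2) unfolding in_Lp_2_iff w_def by simp
    have "(norm (w \<xi> powr ((1 - m) / 2)))\<^sup>2 = w \<xi> powr - (m - 1)" for \<xi>
      by (simp add: power2_eq_square powr_add[symmetric])
    moreover have "integrable lebesgue (\<lambda>\<xi>. w \<xi> powr - (m - 1))"
      using integrable_one_plus_norm_sq_powr[of "m - 1", where 'a = 'a] m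
      unfolding w_def by (subst integrable_completion) auto
    ultimately show "integrable lebesgue (\<lambda>\<xi>. (norm (w \<xi> powr ((1 - m) / 2)))\<^sup>2)" by simp
  qed (use wm in auto)
  thus "integrable lebesgue (\<lambda>\<xi>. 2 * ((w \<xi> powr (m / 2) * cmod (g \<xi>)) * w \<xi> powr ((1 - m) / 2)))"
    by (rule integrable_mult_right)
  have "(1 + norm \<xi>) * cmod (g \<xi>) \<le> 2 * ((w \<xi> powr (m / 2) * cmod (g \<xi>)) * w \<xi> powr ((1 - m) / 2))" for \<xi>
  proof -
    have "norm \<xi> \<le> sqrt (w \<xi>)" by (rule real_le_rsqrt) (simp add: w_def)
    moreover have "1 \<le> sqrt (w \<xi>)" using w[of \<xi>] by simp
    ultimately have "1 + norm \<xi> \<le> 2 * sqrt (w \<xi>)" by linarith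
    also have "sqrt (w \<xi>) = w \<xi> powr (m / 2 + (1 - m) / 2)"
      using w[of \<xi>] by (simp add: powr_half_sqrt add_divide_distrib[symmetric])
    finally have "1 + norm \<xi> \<le> 2 * w \<xi> powr (m / 2 + (1 - m) / 2)" .
    hence "(1 + norm \<xi>) * cmod (g \<xi>) \<le> (2 * w \<xi> powr (m / 2 + (1 - m) / 2)) * cmod (g \<xi>)"
      by (intro mult_right_mono) auto
    thus ?thesis by (simp add: powr_add mult_ac)
  qed
  thus "AE \<xi> in lebesgue. norm ((1 + norm \<xi>) * cmod (g \<xi>))
      \<le> norm (2 * ((w \<xi> powr (m / 2) * cmod (g \<xi>)) * w \<xi> powr ((1 - m) / 2)))"
    by (auto simp: abs_mult intro!: AE_I2)
  show "(\<lambda>\<xi>. (1 + norm \<xi>) * cmod (g \<xi>)) \<in> borel_measurable lebesgue" using nm by measurable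
qed

lemma derivative_bound_of_Lipschitz_at:
  fixes f :: "'a::real_normed_vector \<Rightarrow> 'b::real_normed_vector"
  assumes "(f has_derivative f') (at x)" and L: "\<And>h. norm (f (x + h) - f x) \<le> L * norm h"
  shows "norm (f' h) \<le> L * norm h"
proof (cases "h = 0")
  case True
  thus ?thesis using has_derivative_bounded_linear[OF assms(1)] by (simp add: linear_simps)
next
  case h: False
  have lin: "bounded_linear f'"
    and approx: "\<And>e. e > 0 \<Longrightarrow> \<exists>d>0. \<forall>y. norm (y - x) < d \<longrightarrow> norm (f y - f x - f' (y - x)) \<le> e * norm (y - x)"
    using assms(1) unfolding has_derivative_at_alt by auto
  have "norm (f' h) / norm h \<le> L + e" if e: "e > 0" for e
  proof -
    obtain d where d: "d > 0" "\<And>y. norm (y - x) < d \<Longrightarrow> norm (f y - f x - f' (y - x)) \<le> e * norm (y - x)"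
      using approx[OF e] by blast
    define t where "t = d / (2 * norm h)"
    have t: "t > 0" "norm (t *\<^sub>R h) < d" using d h by (auto simp: t_def)
    have "norm (f' (t *\<^sub>R h)) \<le> norm (f (x + t *\<^sub>R h) - f x) + norm (f (x + t *\<^sub>R h) - f x - f' (t *\<^sub>R h))"
      using norm_triangle_ineq4[of "f (x + t *\<^sub>R h) - f x" "f (x + t *\<^sub>R h) - f x - f' (t *\<^sub>R h)"] by simp
    also have "\<dots> \<le> L * norm (t *\<^sub>R h) + e * norm (t *\<^sub>R h)"
      using d(2)[of "x + t *\<^sub>R h"] t by (intro add_mono L) auto
    also have "norm (f' (t *\<^sub>R h)) = t * norm (f' h)"
      using t lin by (simp add: linear_simps)
    finally have "t * norm (f' h) \<le> t * ((L + e) * norm h)" using t by (simp add: algebra_simps)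
    hence "norm (f' h) \<le> (L + e) * norm h" using t by simp
    thus ?thesis using h by (simp add: divide_simps)
  qed
  hence "norm (f' h) / norm h \<le> L" by (rule field_le_epsilon)
  thus ?thesis using h by (simp add: divide_simps)
qed

text \<open>
  A value of size \<open>e\<close> at \<open>x\<close> forces \<open>|f| \<ge> e/2\<close> on a ball about \<open>x\<close> of radius independent of \<open>x\<close>,
  hence a fixed amount of \<open>L\<^sup>2\<close> mass; far out there is not enough mass left.
\<close>

lemma Lipschitz_L2_vanishes_at_infinity:
  fixes f :: "'a::euclidean_space \<Rightarrow> 'b::{banach, second_countable_topology}"
  assumes L: "\<And>x y. norm (f x - f y) \<le> L * norm (x - y)"
    and f2: "integrable lborel (\<lambda>x. (norm (f x))\<^sup>2)"
  shows "(f \<longlongrightarrow> 0) at_infinity"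
proof -
  define M where "M = max L 1"
  have M: "M > 0" "\<And>x y. norm (f x - f y) \<le> M * norm (x - y)"
    using order_trans[OF L mult_right_mono[of L M]] by (auto simp: M_def)
  have [measurable]: "(\<lambda>x. (norm (f x))\<^sup>2) \<in> borel_measurable borel"
    using borel_measurable_integrable[OF f2] by simp
  define tl where "tl R = (\<integral>x. (if norm x < R then 0 else (norm (f x))\<^sup>2) \<partial>lborel)" for R
  have meas: "(\<lambda>x. if norm x < R then 0 else (norm (f x))\<^sup>2) \<in> borel_measurable borel" for R
    by measurable
  have "((\<lambda>R. \<integral>x. (if norm x < R then 0 else (norm (f x))\<^sup>2) \<partial>lborel) \<longlongrightarrow> (\<integral>x. 0 \<partial>(lborel :: 'a measure))) at_top"
  proof (rule integral_dominated_convergence_at_top[OF _ _ f2])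
    show "AE x in lborel. ((\<lambda>R. if norm x < R then 0 else (norm (f x))\<^sup>2) \<longlongrightarrow> 0) at_top"
    proof (rule AE_I2, rule tendsto_eventually)
      fix x show "\<forall>\<^sub>F R in at_top. (if norm x < R then 0 else (norm (f x))\<^sup>2) = 0"
        using eventually_gt_at_top[of "norm x"] by eventually_elim auto
    qed
  qed (use meas in auto)
  hence tl: "(tl \<longlongrightarrow> 0) at_top" by (simp add: tl_def[abs_def])
  have "\<exists>b. \<forall>x. norm x \<ge> b \<longrightarrow> norm (f x) < e" if "e > 0" for e
  proof -
    define r where "r = e / (2 * M)"
    have r: "r > 0" using M that by (simp add: r_def)
    define v where "v = (e / 2)\<^sup>2 * measure lborel (ball (0::'a) r)"
    have v: "v > 0" using r that content_ball_pos[of r "0::'a"] by (simp add: v_def)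
    obtain R where R: "\<And>s. s \<ge> R \<Longrightarrow> tl s < v"
      using order_tendstoD(2)[OF tl v] by (auto simp: eventually_at_top_linorder)
    have "norm (f x) < e" if x: "norm x \<ge> R + r" for x
    proof (rule ccontr)
      assume "\<not> norm (f x) < e"
      hence e: "norm (f x) \<ge> e" by simp
      have ge: "indicator (ball x r) y * (e / 2)\<^sup>2 \<le> (if norm y < R then 0 else (norm (f y))\<^sup>2)" for y
      proof (cases "y \<in> ball x r")
        case True
        have "norm (f x - f y) \<le> M * r"
          using True by (intro order_trans[OF M(2)] mult_left_mono) (use M in \<open>auto simp: dist_norm\<close>)
        also have "M * r = e / 2" using M by (simp add: r_def)
        finally have "norm (f y) \<ge> e / 2" using e norm_triangle_ineq2[of "f x" "f y"] by linarith
        moreover have "norm y \<ge> R" using True x norm_triangle_ineq2[of x y] by (simp add: dist_norm)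
        ultimately show ?thesis using \<open>e > 0\<close> True by (auto intro: power_mono)
      qed simp
      have "v = (\<integral>y. indicator (ball x r) y * (e / 2)\<^sup>2 \<partial>lborel)"
        using content_ball_conv_unit_ball[of r x] content_ball_conv_unit_ball[of r "0::'a"] r
        by (simp add: v_def)
      also have "\<dots> \<le> tl R"
        unfolding tl_def
      proof (rule integral_mono)
        show "integrable lborel (\<lambda>y. indicator (ball x r) y * (e / 2)\<^sup>2)"
          using emeasure_lborel_ball_finite[of x r] by (auto intro!: integrable_real_indicator)
        show "integrable lborel (\<lambda>y. if norm y < R then 0 else (norm (f y))\<^sup>2)"
          using f2 by (rule Bochner_Integration.integrable_bound) auto
      qed (rule ge)
      finally show False using R[of R] by simp
    qed
    thus ?thesis by blast
  qed
  thus ?thesis by (simp add: Lim_at_infinity dist_norm)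
qed

text \<open>
  With \<open>g\<close> the transform of \<open>f\<close>, the inversion formula bounds first differences of \<open>f\<close> by
  \<open>\<integral>|\<xi>||g|\<close> and second differences \<open>f(x+h) - f(y+h) - f(x) + f(y)\<close> by \<open>|h|\<close> times a modulus
  \<open>\<omega>(x - y)\<close> that tends to \<open>0\<close> by dominated convergence.  The latter makes \<open>\<omega>\<close> a modulus of
  continuity of the derivative, without differentiating under the integral sign.  The decay of \<open>f\<close>
  comes from its Lipschitz continuity and square integrability.
\<close>

lemma Sobolev_embedding_C1:
  fixes f :: "'a::euclidean_space \<Rightarrow> complex"
  assumes Hs: "in_Hs m f" and m: "m > DIM('a) / 2 + 1"
    and D: "\<And>x. (f has_derivative D x) (at x)"
  shows "(f \<longlongrightarrow> 0) at_infinity"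
    and "\<exists>L. \<forall>x y. cmod (f x - f y) \<le> L * norm (x - y)"
    and "\<And>e. e > 0 \<Longrightarrow> \<exists>d>0. \<forall>x y. dist x y < d \<longrightarrow> (\<forall>h. norm (D x h - D y h) \<le> e * norm h)"
proof -
  obtain g where pl: "is_plancherel_transform f g"
    and wg: "in_Lp 2 (\<lambda>\<xi>. (1 + (norm \<xi>)\<^sup>2) powr (m / 2) *\<^sub>R g \<xi>)"
    using Hs unfolding in_Hs_def by auto
  have g [measurable]: "g \<in> borel_measurable lebesgue"
    and f2: "integrable lebesgue (\<lambda>x. (cmod (f x))\<^sup>2)"
    using pl unfolding is_plancherel_transform_def in_Lp_2_iff by auto
  have cont: "continuous_on UNIV f"
    using D by (meson continuous_at_imp_continuous_on has_derivative_continuous)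
  hence f_meas: "f \<in> borel_measurable borel" by (rule borel_measurable_continuous_onI)
  have wint: "integrable lebesgue (\<lambda>\<xi>. (1 + norm \<xi>) * cmod (g \<xi>))"
    by (rule weighted_L2_imp_integrable[OF g wg m])
  have leb: "F \<in> borel_measurable borel \<Longrightarrow> F \<in> borel_measurable lebesgue" for F :: "'a \<Rightarrow> 'b::real_normed_vector"
    by (rule measurable_completion) simp
  have cis_meas [measurable]: "(\<lambda>\<xi>. cis (x \<bullet> \<xi>)) \<in> borel_measurable lebesgue" for x :: 'a
    by (rule leb) measurable
  have norm_meas [measurable]: "(norm :: 'a \<Rightarrow> real) \<in> borel_measurable lebesgue"
    by (rule leb) measurable
  have ng: "integrable lebesgue (\<lambda>\<xi>. norm \<xi> * cmod (g \<xi>))"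
    using wint by (rule Bochner_Integration.integrable_bound) (auto intro!: mult_right_mono AE_I2 simp: abs_mult)
  have g1: "integrable lebesgue g"
    using wint
  proof (rule Bochner_Integration.integrable_bound)
    have "1 * cmod (g \<xi>) \<le> (1 + norm \<xi>) * cmod (g \<xi>)" for \<xi> by (rule mult_right_mono) auto
    thus "AE \<xi> in lebesgue. cmod (g \<xi>) \<le> norm ((1 + norm \<xi>) * cmod (g \<xi>))"
      by (auto simp: abs_mult)
  qed simp
  define c where "c = (2 * pi) ^ DIM('a)"
  have c: "c > 0" by (simp add: c_def)
  have inv: "complex_of_real c * f x = (\<integral>\<xi>. g \<xi> * cis (x \<bullet> \<xi>) \<partial>lebesgue)" for x
    using fourier_inversion[OF pl cont g1, of x] by (simp add: c_def)
  have gc: "integrable lebesgue (\<lambda>\<xi>. g \<xi> * cis (x \<bullet> \<xi>))" for x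
    using g1 by (rule Bochner_Integration.integrable_bound) (auto simp: norm_mult)
  define N where "N = (\<integral>\<xi>. norm \<xi> * cmod (g \<xi>) \<partial>lebesgue)"
  have Lip: "cmod (f x - f y) \<le> N / c * norm (x - y)" for x y
  proof -
    have "complex_of_real c * (f x - f y) = (\<integral>\<xi>. g \<xi> * cis (x \<bullet> \<xi>) - g \<xi> * cis (y \<bullet> \<xi>) \<partial>lebesgue)"
      using gc by (simp add: right_diff_distrib inv)
    hence "c * cmod (f x - f y) = cmod (\<integral>\<xi>. g \<xi> * cis (x \<bullet> \<xi>) - g \<xi> * cis (y \<bullet> \<xi>) \<partial>lebesgue)"
      using c by (metis abs_of_pos norm_mult norm_of_real)
    also have "\<dots> \<le> (\<integral>\<xi>. norm (x - y) * (norm \<xi> * cmod (g \<xi>)) \<partial>lebesgue)"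
    proof (rule order_trans[OF integral_norm_bound integral_mono])
      show "integrable lebesgue (\<lambda>\<xi>. cmod (g \<xi> * cis (x \<bullet> \<xi>) - g \<xi> * cis (y \<bullet> \<xi>)))"
        using gc by (intro integrable_norm Bochner_Integration.integrable_diff)
      show "integrable lebesgue (\<lambda>\<xi>. norm (x - y) * (norm \<xi> * cmod (g \<xi>)))"
        using ng by (rule integrable_mult_right)
      fix \<xi>
      have "cmod (g \<xi> * cis (x \<bullet> \<xi>) - g \<xi> * cis (y \<bullet> \<xi>)) = cmod (g \<xi>) * cmod (cis (x \<bullet> \<xi>) - cis (y \<bullet> \<xi>))"
        by (simp add: norm_mult right_diff_distrib[symmetric])
      also have "\<dots> \<le> cmod (g \<xi>) * (norm (x - y) * norm \<xi>)"
        using Cauchy_Schwarz_ineq2[of "x - y" \<xi>]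
        by (intro mult_left_mono order_trans[OF norm_cis_diff_le]) (auto simp: inner_diff_left)
      finally show "cmod (g \<xi> * cis (x \<bullet> \<xi>) - g \<xi> * cis (y \<bullet> \<xi>)) \<le> norm (x - y) * (norm \<xi> * cmod (g \<xi>))"
        by (simp add: mult_ac)
    qed
    also have "\<dots> = norm (x - y) * N" by (simp add: N_def)
    finally show ?thesis using c by (simp add: field_simps)
  qed
  show "(f \<longlongrightarrow> 0) at_infinity"
  proof (rule Lipschitz_L2_vanishes_at_infinity[OF Lip])
    show "integrable lborel (\<lambda>x. (norm (f x))\<^sup>2)"
      using f2 f_meas by (subst (asm) integrable_completion) auto
  qed
  show "\<exists>L. \<forall>x y. cmod (f x - f y) \<le> L * norm (x - y)" using Lip by blast
  define \<omega> where "\<omega> d = (\<integral>\<xi>. norm \<xi> * cmod (g \<xi>) * cmod (cis (d \<bullet> \<xi>) - 1) \<partial>lebesgue)" for d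
  have \<omega>_bd: "norm \<xi> * cmod (g \<xi>) * cmod (cis (d \<bullet> \<xi>) - 1) \<le> norm \<xi> * cmod (g \<xi>) * 2" for d \<xi>
    using norm_triangle_ineq4[of "cis (d \<bullet> \<xi>)" 1] by (intro mult_left_mono) auto
  have \<omega>_int: "integrable lebesgue (\<lambda>\<xi>. norm \<xi> * cmod (g \<xi>) * cmod (cis (d \<bullet> \<xi>) - 1))" for d
    by (rule Bochner_Integration.integrable_bound[OF integrable_mult_left[OF ng, of 2]])
      (auto intro!: AE_I2 simp: abs_mult \<omega>_bd[simplified])
  have \<omega>_lim: "(\<omega> \<longlongrightarrow> 0) (at 0)"
    unfolding tendsto_at_iff_sequentially
  proof (intro allI impI)
    fix X :: "nat \<Rightarrow> 'a" assume X: "X \<longlonglongrightarrow> 0"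
    have "(\<lambda>n. \<integral>\<xi>. norm \<xi> * cmod (g \<xi>) * cmod (cis (X n \<bullet> \<xi>) - 1) \<partial>lebesgue) \<longlonglongrightarrow> (\<integral>\<xi>. 0 \<partial>(lebesgue :: 'a measure))"
    proof (rule integral_dominated_convergence)
      show "integrable lebesgue (\<lambda>\<xi>. norm \<xi> * cmod (g \<xi>) * 2)" using ng by simp
      show "AE \<xi> in lebesgue. (\<lambda>n. norm \<xi> * cmod (g \<xi>) * cmod (cis (X n \<bullet> \<xi>) - 1)) \<longlonglongrightarrow> 0"
      proof (rule AE_I2)
        fix \<xi>
        have "(\<lambda>n. norm \<xi> * cmod (g \<xi>) * cmod (cis (X n \<bullet> \<xi>) - 1)) \<longlonglongrightarrow> norm \<xi> * cmod (g \<xi>) * cmod (cis (0 \<bullet> \<xi>) - 1)"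
          using X by (intro tendsto_intros)
        thus "(\<lambda>n. norm \<xi> * cmod (g \<xi>) * cmod (cis (X n \<bullet> \<xi>) - 1)) \<longlonglongrightarrow> 0" by simp
      qed
      show "AE \<xi> in lebesgue. norm (norm \<xi> * cmod (g \<xi>) * cmod (cis (X n \<bullet> \<xi>) - 1)) \<le> norm \<xi> * cmod (g \<xi>) * 2" for n
        using \<omega>_bd[of _ "X n"] by (intro AE_I2) (simp add: abs_mult)
    qed (use \<omega>_int in auto)
    thus "(\<omega> \<circ> X) \<longlonglongrightarrow> 0" by (simp add: \<omega>_def o_def)
  qed
  have "\<omega> 0 = 0" by (simp add: \<omega>_def)
  have \<omega>0: "\<exists>d>0. \<forall>x. norm x < d \<longrightarrow> \<omega> x < e" if e: "e > 0" for e
  proof -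
    obtain s where "s > 0" "\<And>x. x \<noteq> 0 \<Longrightarrow> norm (x - 0) < s \<Longrightarrow> norm (\<omega> x - 0) < e"
      using LIM_D[OF \<omega>_lim e] by blast
    hence "\<omega> x < e" if "norm x < s" for x
      using that \<open>\<omega> 0 = 0\<close> e by (cases "x = 0") force+
    thus ?thesis using \<open>s > 0\<close> by blast
  qed
  have diff2: "cmod ((f (x + h) - f (y + h)) - (f x - f y)) \<le> \<omega> (x - y) / c * norm h" for x y h
  proof -
    define q where "q \<xi> = g \<xi> * cis ((x + h) \<bullet> \<xi>) - g \<xi> * cis ((y + h) \<bullet> \<xi>) - (g \<xi> * cis (x \<bullet> \<xi>) - g \<xi> * cis (y \<bullet> \<xi>))" for \<xi>
    have "complex_of_real c * ((f (x + h) - f (y + h)) - (f x - f y)) = (\<integral>\<xi>. q \<xi> \<partial>lebesgue)"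
      using gc by (simp add: q_def right_diff_distrib inv)
    hence "c * cmod ((f (x + h) - f (y + h)) - (f x - f y)) = cmod (\<integral>\<xi>. q \<xi> \<partial>lebesgue)"
      using c by (metis abs_of_pos norm_mult norm_of_real)
    also have "\<dots> \<le> (\<integral>\<xi>. norm h * (norm \<xi> * cmod (g \<xi>) * cmod (cis ((x - y) \<bullet> \<xi>) - 1)) \<partial>lebesgue)"
    proof (rule order_trans[OF integral_norm_bound integral_mono])
      show "integrable lebesgue (\<lambda>\<xi>. cmod (q \<xi>))"
        using gc unfolding q_def by (intro integrable_norm Bochner_Integration.integrable_diff)
      show "integrable lebesgue (\<lambda>\<xi>. norm h * (norm \<xi> * cmod (g \<xi>) * cmod (cis ((x - y) \<bullet> \<xi>) - 1)))"
        using \<omega>_int by (rule integrable_mult_right)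
      fix \<xi>
      have x: "cis (x \<bullet> \<xi>) = cis ((x - y) \<bullet> \<xi>) * cis (y \<bullet> \<xi>)" by (simp add: cis_mult inner_diff_left)
      have "q \<xi> = g \<xi> * cis (y \<bullet> \<xi>) * (cis (h \<bullet> \<xi>) - 1) * (cis ((x - y) \<bullet> \<xi>) - 1)"
        unfolding q_def inner_add_left cis_mult[symmetric] x by (simp add: algebra_simps)
      hence "cmod (q \<xi>) = cmod (g \<xi>) * cmod (cis (h \<bullet> \<xi>) - 1) * cmod (cis ((x - y) \<bullet> \<xi>) - 1)"
        by (simp add: norm_mult)
      also have "\<dots> \<le> cmod (g \<xi>) * (norm h * norm \<xi>) * cmod (cis ((x - y) \<bullet> \<xi>) - 1)"
        using Cauchy_Schwarz_ineq2[of h \<xi>] norm_cis_diff_le[of "h \<bullet> \<xi>" 0]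
        by (intro mult_right_mono mult_left_mono) auto
      finally show "cmod (q \<xi>) \<le> norm h * (norm \<xi> * cmod (g \<xi>) * cmod (cis ((x - y) \<bullet> \<xi>) - 1))"
        by (simp add: mult_ac)
    qed
    also have "\<dots> = norm h * \<omega> (x - y)" by (simp add: \<omega>_def)
    finally show ?thesis using c by (simp add: field_simps)
  qed
  fix e :: real assume e: "e > 0"
  obtain d where d: "d > 0" "\<And>x. norm x < d \<Longrightarrow> \<omega> x < e * c" using \<omega>0[of "e * c"] e c by auto
  have "norm (D x h - D y h) \<le> e * norm h" if "dist x y < d" for x y h
  proof -
    have "((\<lambda>z. f (p + z)) has_derivative D p) (at 0)" for p
      using D[of p] by (intro has_derivative_compose[of "\<lambda>z. p + z" "\<lambda>h. h" 0 UNIV f "D p"])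
        (auto intro!: derivative_eq_intros)
    from has_derivative_diff[OF this this]
    have "((\<lambda>z. f (x + z) - f (y + z)) has_derivative (\<lambda>h. D x h - D y h)) (at 0)" .
    hence "norm (D x h - D y h) \<le> \<omega> (x - y) / c * norm h"
      by (rule derivative_bound_of_Lipschitz_at) (use diff2[of x _ y] in simp)
    also have "\<dots> \<le> e * norm h"
      using d(2)[of "x - y"] that c by (intro mult_right_mono) (auto simp: dist_norm field_simps)
    finally show ?thesis .
  qed
  thus "\<exists>d>0. \<forall>x y. dist x y < d \<longrightarrow> (\<forall>h. norm (D x h - D y h) \<le> e * norm h)" using d by blast
qed

lemma norm_vec_2: "norm (x :: real ^ 2) = sqrt ((x $ 1)\<^sup>2 + (x $ 2)\<^sup>2)"
  by (simp add: norm_vec_def L2_set_def sum_2)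

lemma norm_vec_2_le: "norm (x :: real ^ 2) \<le> \<bar>x $ 1\<bar> + \<bar>x $ 2\<bar>"
  unfolding norm_vec_2 by (rule sqrt_sum_squares_le_sum_abs)

lemma Sobolev_embedding_C1_vec:
  fixes V :: "real ^ 2 \<Rightarrow> real ^ 2"
  assumes Hs: "in_Hs_vec m V" and m: "m > 2" and D: "\<And>x. (V has_derivative D x) (at x)"
  shows "(V \<longlongrightarrow> 0) at_infinity"
    and "\<exists>B. \<forall>x h. norm (D x h) \<le> B * norm h"
    and "\<And>e. e > 0 \<Longrightarrow> \<exists>d>0. \<forall>x y. dist x y < d \<longrightarrow> (\<forall>h. norm (D x h - D y h) \<le> e * norm h)"
proof -
  have Hs: "in_Hs m (\<lambda>x. complex_of_real (V x $ i))" for i using Hs unfolding in_Hs_vec_def by blast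
  have m': "m > DIM(real ^ 2) / 2 + 1" using m by simp
  have Di: "((\<lambda>x. V x $ i) has_derivative (\<lambda>h. D x h $ i)) (at x)" for x i
    using bounded_linear.has_derivative[OF bounded_linear_vec_nth D] .
  have Dc: "((\<lambda>x. complex_of_real (V x $ i)) has_derivative (\<lambda>h. complex_of_real (D x h $ i))) (at x)" for x i
    using bounded_linear.has_derivative[OF bounded_linear_of_real Di] .
  note C1 = Sobolev_embedding_C1[OF Hs m' Dc]
  have "((\<lambda>x. V x $ i) \<longlongrightarrow> 0) at_infinity" for i
    using tendsto_Re[OF C1(1)[of i]] by simp
  from tendsto_add[OF tendsto_rabs[OF this[of 1]] tendsto_rabs[OF this[of 2]]]
  have "((\<lambda>x. \<bar>V x $ 1\<bar> + \<bar>V x $ 2\<bar>) \<longlongrightarrow> 0) at_infinity" by simp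
  thus "(V \<longlongrightarrow> 0) at_infinity"
    by (rule Lim_null_comparison[OF always_eventually, rotated]) (simp add: norm_vec_2_le)
  have "\<exists>L. \<forall>x h. \<bar>D x h $ i\<bar> \<le> L * norm h" for i
  proof -
    obtain L where L: "\<And>x y. cmod (complex_of_real (V x $ i) - complex_of_real (V y $ i)) \<le> L * norm (x - y)"
      using C1(2)[of i] by blast
    have "norm (D x h $ i) \<le> L * norm h" for x h
    proof (rule derivative_bound_of_Lipschitz_at[OF Di])
      fix k show "norm (V (x + k) $ i - V x $ i) \<le> L * norm k"
        using L[of "x + k" x] by (simp flip: of_real_diff)
    qed
    thus ?thesis by auto
  qed
  then obtain L where L: "\<And>i x h. \<bar>D x h $ i\<bar> \<le> L i * norm h" by metis
  have "norm (D x h) \<le> (L 1 + L 2) * norm h" for x h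
    using norm_vec_2_le[of "D x h"] L[of x h 1] L[of x h 2] by (simp add: distrib_right)
  thus "\<exists>B. \<forall>x h. norm (D x h) \<le> B * norm h" by blast
  fix e :: real assume e: "e > 0"
  have "\<exists>d>0. \<forall>x y. dist x y < d \<longrightarrow> (\<forall>h. \<bar>D x h $ i - D y h $ i\<bar> \<le> e / 2 * norm h)" for i
    using C1(3)[of "e / 2" i] e by (simp flip: of_real_diff)
  then obtain d where d: "\<And>i. d i > 0" "\<And>i x y h. dist x y < d i \<Longrightarrow> \<bar>D x h $ i - D y h $ i\<bar> \<le> e / 2 * norm h"
    by metis
  have "norm (D x h - D y h) \<le> e * norm h" if "dist x y < min (d 1) (d 2)" for x y h
    using norm_vec_2_le[of "D x h - D y h"] d(2)[of x y 1 h] d(2)[of x y 2 h] that by simp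
  thus "\<exists>d>0. \<forall>x y. dist x y < d \<longrightarrow> (\<forall>h. norm (D x h - D y h) \<le> e * norm h)"
    using d(1) by (intro exI[of _ "min (d 1) (d 2)"]) auto
qed

section \<open>Steady transport equations in Lebesgue spaces\<close>

text \<open>
  Translation invariance: the difference quotients of the compactly supported \<open>F\<close> have integral
  \<open>0\<close> and converge to the derivative, dominated by a constant on a compact set.
\<close>

lemma
  fixes F :: "'a::euclidean_space \<Rightarrow> real"
  assumes F': "\<And>x. (F has_derivative F' x) (at x)"
    and cont: "continuous_on UNIV (\<lambda>x. F' x e)"
    and supp: "\<And>x. norm x \<ge> R \<Longrightarrow> F x = 0"
  shows integrable_directional_derivative: "integrable lborel (\<lambda>x. F' x e)"
    and integral_directional_derivative_eq_0: "(\<integral>x. F' x e \<partial>lborel) = 0"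
proof -
  have F_cont: "continuous_on UNIV F"
    using F' by (meson continuous_at_imp_continuous_on has_derivative_continuous)
  have [measurable]: "F \<in> borel_measurable borel"
    using F_cont by (rule borel_measurable_continuous_onI)
  have [measurable]: "(\<lambda>x. F' x e) \<in> borel_measurable borel"
    using cont by (rule borel_measurable_continuous_onI)
  have F'0: "F' x e = 0" if "norm x > R" for x
  proof -
    have "open {y::'a. norm y > R}" by (intro open_Collect_less continuous_intros)
    from has_derivative_transform_within_open[OF F' this, where g = "\<lambda>_. 0" and x = x]
    have "((\<lambda>_. 0) has_derivative F' x) (at x)" using that supp by simp
    hence "F' x = (\<lambda>_. 0)" using has_derivative_const has_derivative_unique by blast
    thus ?thesis by simp
  qed
  have bdd: "\<exists>B. \<forall>x. \<bar>H x\<bar> \<le> B" if "continuous_on UNIV H" "\<And>x. norm x > R \<Longrightarrow> H x = 0" for H :: "'a \<Rightarrow> real"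
  proof -
    have "compact (H ` cball 0 R)"
      by (rule compact_continuous_image) (auto intro: continuous_on_subset[OF that(1)])
    hence "bounded (H ` cball 0 R)" by (rule compact_imp_bounded)
    then obtain B where "\<forall>y\<in>H ` cball 0 R. norm y \<le> B" unfolding bounded_iff by blast
    hence B: "\<bar>H x\<bar> \<le> B" if "x \<in> cball 0 R" for x using that by auto
    have "\<bar>H x\<bar> \<le> max B 0" for x
      using B[of x] that(2)[of x] by (cases "norm x > R") (auto simp: max_def)
    thus ?thesis by blast
  qed
  obtain A where A: "\<And>x. \<bar>F x\<bar> \<le> A" using bdd[OF F_cont] supp by fastforce
  obtain B where B: "\<And>x. \<bar>F' x e\<bar> \<le> B" using bdd[OF cont] F'0 by fastforce
  have B0: "B \<ge> 0" using order_trans[OF abs_ge_zero B] .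
  have ind: "integrable lborel (\<lambda>x::'a. K * indicator (cball 0 r) x)" for r K :: real
    using emeasure_lborel_cball_finite[of "0::'a" r] by (auto intro!: integrable_real_indicator)
  have F_int: "integrable lborel F"
    by (rule Bochner_Integration.integrable_bound[OF ind[of A R]])
      (use A supp in \<open>auto intro!: AE_I2 simp: indicator_def intro: order_trans[OF _ abs_ge_self]\<close>)
  show "integrable lborel (\<lambda>x. F' x e)"
    by (rule Bochner_Integration.integrable_bound[OF ind[of B R]])
      (use B F'0 in \<open>auto intro!: AE_I2 simp: indicator_def not_le intro: order_trans[OF _ abs_ge_self]\<close>)
  define h where "h n = inverse (real (Suc n))" for n
  have h: "h n > 0" "h n \<le> 1" "h \<longlonglongrightarrow> 0" for n
    using LIMSEQ_inverse_real_of_nat by (auto simp: h_def[abs_def] field_simps)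
  define q where "q n x = (F (x + h n *\<^sub>R e) - F x) / h n" for n x
  have line: "((\<lambda>t. F (x + t *\<^sub>R e)) has_real_derivative F' (x + t *\<^sub>R e) e) (at t)" for x t
  proof -
    have "((\<lambda>t. F (x + t *\<^sub>R e)) has_derivative (\<lambda>s. F' (x + t *\<^sub>R e) (s *\<^sub>R e))) (at t)"
      by (rule has_derivative_compose[OF _ F', where f = "\<lambda>t. x + t *\<^sub>R e"]) (auto intro!: derivative_eq_intros)
    moreover have "F' (x + t *\<^sub>R e) (s *\<^sub>R e) = F' (x + t *\<^sub>R e) e * s" for s
      using linear_scale[OF has_derivative_linear[OF F']] by simp
    ultimately show ?thesis by (simp add: has_field_derivative_def)
  qed
  have "(\<lambda>n. \<integral>x. q n x \<partial>lborel) \<longlonglongrightarrow> (\<integral>x. F' x e \<partial>lborel)"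
  proof (rule integral_dominated_convergence[OF _ _ ind[of B "\<bar>R\<bar> + norm e"]])
    show "q n \<in> borel_measurable lborel" for n unfolding q_def by measurable
    show "AE x in lborel. (\<lambda>n. q n x) \<longlonglongrightarrow> F' x e"
    proof (rule AE_I2)
      fix x
      have "(\<lambda>t. (F (x + t *\<^sub>R e) - F x) / t) \<midarrow>0\<rightarrow> F' x e"
        using line[of x 0] by (simp add: DERIV_def)
      moreover have "\<forall>\<^sub>F n in sequentially. h n \<noteq> 0" using h(1) by (simp add: less_imp_neq[symmetric])
      ultimately show "(\<lambda>n. q n x) \<longlonglongrightarrow> F' x e"
        unfolding q_def using filterlim_compose[of _ _ "at 0" h] h(3) by (auto simp: filterlim_at)
    qed
    show "AE x in lborel. norm (q n x) \<le> B * indicator (cball 0 (\<bar>R\<bar> + norm e)) x" for n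
    proof (rule AE_I2)
      fix x :: 'a
      show "norm (q n x) \<le> B * indicator (cball 0 (\<bar>R\<bar> + norm e)) x"
      proof (cases "norm x \<le> \<bar>R\<bar> + norm e")
        case True
        obtain z where "F (x + h n *\<^sub>R e) - F (x + 0 *\<^sub>R e) = (h n - 0) * F' (x + z *\<^sub>R e) e"
          using MVT2[of 0 "h n" "\<lambda>t. F (x + t *\<^sub>R e)" "\<lambda>t. F' (x + t *\<^sub>R e) e"] line h(1)[of n] by blast
        hence "q n x = F' (x + z *\<^sub>R e) e" using h(1)[of n] by (simp add: q_def)
        thus ?thesis using B True by simp
      next
        case False
        have "norm (h n *\<^sub>R e) \<le> norm e" using h(1,2)[of n] by (simp add: mult_left_le_one_le)
        hence "norm (x + h n *\<^sub>R e) \<ge> \<bar>R\<bar>"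
          using False norm_triangle_ineq4[of "x + h n *\<^sub>R e" "h n *\<^sub>R e"] by simp
        hence "F (x + h n *\<^sub>R e) = 0" "F x = 0" using False by (auto intro!: supp) (smt (verit) norm_ge_zero)
        thus ?thesis using False by (simp add: q_def)
      qed
    qed
  qed simp
  moreover have "(\<integral>x. q n x \<partial>lborel) = 0" for n
  proof -
    have "(\<integral>x. F x \<partial>lborel) = (\<integral>x. F (h n *\<^sub>R e + 1 *\<^sub>R x) \<partial>lborel)"
      by (subst lborel_integral_affine[where c = 1 and x = "h n *\<^sub>R e"]) simp_all
    moreover have "integrable lborel (\<lambda>x. F (h n *\<^sub>R e + 1 *\<^sub>R x))"
      using F_int by (subst lborel_integrable_affine_iff) simp_all
    ultimately show ?thesis
      using F_int by (simp add: q_def add.commute)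
  qed
  ultimately show "(\<integral>x. F' x e \<partial>lborel) = 0" by (simp add: LIMSEQ_const_iff)
qed

text \<open>
  The integrand is the divergence of the compactly supported field \<open>u W\<close>.
\<close>

lemma integral_divergence_eq_0:
  fixes u :: "'a::euclidean_space \<Rightarrow> real" and W :: "'a \<Rightarrow> 'a"
  assumes u: "\<And>x. (u has_derivative Du x) (at x)" "\<And>h. continuous_on UNIV (\<lambda>x. Du x h)"
    and W: "\<And>x. (W has_derivative DW x) (at x)" "\<And>h. continuous_on UNIV (\<lambda>x. DW x h)"
    and supp: "\<And>x. norm x \<ge> R \<Longrightarrow> u x = 0"
  shows "(\<integral>x. Du x (W x) + u x * (\<Sum>b\<in>Basis. DW x b \<bullet> b) \<partial>lborel) = 0"
proof -
  have cont: "continuous_on UNIV u" "continuous_on UNIV W"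
    using u(1) W(1) by (meson continuous_at_imp_continuous_on has_derivative_continuous)+
  define F' where "F' b x h = u x * (DW x h \<bullet> b) + Du x h * (W x \<bullet> b)" for b x h
  have F': "((\<lambda>x. u x * (W x \<bullet> b)) has_derivative F' b x) (at x)" for b x
    unfolding F'_def by (auto intro!: derivative_eq_intros u(1) W(1))
  have F'_cont: "continuous_on UNIV (\<lambda>x. F' b x h)" for b h
    unfolding F'_def by (intro continuous_intros cont u(2) W(2))
  have eq: "Du x (W x) + u x * (\<Sum>b\<in>Basis. DW x b \<bullet> b) = (\<Sum>b\<in>Basis. F' b x b)" for x
  proof -
    have "Du x (W x) = Du x (\<Sum>b\<in>Basis. (W x \<bullet> b) *\<^sub>R b)" by (simp add: euclidean_representation)
    also have "\<dots> = (\<Sum>b\<in>Basis. (W x \<bullet> b) * Du x b)"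
      using has_derivative_linear[OF u(1)] by (simp add: linear_sum linear_scale)
    finally show ?thesis by (simp add: F'_def sum.distrib sum_distrib_left mult.commute)
  qed
  have "integrable lborel (\<lambda>x. F' b x b)" "(\<integral>x. F' b x b \<partial>lborel) = 0" for b
    using integrable_directional_derivative[OF F' F'_cont, of R b b]
      integral_directional_derivative_eq_0[OF F' F'_cont, of R b b] supp by auto
  thus ?thesis unfolding eq by (simp add: Bochner_Integration.integral_sum)
qed

lemma DERIV_of_quadratic_remainder:
  fixes f :: "real \<Rightarrow> real"
  assumes "\<And>y. \<bar>f y - f x - L * (y - x)\<bar> \<le> C * (y - x)\<^sup>2"
  shows "(f has_real_derivative L) (at x)"
proof -
  have "((\<lambda>h. (f (x + h) - f x) / h - L) \<longlongrightarrow> 0) (at 0)"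
  proof (rule Lim_null_comparison)
    show "\<forall>\<^sub>F h in at 0. norm ((f (x + h) - f x) / h - L) \<le> \<bar>C\<bar> * \<bar>h\<bar>"
    proof (rule eventually_at_filter[THEN iffD2, OF always_eventually], intro allI impI)
      fix h :: real assume h: "h \<noteq> 0"
      have "norm ((f (x + h) - f x) / h - L) = \<bar>f (x + h) - f x - L * h\<bar> / \<bar>h\<bar>"
        using h by (simp add: abs_divide[symmetric] diff_divide_distrib)
      also have "\<dots> \<le> (\<bar>C\<bar> * h\<^sup>2) / \<bar>h\<bar>"
        using assms[of "x + h"] mult_right_mono[OF abs_ge_self[of C], of "h\<^sup>2"] by (intro divide_right_mono) auto
      also have "\<dots> = \<bar>C\<bar> * \<bar>h\<bar>" using h by (simp add: power2_eq_square abs_if)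
      finally show "norm ((f (x + h) - f x) / h - L) \<le> \<bar>C\<bar> * \<bar>h\<bar>" .
    qed
    have "((\<lambda>h. \<bar>C\<bar> * \<bar>h\<bar>) \<longlongrightarrow> \<bar>C\<bar> * \<bar>0\<bar>) (at (0::real))" by (intro tendsto_intros)
    thus "((\<lambda>h. \<bar>C\<bar> * \<bar>h\<bar>) \<longlongrightarrow> 0) (at (0::real))" by simp
  qed
  thus ?thesis by (simp add: DERIV_def LIM_zero_iff)
qed

text \<open>
  The profile of the cutoff functions used below: continuously differentiable, nonnegative and
  zero on a half line.
\<close>

lemma DERIV_max_0_power2: "((\<lambda>t. (max 0 t)\<^sup>2) has_real_derivative 2 * max 0 t) (at t)"
proof (rule DERIV_of_quadratic_remainder[where C = 1])
  fix y :: real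
  consider "t \<ge> 0" "y \<ge> 0" | "t \<ge> 0" "y \<le> 0" | "t \<le> 0" "y \<ge> 0" | "t \<le> 0" "y \<le> 0" by linarith
  thus "\<bar>(max 0 y)\<^sup>2 - (max 0 t)\<^sup>2 - 2 * max 0 t * (y - t)\<bar> \<le> 1 * (y - t)\<^sup>2"
  proof cases
    case 1
    have "y\<^sup>2 - t\<^sup>2 - 2 * t * (y - t) = (y - t)\<^sup>2" by (simp add: power2_eq_square algebra_simps)
    thus ?thesis using 1 by (simp add: max_def)
  next
    case 2
    have "max 0 y = 0" "max 0 t = t" using 2 by auto
    moreover have "2 * t * (y - t) = 2 * (t * y) - 2 * t\<^sup>2" "(y - t)\<^sup>2 = y\<^sup>2 + t\<^sup>2 - 2 * (t * y)"
      by (simp_all add: power2_eq_square algebra_simps)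
    moreover have "t * y \<le> 0" using 2 by (simp add: mult_nonneg_nonpos)
    moreover have "0 \<le> y\<^sup>2" "0 \<le> t\<^sup>2" by simp_all
    moreover have "\<bar>0\<^sup>2 - T - (2 * P - 2 * T)\<bar> \<le> 1 * (Y + T - 2 * P)" if "P \<le> 0" "0 \<le> Y" "0 \<le> T" for P T Y :: real
      using that by simp
    ultimately show ?thesis by (simp only:)
  next
    case 3
    have "y\<^sup>2 \<le> (y - t)\<^sup>2" using 3 by (intro power_mono) auto
    thus ?thesis using 3 by (auto simp: max_def)
  qed (auto simp: max_def)
qed

lemma continuous_AE_0_imp_0:
  fixes f :: "'a::euclidean_space \<Rightarrow> real"
  assumes "continuous_on UNIV f" and AE: "AE x in lborel. f x = 0"
  shows "f x = 0"
proof (rule ccontr)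
  assume "f x \<noteq> 0"
  define S where "S = {y. f y \<noteq> 0}"
  have "open S" unfolding S_def by (intro open_Collect_neq assms(1) continuous_intros)
  hence "S \<in> sets lborel" by simp
  with AE have "S \<in> null_sets lborel"
    unfolding S_def by (subst (asm) AE_iff_null) auto
  hence "negligible S" by (simp add: negligible_iff_null_sets null_sets_completionI)
  moreover have "S \<noteq> {}" using \<open>f x \<noteq> 0\<close> by (auto simp: S_def)
  ultimately show False using open_not_negligible[OF \<open>open S\<close>] by blast
qed

text \<open>
  Powers \<open>|s|\<^sup>p\<close> with small \<open>p\<close> are not differentiable at \<open>0\<close>.  The factor \<open>s\<^sup>2/(s\<^sup>2 + d)\<close> makes
  them \<open>C\<^sup>1\<close> for every \<open>p > 0\<close> and keeps them below \<open>|s|\<^sup>p\<close>, to which they converge as \<open>d \<rightarrow> 0\<close>.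
\<close>

definition regpow :: "real \<Rightarrow> real \<Rightarrow> real \<Rightarrow> real" where
  "regpow p d s = (s\<^sup>2) powr (p / 2) * s\<^sup>2 / (s\<^sup>2 + d)"

definition regpow' :: "real \<Rightarrow> real \<Rightarrow> real \<Rightarrow> real" where
  "regpow' p d s = s * (s\<^sup>2) powr (p / 2) * (p + 2 * d / (s\<^sup>2 + d)) / (s\<^sup>2 + d)"

lemma sq_powr_half: "(s\<^sup>2) powr (p / 2) = \<bar>s\<bar> powr p" for s p :: real
proof -
  have "(s\<^sup>2) powr (p / 2) = (\<bar>s\<bar> powr 2) powr (p / 2)" by simp
  also have "\<dots> = \<bar>s\<bar> powr p" by (simp only: powr_powr) simp
  finally show ?thesis .
qed

lemma continuous_sq_powr_half:
  assumes "p > 0" shows "continuous_on S (\<lambda>s::real. (s\<^sup>2) powr (p / 2))"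
  using assms by (intro continuous_on_powr' continuous_intros) auto

lemma DERIV_regpow:
  assumes p: "p > 0" and d: "d > 0"
  shows "(regpow p d has_real_derivative regpow' p d s) (at s)"
proof (cases "s = 0")
  case True
  have "((\<lambda>h. h * (h\<^sup>2) powr (p / 2) / (h\<^sup>2 + d)) \<longlongrightarrow> 0 * (0\<^sup>2) powr (p / 2) / (0\<^sup>2 + d)) (at 0)"
  proof (intro tendsto_divide tendsto_mult)
    show "((\<lambda>h::real. (h\<^sup>2) powr (p / 2)) \<longlongrightarrow> (0\<^sup>2) powr (p / 2)) (at 0)"
      using continuous_sq_powr_half[OF p, of UNIV, unfolded continuous_on_def, rule_format, of 0] by simp
  qed (use d in \<open>auto intro!: tendsto_eq_intros\<close>)
  moreover have "(regpow p d h - regpow p d 0) / h = h * (h\<^sup>2) powr (p / 2) / (h\<^sup>2 + d)" for h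
    by (simp add: regpow_def power2_eq_square)
  ultimately have "(\<lambda>h. (regpow p d (0 + h) - regpow p d 0) / h) \<midarrow>0\<rightarrow> 0" by simp
  thus ?thesis using True by (simp add: DERIV_def regpow'_def)
next
  case False
  hence s: "s\<^sup>2 > 0" by simp
  have d': "s\<^sup>2 + d > 0" using s d by linarith
  have "((\<lambda>s. (s\<^sup>2) powr (p / 2)) has_real_derivative (p / 2) * (s\<^sup>2) powr (p / 2 - 1) * (2 * s)) (at s)"
    using s by (auto intro!: derivative_eq_intros)
  moreover have "(s\<^sup>2) powr (p / 2 - 1) = (s\<^sup>2) powr (p / 2) / s\<^sup>2" using s by (simp add: powr_diff)
  hence "(p / 2) * (s\<^sup>2) powr (p / 2 - 1) * (2 * s) = p * (s\<^sup>2) powr (p / 2) / s"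
    using False by (simp add: power2_eq_square)
  ultimately have 1: "((\<lambda>s. (s\<^sup>2) powr (p / 2)) has_real_derivative p * (s\<^sup>2) powr (p / 2) / s) (at s)"
    by (simp only:)
  have 2: "((\<lambda>s. s\<^sup>2) has_real_derivative 2 * s) (at s)" "((\<lambda>s. s\<^sup>2 + d) has_real_derivative 2 * s) (at s)"
    by (auto intro!: derivative_eq_intros)
  define q where "q = (s\<^sup>2) powr (p / 2)"
  define E where "E = s\<^sup>2 + d"
  have E: "E > 0" "s\<^sup>2 = E - d" using d' by (auto simp: E_def)
  have "(regpow p d has_real_derivative ((p * q / s * s\<^sup>2 + 2 * s * q) * E - q * s\<^sup>2 * (2 * s)) / (E * E)) (at s)"
    unfolding regpow_def[abs_def] q_def E_def
    by (rule DERIV_divide[OF DERIV_mult[OF 1 2(1)] 2(2)]) (use d' in simp)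
  moreover have "((p * q / s * s\<^sup>2 + 2 * s * q) * E - q * s\<^sup>2 * (2 * s)) / (E * E) = regpow' p d s"
  proof -
    have "p * q / s * s\<^sup>2 = p * q * s" using False by (simp add: power2_eq_square)
    hence "(p * q / s * s\<^sup>2 + 2 * s * q) * E - q * s\<^sup>2 * (2 * s) = s * q * (p * E + 2 * d)"
      unfolding E(2) by (simp only:) (simp add: algebra_simps)
    moreover have "p * E + 2 * d = (p + 2 * d / E) * E" using E(1) by (simp add: distrib_right)
    ultimately show ?thesis
      using E(1) by (simp add: regpow'_def q_def E_def)
  qed
  ultimately show ?thesis by simp
qed

lemma continuous_regpow':
  assumes "p > 0" "d > 0" shows "continuous_on UNIV (regpow' p d)"
proof -
  have "s\<^sup>2 + d \<noteq> 0" for s :: real using assms(2) zero_le_power2[of s] by linarith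
  thus ?thesis
    unfolding regpow'_def[abs_def] by (intro continuous_intros continuous_sq_powr_half assms(1)) auto
qed

lemma regpow_bounds:
  assumes "d > 0" shows "0 \<le> regpow p d s" "regpow p d s \<le> \<bar>s\<bar> powr p"
proof -
  have "s\<^sup>2 / (s\<^sup>2 + d) \<le> 1" using assms zero_le_power2[of s] by (subst divide_le_eq_1_pos) linarith+
  hence "\<bar>s\<bar> powr p * (s\<^sup>2 / (s\<^sup>2 + d)) \<le> \<bar>s\<bar> powr p" by (intro mult_left_le) auto
  thus "regpow p d s \<le> \<bar>s\<bar> powr p" by (simp add: regpow_def sq_powr_half)
  show "0 \<le> regpow p d s" using assms by (simp add: regpow_def)
qed

text \<open>
  The approximate Euler relation \<open>s G'(s) = \<kappa>(s) G(s)\<close>, with \<open>\<kappa>\<close> between \<open>p\<close> and \<open>p + 2\<close>.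
\<close>

lemma regpow'_Euler: "s * regpow' p d s = (p + 2 * d / (s\<^sup>2 + d)) * regpow p d s"
  by (simp add: regpow_def regpow'_def power2_eq_square mult_ac)

text \<open>
  Let \<open>G\<close> be a regularised power and \<open>\<phi>\<close> a cutoff at radius \<open>R\<close>.  Integrating the divergence of
  \<open>G(\<Theta>) \<phi> W\<close> and using the equation gives
  \<open>\<integral> (\<delta> - c \<kappa>) G(\<Theta>) \<phi> + G(\<Theta>) D\<phi>(W) = 0\<close>.  By the linear growth of \<open>W\<close> the term \<open>D\<phi>(W)\<close> is bounded
  uniformly in \<open>R\<close>, so the integrand is dominated by a multiple of \<open>|\<Theta>|\<^sup>p\<close>.  Letting \<open>R = n + 1\<close>
  grow and the regularisation \<open>d = 1/R\<close> decrease together yields \<open>(\<delta> - c p) \<integral>|\<Theta>|\<^sup>p = 0\<close>.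
\<close>

lemma steady_transport_Lp_imp_0:
  fixes \<Theta> :: "'a::euclidean_space \<Rightarrow> real" and W :: "'a \<Rightarrow> 'a" and c \<delta> M p :: real
  assumes \<Theta>: "\<And>x. (\<Theta> has_derivative D\<Theta> x) (at x)" "\<And>h. continuous_on UNIV (\<lambda>x. D\<Theta> x h)"
    and W: "\<And>x. (W has_derivative DW x) (at x)" "\<And>h. continuous_on UNIV (\<lambda>x. DW x h)"
    and div: "\<And>x. (\<Sum>b\<in>Basis. DW x b \<bullet> b) = \<delta>"
    and growth: "\<And>x. norm (W x) \<le> M * (1 + norm x)"
    and eq: "\<And>x. c * \<Theta> x + D\<Theta> x (W x) = 0"
    and p: "p > 0" "integrable lborel (\<lambda>x. \<bar>\<Theta> x\<bar> powr p)" "c * p \<noteq> \<delta>"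
  shows "\<Theta> x = 0"
proof -
  have cont: "continuous_on UNIV \<Theta>" "continuous_on UNIV W"
    using \<Theta>(1) W(1) by (meson continuous_at_imp_continuous_on has_derivative_continuous)+
  have M: "M \<ge> 0" using order_trans[OF norm_ge_zero growth[of 0]] by simp
  define R where "R n = real n + 1" for n
  have R: "R n \<ge> 1" for n by (simp add: R_def)
  define d where "d n = 1 / R n" for n
  have d: "d n > 0" for n using R[of n] by (simp add: d_def)
  define m where "m n x = max 0 (1 - (norm x / R n)\<^sup>2)" for n and x :: 'a
  define \<phi> where "\<phi> n x = (m n x)\<^sup>2" for n and x :: 'a
  define D\<phi> where "D\<phi> n x h = - 4 * m n x * (x \<bullet> h) / (R n)\<^sup>2" for n and x h :: 'a
  have m_bd: "0 \<le> m n x" "m n x \<le> 1" for n x by (auto simp: m_def)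
  have m_0: "m n x = 0" if "norm x \<ge> R n" for n x
  proof -
    have "1 \<le> (norm x / R n)\<^sup>2" using that R[of n] by (intro one_le_power) (simp add: field_simps)
    thus ?thesis by (simp add: m_def)
  qed
  have m_cont: "continuous_on UNIV (m n)" for n
    unfolding m_def[abs_def] using R[of n] by (intro continuous_intros) auto
  have D\<phi>: "(\<phi> n has_derivative D\<phi> n x) (at x)" for n x
  proof -
    define r where "r = 1 / (R n)\<^sup>2"
    have "((\<lambda>y. 1 - (y \<bullet> y) * r) has_derivative (\<lambda>h. - 2 * (x \<bullet> h) * r)) (at x)"
      by (auto intro!: derivative_eq_intros simp: inner_commute algebra_simps)
    moreover have "(norm y / R n)\<^sup>2 = (y \<bullet> y) * r" for y :: 'a
      by (simp add: r_def power_divide power2_norm_eq_inner)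
    ultimately have "((\<lambda>y. 1 - (norm y / R n)\<^sup>2) has_derivative (\<lambda>h. - 2 * (x \<bullet> h) / (R n)\<^sup>2)) (at x)"
      by (simp add: r_def)
    from has_derivative_compose[OF this DERIV_max_0_power2[unfolded has_field_derivative_def]]
    show ?thesis by (simp add: \<phi>_def[abs_def] m_def D\<phi>_def[abs_def] mult.assoc)
  qed
  define u where "u n x = regpow p (d n) (\<Theta> x) * \<phi> n x" for n x
  define Du where "Du n x h = regpow' p (d n) (\<Theta> x) * D\<Theta> x h * \<phi> n x + regpow p (d n) (\<Theta> x) * D\<phi> n x h" for n x h
  have reg_cont: "continuous_on UNIV (\<lambda>x. regpow' p (d n) (\<Theta> x))" "continuous_on UNIV (\<lambda>x. regpow p (d n) (\<Theta> x))" for n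
    using continuous_on_compose2[OF continuous_regpow'[OF p(1) d[of n]] cont(1)]
      continuous_on_compose2[OF DERIV_continuous_on[of UNIV, OF has_field_derivative_at_within[OF DERIV_regpow[OF p(1) d[of n]]]] cont(1)]
    by auto
  have Du: "(u n has_derivative Du n x) (at x)" for n x
  proof -
    have "((\<lambda>x. regpow p (d n) (\<Theta> x)) has_derivative (\<lambda>h. regpow' p (d n) (\<Theta> x) * D\<Theta> x h)) (at x)"
      using has_derivative_compose[OF \<Theta>(1) DERIV_regpow[OF p(1) d, unfolded has_field_derivative_def]] .
    from has_derivative_mult[OF this D\<phi>]
    show ?thesis by (simp add: u_def[abs_def] Du_def[abs_def] add.commute)
  qed
  have Du_cont: "continuous_on UNIV (\<lambda>x. Du n x h)" for n h
    unfolding Du_def \<phi>_def D\<phi>_def using R[of n]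
    by (intro continuous_intros reg_cont \<Theta>(2) m_cont) auto
  define \<kappa> where "\<kappa> n x = p + 2 * d n / ((\<Theta> x)\<^sup>2 + d n)" for n x
  define F where "F n x = (\<delta> - c * \<kappa> n x) * regpow p (d n) (\<Theta> x) * \<phi> n x + regpow p (d n) (\<Theta> x) * D\<phi> n x (W x)" for n x
  have "(\<integral>x. F n x \<partial>lborel) = 0" for n
  proof -
    have "(\<integral>x. Du n x (W x) + u n x * (\<Sum>b\<in>Basis. DW x b \<bullet> b) \<partial>lborel) = 0"
      by (rule integral_divergence_eq_0[OF Du Du_cont W, where R = "R n"]) (simp add: u_def \<phi>_def m_0)
    moreover have "Du n x (W x) + u n x * (\<Sum>b\<in>Basis. DW x b \<bullet> b) = F n x" for x
    proof -
      have "D\<Theta> x (W x) = - c * \<Theta> x" using eq[of x] by simp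
      hence "regpow' p (d n) (\<Theta> x) * D\<Theta> x (W x) = - c * (\<kappa> n x * regpow p (d n) (\<Theta> x))"
        using regpow'_Euler[of "\<Theta> x" p "d n"] by (simp add: \<kappa>_def mult_ac)
      thus ?thesis unfolding Du_def u_def F_def div by (simp add: algebra_simps)
    qed
    ultimately show ?thesis by simp
  qed
  moreover have "(\<lambda>n. \<integral>x. F n x \<partial>lborel) \<longlonglongrightarrow> (\<integral>x. (\<delta> - c * p) * \<bar>\<Theta> x\<bar> powr p \<partial>lborel)"
  proof (rule integral_dominated_convergence)
    define C where "C = \<bar>\<delta>\<bar> + \<bar>c\<bar> * (p + 2) + 8 * M"
    show "integrable lborel (\<lambda>x. C * \<bar>\<Theta> x\<bar> powr p)" using p(2) by simp
    show "(\<lambda>x. (\<delta> - c * p) * \<bar>\<Theta> x\<bar> powr p) \<in> borel_measurable lborel"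
      using borel_measurable_integrable[OF p(2)] by measurable
    have nz: "(\<Theta> x)\<^sup>2 + d n \<noteq> 0" for x n using d[of n] zero_le_power2[of "\<Theta> x"] by linarith
    show "F n \<in> borel_measurable lborel" for n
    proof -
      have "continuous_on UNIV (F n)"
        unfolding F_def \<kappa>_def \<phi>_def D\<phi>_def using nz R[of n]
        by (intro continuous_intros reg_cont m_cont cont) auto
      thus ?thesis using borel_measurable_continuous_onI by simp
    qed
    show "AE x in lborel. (\<lambda>n. F n x) \<longlonglongrightarrow> (\<delta> - c * p) * \<bar>\<Theta> x\<bar> powr p"
    proof (rule AE_I2)
      fix x
      show "(\<lambda>n. F n x) \<longlonglongrightarrow> (\<delta> - c * p) * \<bar>\<Theta> x\<bar> powr p"
      proof (cases "\<Theta> x = 0")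
        case True
        thus ?thesis by (simp add: F_def regpow_def)
      next
        case False
        have R_lim: "filterlim R at_top sequentially"
          unfolding R_def by real_asymp
        have inv: "(\<lambda>n. 1 / R n) \<longlonglongrightarrow> 0"
          using tendsto_divide_0[OF tendsto_const filterlim_at_top_imp_at_infinity[OF R_lim], of 1] .
        hence d_lim: "d \<longlonglongrightarrow> 0" by (simp add: d_def[abs_def])
        have "(\<lambda>n. (\<delta> - c * (p + 2 * d n / ((\<Theta> x)\<^sup>2 + d n))) * (((\<Theta> x)\<^sup>2) powr (p / 2) * (\<Theta> x)\<^sup>2 / ((\<Theta> x)\<^sup>2 + d n)) * (max 0 (1 - (norm x * (1 / R n))\<^sup>2))\<^sup>2
              + (((\<Theta> x)\<^sup>2) powr (p / 2) * (\<Theta> x)\<^sup>2 / ((\<Theta> x)\<^sup>2 + d n)) * (- 4 * (max 0 (1 - (norm x * (1 / R n))\<^sup>2)) * (x \<bullet> W x) * (1 / R n)\<^sup>2))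
          \<longlonglongrightarrow> (\<delta> - c * (p + 2 * 0 / ((\<Theta> x)\<^sup>2 + 0))) * (((\<Theta> x)\<^sup>2) powr (p / 2) * (\<Theta> x)\<^sup>2 / ((\<Theta> x)\<^sup>2 + 0)) * (max 0 (1 - (norm x * 0)\<^sup>2))\<^sup>2
              + (((\<Theta> x)\<^sup>2) powr (p / 2) * (\<Theta> x)\<^sup>2 / ((\<Theta> x)\<^sup>2 + 0)) * (- 4 * (max 0 (1 - (norm x * 0)\<^sup>2)) * (x \<bullet> W x) * 0\<^sup>2)"
          using False by (intro tendsto_intros d_lim inv) auto
        thus ?thesis
          using False by (simp add: F_def \<kappa>_def regpow_def \<phi>_def D\<phi>_def m_def sq_powr_half power_divide)
      qed
    qed
    show "AE x in lborel. norm (F n x) \<le> C * \<bar>\<Theta> x\<bar> powr p" for n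
    proof (rule AE_I2)
      fix x
      have "0 \<le> 2 * d n / ((\<Theta> x)\<^sup>2 + d n)" using d[of n] by simp
      moreover have "0 < (\<Theta> x)\<^sup>2 + d n" using d[of n] zero_le_power2[of "\<Theta> x"] by linarith
      hence "2 * d n / ((\<Theta> x)\<^sup>2 + d n) \<le> 2" by (simp add: divide_le_eq)
      ultimately have "\<bar>\<kappa> n x\<bar> \<le> p + 2" using p(1) by (simp add: \<kappa>_def)
      hence "\<bar>c * \<kappa> n x\<bar> \<le> \<bar>c\<bar> * (p + 2)" by (simp add: abs_mult mult_left_mono)
      hence 1: "\<bar>\<delta> - c * \<kappa> n x\<bar> \<le> \<bar>\<delta>\<bar> + \<bar>c\<bar> * (p + 2)" by linarith
      have phi: "\<bar>\<phi> n x\<bar> \<le> 1" using m_bd[of n x] by (simp add: \<phi>_def power_le_one)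
      have 2: "\<bar>D\<phi> n x (W x)\<bar> \<le> 8 * M"
      proof (cases "norm x \<ge> R n")
        case True
        thus ?thesis using M by (simp add: D\<phi>_def m_0)
      next
        case False
        have "\<bar>x \<bullet> W x\<bar> \<le> R n * (M * (1 + R n))"
          using False M R[of n]
          by (intro order_trans[OF Cauchy_Schwarz_ineq2] mult_mono order_trans[OF growth] mult_left_mono) auto
        also have "\<dots> \<le> R n * (M * (R n + R n))" using M R[of n] by (intro mult_left_mono) auto
        also have "\<dots> = 2 * M * (R n)\<^sup>2" by (simp add: power2_eq_square)
        finally have "\<bar>x \<bullet> W x\<bar> / (R n)\<^sup>2 \<le> 2 * M" using R[of n] by (simp add: field_simps)
        moreover have "\<bar>D\<phi> n x (W x)\<bar> = 4 * m n x * (\<bar>x \<bullet> W x\<bar> / (R n)\<^sup>2)"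
          using m_bd(1)[of n x] by (simp add: D\<phi>_def abs_mult abs_divide)
        moreover have "4 * m n x * (\<bar>x \<bullet> W x\<bar> / (R n)\<^sup>2) \<le> 4 * 1 * (\<bar>x \<bullet> W x\<bar> / (R n)\<^sup>2)"
          using m_bd[of n x] by (intro mult_right_mono) auto
        ultimately show ?thesis by linarith
      qed
      have G: "\<bar>regpow p (d n) (\<Theta> x)\<bar> \<le> \<bar>\<Theta> x\<bar> powr p" using regpow_bounds[OF d[of n]] by simp
      have F: "F n x = ((\<delta> - c * \<kappa> n x) * \<phi> n x + D\<phi> n x (W x)) * regpow p (d n) (\<Theta> x)"
        by (simp add: F_def algebra_simps)
      have "\<bar>(\<delta> - c * \<kappa> n x) * \<phi> n x\<bar> \<le> (\<bar>\<delta>\<bar> + \<bar>c\<bar> * (p + 2)) * 1"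
        unfolding abs_mult using 1 phi p(1) by (intro mult_mono) auto
      hence "\<bar>(\<delta> - c * \<kappa> n x) * \<phi> n x + D\<phi> n x (W x)\<bar> \<le> (\<bar>\<delta>\<bar> + \<bar>c\<bar> * (p + 2)) * 1 + 8 * M"
        using 2 by (rule order_trans[OF abs_triangle_ineq add_mono])
      hence "\<bar>(\<delta> - c * \<kappa> n x) * \<phi> n x + D\<phi> n x (W x)\<bar> \<le> C" by (simp add: C_def)
      thus "norm (F n x) \<le> C * \<bar>\<Theta> x\<bar> powr p"
        unfolding F real_norm_def abs_mult using G by (intro mult_mono) auto
    qed
  qed
  ultimately have "(\<integral>x. (\<delta> - c * p) * \<bar>\<Theta> x\<bar> powr p \<partial>lborel) = 0" by (simp add: LIMSEQ_const_iff)
  hence "(\<integral>x. \<bar>\<Theta> x\<bar> powr p \<partial>lborel) = 0" using p(3) by simp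
  hence "AE x in lborel. \<bar>\<Theta> x\<bar> powr p = 0" using p(2) by (subst (asm) integral_nonneg_eq_0_iff_AE) auto
  hence "AE x in lborel. \<Theta> x = 0" by simp
  thus ?thesis using continuous_AE_0_imp_0[OF cont(1)] by blast
qed

lemma in_Lp_real_exponent:
  fixes \<Theta> :: "'a::euclidean_space \<Rightarrow> real"
  assumes "in_Lp p \<Theta>" "0 < p" "p < \<infinity>" and [measurable]: "\<Theta> \<in> borel_measurable borel"
  shows "enn2real p > 0" "integrable lborel (\<lambda>x. \<bar>\<Theta> x\<bar> powr enn2real p)"
proof -
  show "enn2real p > 0" using assms by (simp add: enn2real_positive_iff)
  have "(\<integral>\<^sup>+ x. ennreal (\<bar>\<Theta> x\<bar> powr enn2real p) \<partial>lebesgue) < \<infinity>"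
  proof -
    have "p \<noteq> \<infinity>" using assms(3) by auto
    thus ?thesis using assms(1) unfolding in_Lp_def by simp
  qed
  hence "(\<integral>\<^sup>+ x. ennreal (\<bar>\<Theta> x\<bar> powr enn2real p) \<partial>lborel) < \<infinity>"
    by (subst (asm) nn_integral_completion) auto
  thus "integrable lborel (\<lambda>x. \<bar>\<Theta> x\<bar> powr enn2real p)"
    by (intro integrableI_bounded) auto
qed

text \<open>
  If the larger exponent is infinite, boundedness of \<open>\<Theta>\<close> gives integrability for every exponent
  above the smaller one, for instance the smaller one plus \<open>1\<close>.
\<close>

lemma in_two_Lp_imp_two_real_exponents:
  fixes \<Theta> :: "'a::euclidean_space \<Rightarrow> real"
  assumes p: "0 < p1" "p1 < p2" and Lp: "in_Lp p1 \<Theta>" "in_Lp p2 \<Theta>"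
    and meas [measurable]: "\<Theta> \<in> borel_measurable borel"
  obtains q1 q2 :: real where "0 < q1" "q1 < q2"
    "integrable lborel (\<lambda>x. \<bar>\<Theta> x\<bar> powr q1)" "integrable lborel (\<lambda>x. \<bar>\<Theta> x\<bar> powr q2)"
proof -
  have "p1 < \<infinity>" using p(2) top_greatest unfolding infinity_ennreal_def by (rule order.strict_trans2)
  note q1 = in_Lp_real_exponent[OF Lp(1) p(1) this meas]
  show ?thesis
  proof (cases "p2 = \<infinity>")
    case False
    hence "p2 < \<infinity>" by (simp add: less_top)
    moreover have "0 < p2" using p by (rule less_trans)
    moreover have "enn2real p1 < enn2real p2"
      using p \<open>p1 < \<infinity>\<close> \<open>p2 < \<infinity>\<close> by (cases p1; cases p2) (auto simp: ennreal_less_iff)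
    ultimately show ?thesis using that q1 in_Lp_real_exponent[OF Lp(2) _ _ meas] by blast
  next
    case True
    then obtain C where "AE x in lebesgue. \<bar>\<Theta> x\<bar> \<le> C" using Lp(2) unfolding in_Lp_def by auto
    hence C: "AE x in lborel. \<bar>\<Theta> x\<bar> \<le> C" by (subst (asm) AE_completion_iff) auto
    have "integrable lborel (\<lambda>x. \<bar>\<Theta> x\<bar> powr (enn2real p1 + 1))"
    proof (rule Bochner_Integration.integrable_bound)
      show "integrable lborel (\<lambda>x. C * \<bar>\<Theta> x\<bar> powr enn2real p1)" using q1(2) by (rule integrable_mult_right)
      show "AE x in lborel. norm (\<bar>\<Theta> x\<bar> powr (enn2real p1 + 1)) \<le> norm (C * \<bar>\<Theta> x\<bar> powr enn2real p1)"
        using C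
      proof eventually_elim
        fix x assume "\<bar>\<Theta> x\<bar> \<le> C"
        hence "\<bar>\<Theta> x\<bar> * \<bar>\<Theta> x\<bar> powr enn2real p1 \<le> \<bar>C\<bar> * \<bar>\<Theta> x\<bar> powr enn2real p1"
          by (intro mult_right_mono) auto
        thus "norm (\<bar>\<Theta> x\<bar> powr (enn2real p1 + 1)) \<le> norm (C * \<bar>\<Theta> x\<bar> powr enn2real p1)"
          by (cases "\<Theta> x = 0") (simp_all add: powr_add abs_mult mult.commute)
      qed
    qed measurable
    thus ?thesis using that[of "enn2real p1" "enn2real p1 + 1"] q1 by simp
  qed
qed

section \<open>Circulation around small circles\<close>

text \<open>
  First order Taylor expansion whose remainder depends on \<open>f\<close> only through the oscillation of its
  derivative, hence is uniform in \<open>x\<close> when the derivative is uniformly continuous.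
\<close>

lemma increment_bound_of_derivative_oscillation:
  fixes f :: "'a::real_normed_vector \<Rightarrow> 'b::real_normed_vector"
  assumes D: "\<And>z. (f has_derivative D z) (at z)"
    and osc: "\<And>z k. dist z x < d \<Longrightarrow> norm (D z k - D x k) \<le> e * norm k"
    and "e \<ge> 0" "norm h < d"
  shows "norm (f (x + h) - f x - D x h) \<le> e * norm h"
proof -
  have lin: "bounded_linear (D x)" using has_derivative_bounded_linear[OF D] .
  have "d > 0" using assms(4) norm_ge_zero[of h] by linarith
  have "norm ((f (x + h) - D x (x + h)) - (f x - D x x)) \<le> e * norm ((x + h) - x)"
  proof (rule differentiable_bound[where S = "ball x d" and f' = "\<lambda>y h. D y h - D x h"])
    show "((\<lambda>y. f y - D x y) has_derivative (\<lambda>h. D y h - D x h)) (at y within ball x d)" for y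
      by (intro has_derivative_diff has_derivative_at_withinI[OF D] bounded_linear_imp_has_derivative lin)
    show "onorm (\<lambda>h. D y h - D x h) \<le> e" if "y \<in> ball x d" for y
      using osc[of y] that \<open>e \<ge> 0\<close> by (intro onorm_bound) (auto simp: dist_commute)
  qed (use \<open>d > 0\<close> \<open>norm h < d\<close> in \<open>auto simp: dist_norm\<close>)
  moreover have "(f (x + h) - D x (x + h)) - (f x - D x x) = f (x + h) - f x - D x h"
    using lin by (simp add: linear_simps)
  ultimately show ?thesis by simp
qed

text \<open>
  Take a maximum point \<open>y\<close> of \<open>|F|\<close>; it is a maximum or a minimum point of \<open>F\<close> itself.
\<close>

lemma vanishing_function_critical_point:
  fixes F :: "'a::euclidean_space \<Rightarrow> real"
  assumes F': "\<And>x. (F has_derivative F' x) (at x)" and lim: "(F \<longlongrightarrow> 0) at_infinity"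
  obtains y where "\<bar>F x\<bar> \<le> \<bar>F y\<bar>" "F' y = (\<lambda>_. 0)"
proof -
  have cont: "continuous_on UNIV F"
    using F' by (meson continuous_at_imp_continuous_on has_derivative_continuous)
  have "\<exists>y. \<forall>x. \<bar>F x\<bar> \<le> \<bar>F y\<bar>"
  proof (cases "\<forall>x. F x = 0")
    case False
    then obtain z where z: "\<bar>F z\<bar> > 0" by auto
    moreover have "\<forall>e>0. \<exists>b. \<forall>x. norm x \<ge> b \<longrightarrow> \<bar>F x\<bar> < e"
      using lim unfolding Lim_at_infinity by (simp add: dist_norm)
    ultimately obtain b where b: "\<And>x. norm x \<ge> b \<Longrightarrow> \<bar>F x\<bar> < \<bar>F z\<bar>" by blast
    have zb: "z \<in> cball 0 b" using b[of z] by fastforce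
    have "continuous_on (cball 0 b) (\<lambda>x. \<bar>F x\<bar>)"
      by (intro continuous_intros continuous_on_subset[OF cont]) simp
    from continuous_attains_sup[OF compact_cball _ this]
    obtain y where y: "y \<in> cball 0 b" "\<And>x. x \<in> cball 0 b \<Longrightarrow> \<bar>F x\<bar> \<le> \<bar>F y\<bar>"
      using zb by blast
    have "\<bar>F x\<bar> \<le> \<bar>F y\<bar>" for x
      using y(2)[of x] y(2)[OF zb] b[of x] by (cases "norm x \<le> b") auto
    thus ?thesis by blast
  qed simp
  then obtain y where y: "\<And>x. \<bar>F x\<bar> \<le> \<bar>F y\<bar>" by blast
  have "(\<forall>x\<in>UNIV. F x \<le> F y) \<or> (\<forall>x\<in>UNIV. F y \<le> F x)"
  proof (cases "F y \<ge> 0")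
    case True
    thus ?thesis using y by (auto simp: abs_le_iff)
  next
    case False
    hence "F y \<le> F x" for x using y[of x] by linarith
    thus ?thesis by blast
  qed
  hence "F' y = (\<lambda>_. 0)"
    using differential_zero_maxmin[of y UNIV F "F' y"] F' by simp
  thus ?thesis using that y by blast
qed

definition circ :: "real \<Rightarrow> real ^ 2" where
  "circ t = cos t *\<^sub>R axis 1 1 + sin t *\<^sub>R axis 2 1"

definition circ' :: "real \<Rightarrow> real ^ 2" where
  "circ' t = - sin t *\<^sub>R axis 1 1 + cos t *\<^sub>R axis 2 1"

lemma norm_circ: "norm (circ t) = 1" "norm (circ' t) = 1"
  using sin_cos_squared_add3[of t]
  by (simp_all add: circ_def circ'_def norm_eq_sqrt_inner inner_vec_def sum_2 axis_def add.commute)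

lemma continuous_circ [continuous_intros]: "continuous_on S circ" "continuous_on S circ'"
  unfolding circ_def circ'_def by (intro continuous_intros)+

lemma circ_has_vector_derivative: "(circ has_vector_derivative circ' t) (at t within S)"
  unfolding circ_def circ'_def by (auto intro!: derivative_eq_intros simp: scaleR_minus_left)

lemma circ_2pi: "circ (2 * pi) = circ 0" by (simp add: circ_def)

lemma linear_vec_2:
  fixes L :: "real ^ 2 \<Rightarrow> 'b::real_vector"
  assumes "linear L"
  shows "L v = v $ 1 *\<^sub>R L (axis 1 1) + v $ 2 *\<^sub>R L (axis 2 1)"
proof -
  have "v = v $ 1 *\<^sub>R axis 1 1 + v $ 2 *\<^sub>R axis 2 1"
    by (simp add: vec_eq_iff forall_2 axis_def)
  hence "L v = L (v $ 1 *\<^sub>R axis 1 1 + v $ 2 *\<^sub>R axis 2 1)" by (rule arg_cong)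
  thus ?thesis by (simp only: linear_add[OF assms] linear_scale[OF assms])
qed

definition curl2 :: "(real ^ 2 \<Rightarrow> real ^ 2) \<Rightarrow> real" where
  "curl2 L = L (axis 1 1) $ 2 - L (axis 2 1) $ 1"

text \<open>
  The circulation of a gradient is the total change of its potential along a closed curve.
\<close>

lemma has_integral_circ_gradient:
  assumes P: "\<And>x. GDERIV P x :> gP x" and "\<epsilon> > 0"
  shows "((\<lambda>t. gP (y + \<epsilon> *\<^sub>R circ t) \<bullet> circ' t) has_integral 0) {0..2 * pi}"
proof -
  have "((\<lambda>t. P (y + \<epsilon> *\<^sub>R circ t) / \<epsilon>) has_vector_derivative gP (y + \<epsilon> *\<^sub>R circ t) \<bullet> circ' t) (at t within {0..2 * pi})" for t
  proof -
    have "((\<lambda>t. y + \<epsilon> *\<^sub>R circ t) has_derivative (\<lambda>s. s *\<^sub>R (\<epsilon> *\<^sub>R circ' t))) (at t within {0..2 * pi})"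
      using circ_has_vector_derivative[unfolded has_vector_derivative_def]
      by (auto intro!: derivative_eq_intros)
    from has_derivative_compose[OF this P[unfolded gderiv_def]]
    have "((\<lambda>t. P (y + \<epsilon> *\<^sub>R circ t)) has_derivative (\<lambda>s. s * (\<epsilon> * (gP (y + \<epsilon> *\<^sub>R circ t) \<bullet> circ' t)))) (at t within {0..2 * pi})"
      by (simp add: inner_commute mult.assoc)
    hence "((\<lambda>t. P (y + \<epsilon> *\<^sub>R circ t)) has_real_derivative \<epsilon> * (gP (y + \<epsilon> *\<^sub>R circ t) \<bullet> circ' t)) (at t within {0..2 * pi})"
      by (simp only: has_field_derivative_def mult_commute_abs)
    from DERIV_cdivide[OF this, of \<epsilon>] show ?thesis
      using \<open>\<epsilon> > 0\<close> by (simp add: has_real_derivative_iff_has_vector_derivative)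
  qed
  from fundamental_theorem_of_calculus[OF _ this] show ?thesis by (simp add: circ_2pi)
qed

lemma has_integral_circ_const: "((\<lambda>t. v \<bullet> circ' t) has_integral 0) {0..2 * pi}"
proof -
  have "((\<lambda>t. v \<bullet> circ t) has_vector_derivative v \<bullet> circ' t) (at t within {0..2 * pi})" for t
    using bounded_linear.has_vector_derivative[OF bounded_linear_inner_right circ_has_vector_derivative] .
  from fundamental_theorem_of_calculus[OF _ this] show ?thesis by (simp add: circ_2pi)
qed

text \<open>
  Stokes' theorem for a linear field on the unit disc, by an explicit antiderivative.
\<close>

lemma has_integral_circ_linear:
  assumes L: "linear L"
  shows "((\<lambda>t. L (circ t) \<bullet> circ' t) has_integral pi * curl2 L) {0..2 * pi}"
proof -
  define A B C D where "A = L (axis 1 1) $ 1" and "B = L (axis 2 1) $ 1"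
    and "C = L (axis 1 1) $ 2" and "D = L (axis 2 1) $ 2"
  define F where "F t = C * (t / 2 + sin t * cos t / 2) - B * (t / 2 - sin t * cos t / 2) + (D - A) * (sin t)\<^sup>2 / 2" for t
  have eq: "L (circ t) \<bullet> circ' t = (C * (cos t)\<^sup>2 - B * (sin t)\<^sup>2) + (D - A) * (sin t * cos t)" for t
    by (simp add: circ_def circ'_def linear_add[OF L] linear_scale[OF L] inner_vec_def sum_2 axis_def
        A_def B_def C_def D_def power2_eq_square algebra_simps)
  have "(F has_real_derivative L (circ t) \<bullet> circ' t) (at t)" for t
  proof -
    have "(F has_real_derivative C * (1 / 2 + ((cos t)\<^sup>2 - (sin t)\<^sup>2) / 2) - B * (1 / 2 - ((cos t)\<^sup>2 - (sin t)\<^sup>2) / 2)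
        + (D - A) * (sin t * cos t)) (at t)"
      unfolding F_def[abs_def] by (auto intro!: derivative_eq_intros simp: power2_eq_square field_simps)
    moreover have "1 / 2 + ((cos t)\<^sup>2 - (sin t)\<^sup>2) / 2 = (cos t)\<^sup>2" "1 / 2 - ((cos t)\<^sup>2 - (sin t)\<^sup>2) / 2 = (sin t)\<^sup>2"
      using sin_cos_squared_add[of t] by (auto simp: field_simps)
    ultimately show ?thesis unfolding eq by simp
  qed
  hence "((\<lambda>t. L (circ t) \<bullet> circ' t) has_integral F (2 * pi) - F 0) {0..2 * pi}"
    by (intro fundamental_theorem_of_calculus)
      (auto simp: has_real_derivative_iff_has_vector_derivative intro: has_vector_derivative_at_within)
  moreover have "F (2 * pi) - F 0 = pi * curl2 L"
    by (simp add: F_def curl2_def B_def C_def algebra_simps)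
  ultimately show ?thesis by simp
qed

lemma integral_circ_bound:
  assumes "continuous_on {0..2 * pi} f" "\<And>t. norm (f t) \<le> B"
  shows "\<bar>integral {0..2 * pi} (\<lambda>t. f t \<bullet> circ' t)\<bar> \<le> 2 * pi * B"
proof -
  have "norm (integral (cbox 0 (2 * pi)) (\<lambda>t. f t \<bullet> circ' t)) \<le> B * measure lborel (cbox 0 (2 * pi))"
  proof (rule integrable_bound)
    show "0 \<le> B" using order_trans[OF norm_ge_zero assms(2)] .
    show "(\<lambda>t. f t \<bullet> circ' t) integrable_on cbox 0 (2 * pi)"
      unfolding cbox_interval by (intro integrable_continuous_interval continuous_intros assms(1))
    show "norm (f t \<bullet> circ' t) \<le> B" for t
      using Cauchy_Schwarz_ineq2[of "f t" "circ' t"] assms(2)[of t] by (simp add: norm_circ)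
  qed
  thus ?thesis by (simp add: cbox_interval mult.commute)
qed

text \<open>
  Let \<open>\<Gamma>(y) = \<integral> V(y + \<epsilon>\<gamma>) \<cdot> \<gamma>'\<close> over the unit circle \<open>\<gamma>\<close>, so that \<open>\<epsilon>\<Gamma>(y)\<close> is the circulation of \<open>V\<close>
  around the circle of radius \<open>\<epsilon>\<close> about \<open>y\<close>.  Up to errors \<open>O(\<eta>\<epsilon>)\<close>, where \<open>\<eta>\<close> bounds the
  oscillation of \<open>DV\<close> at distance \<open>2\<epsilon>\<close>, one has \<open>\<Gamma>(y) = \<pi>\<epsilon> curl V(y)\<close>.  At a maximum point \<open>y\<close> of
  \<open>|\<Gamma>|\<close> the circulation of the field \<open>x \<mapsto> DV(x) (W(y))\<close>, being the derivative of \<open>\<Gamma>\<close> in the direction \<open>W(y)\<close>, is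
  \<open>0\<close>.  In the momentum equation there remains, besides \<open>a V\<close>, only
  \<open>DV(x) (W(x) - W(y))\<close> with \<open>x = y + \<epsilon>\<gamma>\<close>; this is \<open>\<epsilon> A (b I + A) \<gamma>\<close> with \<open>A = DV(y)\<close>, and
  \<open>curl (A (b I + A)) = b curl A + tr A curl A = b curl A\<close>.  Hence
  \<open>(a + b) \<pi>\<epsilon> curl V(y) = O(\<eta>\<epsilon>)\<close>, and the maximality of \<open>|\<Gamma>(y)|\<close> carries the bound over to every
  other point.
\<close>

lemma curl2_of_self_similar_Euler_profile:
  fixes V gP :: "real ^ 2 \<Rightarrow> real ^ 2" and a b B :: real
  assumes D: "\<And>x. (V has_derivative D x) (at x)"
    and uc: "\<And>e. e > 0 \<Longrightarrow> \<exists>d>0. \<forall>x y. dist x y < d \<longrightarrow> (\<forall>h. norm (D x h - D y h) \<le> e * norm h)"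
    and bdd: "\<And>x h. norm (D x h) \<le> B * norm h"
    and lim: "(V \<longlongrightarrow> 0) at_infinity"
    and div: "\<And>x. D x (axis 1 1) $ 1 + D x (axis 2 1) $ 2 = 0"
    and P: "\<And>x. GDERIV P x :> gP x"
    and eq: "\<And>x. a *\<^sub>R V x + D x (b *\<^sub>R x + V x) = - gP x"
    and ab: "a + b \<noteq> 0"
  shows "curl2 (D x) = 0"
proof -
  have lin: "linear (D x)" for x using has_derivative_linear[OF D] .
  have "0 \<le> B * norm (axis 1 1 :: real ^ 2)" by (rule order_trans[OF norm_ge_zero bdd])
  hence B: "B \<ge> 0" by (simp add: zero_le_mult_iff axis_eq_0_iff)
  have V_cont: "continuous_on UNIV V"
    using D by (meson continuous_at_imp_continuous_on has_derivative_continuous)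
  have D_cont: "continuous_on UNIV (\<lambda>x. D x h)" for h
    unfolding continuous_on_iff
  proof (intro ballI allI impI)
    fix x :: "real ^ 2" and e :: real assume "e > 0"
    hence e: "e / (2 * norm h + 2) > 0" by (simp add: add_nonneg_pos)
    obtain d where d: "d > 0" "\<And>x y k. dist x y < d \<Longrightarrow> norm (D x k - D y k) \<le> e / (2 * norm h + 2) * norm k"
      using uc[OF e] by blast
    have "norm h < 2 * norm h + 2" using norm_ge_zero[of h] by linarith
    hence "e * norm h < e * (2 * norm h + 2)"
      using \<open>e > 0\<close> by (rule mult_strict_left_mono)
    moreover have "2 * norm h + 2 > 0" using norm_ge_zero[of h] by linarith
    ultimately have "e / (2 * norm h + 2) * norm h < e" by (simp add: pos_divide_less_eq)
    hence "dist (D y h) (D x h) < e" if "dist y x < d" for y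
      using d(2)[OF that, of h] by (simp add: dist_norm)
    thus "\<exists>d>0. \<forall>x'\<in>UNIV. dist x' x < d \<longrightarrow> dist (D x' h) (D x h) < e"
      using d(1) by blast
  qed
  define x\<^sub>0 where "x\<^sub>0 = x"
  define K where "K = \<bar>b\<bar> + 2 * B"
  define C where "C = 2 * (K + \<bar>a\<bar>) / \<bar>a + b\<bar> + 4"
  have K: "K \<ge> 0" using B by (simp add: K_def)
  have C: "C > 0" using K by (simp add: C_def add_nonneg_pos)
  have main: "\<bar>curl2 (D x\<^sub>0)\<bar> \<le> C * \<eta>" if \<eta>: "\<eta> > 0" for \<eta>
  proof -
    obtain d where d: "d > 0" "\<And>x y k. dist x y < d \<Longrightarrow> norm (D x k - D y k) \<le> \<eta> * norm k"
      using uc[OF \<eta>] by blast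
    have incr: "norm (V (x + h) - V x - D x h) \<le> \<eta> * norm h" if "norm h < d" for x h
      by (rule increment_bound_of_derivative_oscillation[where D = D and d = d]) (use D d \<eta> that in auto)
    define \<epsilon> where "\<epsilon> = d / 2"
    have \<epsilon>: "\<epsilon> > 0" "\<epsilon> < d" using d by (auto simp: \<epsilon>_def)
    define c where "c y t = y + \<epsilon> *\<^sub>R circ t" for y t
    have c_cont: "continuous_on S (c y)" for S y
      unfolding c_def by (intro continuous_intros)
    have VC: "continuous_on S (\<lambda>t. V (c y t))" for S y
      by (rule continuous_on_compose2[OF V_cont c_cont]) auto
    have DC: "continuous_on S (\<lambda>t. D (c y t) h)" for S y h
      by (rule continuous_on_compose2[OF D_cont c_cont]) auto
    have int: "(\<lambda>t. f t \<bullet> circ' t) integrable_on {0..2 * pi}" if "continuous_on {0..2 * pi} f" for f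
      by (intro integrable_continuous_interval continuous_intros that)
    define \<Gamma> where "\<Gamma> y = integral {0..2 * pi} (\<lambda>t. V (c y t) \<bullet> circ' t)" for y
    define \<Gamma>' where "\<Gamma>' y h = integral {0..2 * pi} (\<lambda>t. D (c y t) h \<bullet> circ' t)" for y h
    have \<Gamma>': "(\<Gamma> has_derivative \<Gamma>' y) (at y)" for y
      unfolding has_derivative_at_alt
    proof (intro conjI allI impI)
      show "bounded_linear (\<Gamma>' y)"
      proof (rule bounded_linear_intro[where K = "2 * pi * B"])
        show "\<Gamma>' y (h + k) = \<Gamma>' y h + \<Gamma>' y k" for h k
          unfolding \<Gamma>'_def linear_add[OF lin] inner_add_left
          by (rule Henstock_Kurzweil_Integration.integral_add) (intro int DC)+
        show "\<Gamma>' y (r *\<^sub>R h) = r *\<^sub>R \<Gamma>' y h" for r h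
          unfolding \<Gamma>'_def linear_scale[OF lin] inner_scaleR_left by simp
        show "norm (\<Gamma>' y h) \<le> norm h * (2 * pi * B)" for h
          using integral_circ_bound[OF DC bdd] unfolding \<Gamma>'_def by (simp add: mult_ac)
      qed
      fix e :: real assume "e > 0"
      hence e: "e / (2 * pi) > 0" by simp
      obtain r where r: "r > 0" "\<And>x y k. dist x y < r \<Longrightarrow> norm (D x k - D y k) \<le> e / (2 * pi) * norm k"
        using uc[OF e] by blast
      have "norm (\<Gamma> z - \<Gamma> y - \<Gamma>' y (z - y)) \<le> e * norm (z - y)" if "norm (z - y) < r" for z
      proof -
        define f where "f t = V (c z t) - V (c y t) - D (c y t) (z - y)" for t
        have "\<Gamma> z - \<Gamma> y - \<Gamma>' y (z - y) = integral {0..2 * pi} (\<lambda>t. f t \<bullet> circ' t)"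
          unfolding \<Gamma>_def \<Gamma>'_def f_def inner_diff_left
          by (subst Henstock_Kurzweil_Integration.integral_diff, (intro int VC DC integrable_diff)+)+ simp
        moreover have "norm (f t) \<le> e / (2 * pi) * norm (z - y)" for t
        proof -
          have "norm (V (c y t + (z - y)) - V (c y t) - D (c y t) (z - y)) \<le> e / (2 * pi) * norm (z - y)"
            by (rule increment_bound_of_derivative_oscillation[where D = D and d = r]) (use D r e that in auto)
          thus ?thesis by (simp add: f_def c_def algebra_simps)
        qed
        moreover have "continuous_on {0..2 * pi} f" unfolding f_def by (intro continuous_intros VC DC)
        ultimately show ?thesis using integral_circ_bound[of f "e / (2 * pi) * norm (z - y)"] by simp
      qed
      thus "\<exists>r>0. \<forall>z. norm (z - y) < r \<longrightarrow> norm (\<Gamma> z - \<Gamma> y - \<Gamma>' y (z - y)) \<le> e * norm (z - y)"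
        using r by blast
    qed
    have \<Gamma>_lim: "(\<Gamma> \<longlongrightarrow> 0) at_infinity"
      unfolding Lim_at_infinity
    proof (intro allI impI)
      fix e :: real assume "e > 0"
      hence "e / (4 * pi) > 0" by simp
      moreover have "\<forall>e>0. \<exists>b. \<forall>x. norm x \<ge> b \<longrightarrow> norm (V x) < e"
        using lim unfolding Lim_at_infinity by (simp add: dist_norm)
      ultimately obtain b where b: "\<And>x. norm x \<ge> b \<Longrightarrow> norm (V x) < e / (4 * pi)" by blast
      have "dist (\<Gamma> y) 0 < e" if "norm y \<ge> b + \<epsilon>" for y
      proof -
        have "norm (V (c y t)) \<le> e / (4 * pi)" for t
        proof -
          have "norm y \<le> norm (c y t) + norm (\<epsilon> *\<^sub>R circ t)"
            using norm_triangle_ineq4[of "c y t" "\<epsilon> *\<^sub>R circ t"] by (simp add: c_def)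
          hence "norm (c y t) \<ge> b" using that \<epsilon> by (simp add: norm_circ)
          thus ?thesis using b by (simp add: less_imp_le)
        qed
        from integral_circ_bound[OF VC this] have "\<bar>\<Gamma> y\<bar> \<le> e / 2" by (simp add: \<Gamma>_def)
        thus ?thesis using \<open>e > 0\<close> by simp
      qed
      thus "\<exists>b. \<forall>y. norm y \<ge> b \<longrightarrow> dist (\<Gamma> y) 0 < e" by blast
    qed
    have circ1: "\<bar>\<Gamma> y - \<epsilon> * pi * curl2 (D y)\<bar> \<le> 2 * pi * (\<eta> * \<epsilon>)" for y
    proof -
      define f where "f t = V (c y t) - V y - D y (\<epsilon> *\<^sub>R circ t)" for t
      have "((\<lambda>t. V (c y t) \<bullet> circ' t) has_integral \<Gamma> y) {0..2 * pi}"
        unfolding \<Gamma>_def by (intro integrable_integral int VC)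
      moreover have "((\<lambda>t. D y (\<epsilon> *\<^sub>R circ t) \<bullet> circ' t) has_integral \<epsilon> * (pi * curl2 (D y))) {0..2 * pi}"
        using has_integral_mult_right[OF has_integral_circ_linear[OF lin[of y]], of \<epsilon>]
        by (simp add: linear_scale[OF lin])
      ultimately have "((\<lambda>t. f t \<bullet> circ' t) has_integral \<Gamma> y - 0 - \<epsilon> * (pi * curl2 (D y))) {0..2 * pi}"
        unfolding f_def inner_diff_left by (intro has_integral_diff has_integral_circ_const)
      hence "integral {0..2 * pi} (\<lambda>t. f t \<bullet> circ' t) = \<Gamma> y - \<epsilon> * pi * curl2 (D y)"
        by (simp add: integral_unique mult.assoc)
      moreover have "norm (f t) \<le> \<eta> * \<epsilon>" for t
        using incr[of "\<epsilon> *\<^sub>R circ t" y] \<epsilon> by (simp add: f_def c_def norm_circ)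
      moreover have "continuous_on {0..2 * pi} f"
        unfolding f_def
        by (intro continuous_intros VC linear_continuous_on_compose[OF _ lin])
      ultimately show ?thesis using integral_circ_bound[of f "\<eta> * \<epsilon>"] by simp
    qed
    obtain y where y: "\<bar>\<Gamma> x\<^sub>0\<bar> \<le> \<bar>\<Gamma> y\<bar>" "\<Gamma>' y = (\<lambda>_. 0)"
      using vanishing_function_critical_point[OF \<Gamma>' \<Gamma>_lim] by metis
    define W where "W z = b *\<^sub>R z + V z" for z
    define L where "L h = D y (b *\<^sub>R h + D y h)" for h
    have L: "linear L"
      unfolding L_def by (intro linear_compose[OF _ lin, unfolded o_def] linear_compose_add linear_compose_scale_right linear_ident lin)
    \<comment> \<open>The trace of \<open>D y\<close> vanishes, so its square is a multiple of the identity and has no curl.\<close>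
    have curl_L: "curl2 L = b * curl2 (D y)"
    proof -
      have LD: "L (axis j 1) = b *\<^sub>R D y (axis j 1)
          + (D y (axis j 1) $ 1 *\<^sub>R D y (axis 1 1) + D y (axis j 1) $ 2 *\<^sub>R D y (axis 2 1))" for j
        by (simp only: L_def linear_add[OF lin] linear_scale[OF lin] linear_vec_2[OF lin, of y "D y (axis j 1)", symmetric])
      define A11 A21 A12 A22 where "A11 = D y (axis 1 1) $ 1" and "A21 = D y (axis 1 1) $ 2"
        and "A12 = D y (axis 2 1) $ 1" and "A22 = D y (axis 2 1) $ 2"
      have "curl2 L = b * (A21 - A12) + (A11 + A22) * (A21 - A12)"
        unfolding curl2_def LD
        by (simp add: A11_def A21_def A12_def A22_def algebra_simps)
      moreover have "A11 + A22 = 0" using div[of y] by (simp add: A11_def A22_def)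
      ultimately show ?thesis by (simp add: curl2_def A21_def A12_def)
    qed
    have WC: "continuous_on S (\<lambda>t. W (c y t))" for S
      unfolding W_def by (intro continuous_intros VC c_cont)
    define g where "g t = - gP (c y t) - a *\<^sub>R V (c y t) - D (c y t) (W y)" for t
    \<comment> \<open>By the momentum equation, \<open>g\<close> measures how the drift varies along the circle.\<close>
    have g: "g t = D (c y t) (W (c y t) - W y)" for t
    proof -
      have "a *\<^sub>R V (c y t) + D (c y t) (W (c y t)) = - gP (c y t)" using eq[of "c y t"] by (simp only: W_def)
      hence "D (c y t) (W (c y t)) = - gP (c y t) - a *\<^sub>R V (c y t)" by (simp only: eq_diff_eq add.commute)
      thus ?thesis by (simp only: g_def linear_diff[OF lin])
    qed
    have g_int: "((\<lambda>t. g t \<bullet> circ' t) has_integral - (a * \<Gamma> y)) {0..2 * pi}"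
    proof -
      have 1: "((\<lambda>t. - (gP (c y t) \<bullet> circ' t)) has_integral - 0) {0..2 * pi}"
        using has_integral_neg[OF has_integral_circ_gradient[OF P \<epsilon>(1), of y]] by (simp add: c_def)
      have 2: "((\<lambda>t. a * (V (c y t) \<bullet> circ' t)) has_integral a * \<Gamma> y) {0..2 * pi}"
        unfolding \<Gamma>_def by (intro has_integral_mult_right integrable_integral int VC)
      have "((\<lambda>t. D (c y t) (W y) \<bullet> circ' t) has_integral \<Gamma>' y (W y)) {0..2 * pi}"
        unfolding \<Gamma>'_def by (intro integrable_integral int DC)
      hence 3: "((\<lambda>t. D (c y t) (W y) \<bullet> circ' t) has_integral 0) {0..2 * pi}" using y(2) by simp
      show ?thesis
        using has_integral_diff[OF has_integral_diff[OF 1 2] 3] by (simp add: g_def inner_diff_left)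
    qed
    have L_int: "((\<lambda>t. \<epsilon> * (L (circ t) \<bullet> circ' t)) has_integral \<epsilon> * (pi * (b * curl2 (D y)))) {0..2 * pi}"
      using has_integral_mult_right[OF has_integral_circ_linear[OF L], of \<epsilon>] by (simp add: curl_L)
    define r where "r t = g t - \<epsilon> *\<^sub>R L (circ t)" for t
    have r_int: "((\<lambda>t. r t \<bullet> circ' t) has_integral - (a * \<Gamma> y) - \<epsilon> * (pi * (b * curl2 (D y)))) {0..2 * pi}"
      using has_integral_diff[OF g_int L_int] by (simp add: r_def inner_diff_left)
    have r_bd: "norm (r t) \<le> K * (\<eta> * \<epsilon>)" for t
    proof -
      define w where "w = W (c y t) - W y"
      have inc: "norm (V (c y t) - V y - D y (\<epsilon> *\<^sub>R circ t)) \<le> \<eta> * \<epsilon>"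
        using incr[of "\<epsilon> *\<^sub>R circ t" y] \<epsilon> by (simp add: c_def norm_circ)
      have w: "w = \<epsilon> *\<^sub>R (b *\<^sub>R circ t) + (V (c y t) - V y)"
        by (simp add: w_def W_def c_def algebra_simps)
      have nV: "norm (V (c y t) - V y) \<le> B * \<epsilon>"
      proof -
        have "norm (V (c y t) - V y) \<le> B * norm (c y t - y)"
          by (rule differentiable_bound[of UNIV V D])
            (use D bdd in \<open>auto intro!: onorm_bound B has_derivative_at_withinI\<close>)
        thus ?thesis using \<epsilon> by (simp add: c_def norm_circ)
      qed
      have nw: "norm w \<le> (\<bar>b\<bar> + B) * \<epsilon>"
        unfolding w using nV \<epsilon>
        by (intro order_trans[OF norm_triangle_ineq]) (simp add: norm_circ abs_mult algebra_simps)
      have "r t = (D (c y t) w - D y w) + D y (V (c y t) - V y - D y (\<epsilon> *\<^sub>R circ t))"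
        unfolding r_def g w_def[symmetric] unfolding w L_def
        by (simp add: linear_add[OF lin] linear_diff[OF lin] linear_scale[OF lin] algebra_simps)
      hence "norm (r t) \<le> norm (D (c y t) w - D y w) + norm (D y (V (c y t) - V y - D y (\<epsilon> *\<^sub>R circ t)))"
        using norm_triangle_ineq by metis
      also have "\<dots> \<le> \<eta> * norm w + B * norm (V (c y t) - V y - D y (\<epsilon> *\<^sub>R circ t))"
        using \<epsilon> by (intro add_mono d(2) bdd) (simp add: c_def dist_norm norm_circ)
      also have "\<dots> \<le> \<eta> * ((\<bar>b\<bar> + B) * \<epsilon>) + B * (\<eta> * \<epsilon>)"
        using nw inc \<eta> B by (intro add_mono mult_left_mono) auto
      also have "\<dots> = K * (\<eta> * \<epsilon>)" by (simp add: K_def algebra_simps)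
      finally show ?thesis .
    qed
    have "continuous_on {0..2 * pi} r"
    proof -
      have "continuous_on {0..2 * pi} (\<lambda>t. D (c y t) (W (c y t) - W y))"
      proof -
        have "D (c y t) (W (c y t) - W y) = (W (c y t) - W y) $ 1 *\<^sub>R D (c y t) (axis 1 1)
            + (W (c y t) - W y) $ 2 *\<^sub>R D (c y t) (axis 2 1)" for t
          by (rule linear_vec_2[OF lin])
        thus ?thesis by (simp only:) (intro continuous_intros DC WC)
      qed
      thus ?thesis
        unfolding r_def g by (intro continuous_intros linear_continuous_on_compose[OF _ L])
    qed
    from integral_circ_bound[OF this r_bd]
    have "\<bar>- (a * \<Gamma> y) - \<epsilon> * (pi * (b * curl2 (D y)))\<bar> \<le> 2 * pi * (K * (\<eta> * \<epsilon>))"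
      using integral_unique[OF r_int] by simp
    hence e1: "\<bar>a * \<Gamma> y + \<epsilon> * pi * b * curl2 (D y)\<bar> \<le> 2 * pi * K * \<eta> * \<epsilon>" by (simp add: algebra_simps abs_minus_commute)
    have e2: "\<bar>a * (\<Gamma> y - \<epsilon> * pi * curl2 (D y))\<bar> \<le> \<bar>a\<bar> * (2 * pi * (\<eta> * \<epsilon>))"
      unfolding abs_mult[of a] using circ1 by (intro mult_left_mono) auto
    have split: "(a + b) * (\<epsilon> * pi * curl2 (D y))
        = (a * \<Gamma> y + \<epsilon> * pi * b * curl2 (D y)) - a * (\<Gamma> y - \<epsilon> * pi * curl2 (D y))" by (simp add: algebra_simps)
    have "\<bar>(a + b) * (\<epsilon> * pi * curl2 (D y))\<bar> \<le> 2 * pi * K * \<eta> * \<epsilon> + \<bar>a\<bar> * (2 * pi * (\<eta> * \<epsilon>))"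
      unfolding split by (rule order_trans[OF abs_triangle_ineq4 add_mono[OF e1 e2]])
    moreover have "\<bar>(a + b) * (\<epsilon> * pi * curl2 (D y))\<bar> = (pi * \<epsilon>) * (\<bar>a + b\<bar> * \<bar>curl2 (D y)\<bar>)"
      using \<epsilon> by (simp add: abs_mult)
    moreover have "2 * pi * K * \<eta> * \<epsilon> + \<bar>a\<bar> * (2 * pi * (\<eta> * \<epsilon>)) = (pi * \<epsilon>) * (2 * (K + \<bar>a\<bar>) * \<eta>)"
      by (simp add: algebra_simps)
    ultimately have "(pi * \<epsilon>) * (\<bar>a + b\<bar> * \<bar>curl2 (D y)\<bar>) \<le> (pi * \<epsilon>) * (2 * (K + \<bar>a\<bar>) * \<eta>)"
      by (simp only:)
    hence "\<bar>a + b\<bar> * \<bar>curl2 (D y)\<bar> \<le> 2 * (K + \<bar>a\<bar>) * \<eta>" using \<epsilon> by simp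
    hence cy: "\<bar>curl2 (D y)\<bar> \<le> 2 * (K + \<bar>a\<bar>) / \<bar>a + b\<bar> * \<eta>" using ab by (simp add: field_simps)
    have absr: "\<bar>\<epsilon> * pi * curl2 (D z)\<bar> = \<epsilon> * pi * \<bar>curl2 (D z)\<bar>" for z using \<epsilon> by (simp add: abs_mult)
    have "\<epsilon> * pi * \<bar>curl2 (D x\<^sub>0)\<bar> \<le> \<epsilon> * pi * \<bar>curl2 (D y)\<bar> + 4 * pi * (\<eta> * \<epsilon>)"
      using circ1[of x\<^sub>0] circ1[of y] y(1) absr[of x\<^sub>0] absr[of y] by linarith
    hence "(pi * \<epsilon>) * \<bar>curl2 (D x\<^sub>0)\<bar> \<le> (pi * \<epsilon>) * (\<bar>curl2 (D y)\<bar> + 4 * \<eta>)" by (simp add: algebra_simps)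
    hence "\<bar>curl2 (D x\<^sub>0)\<bar> \<le> \<bar>curl2 (D y)\<bar> + 4 * \<eta>" using \<epsilon> by simp
    thus ?thesis using cy by (simp add: C_def algebra_simps)
  qed
  have "\<bar>curl2 (D x\<^sub>0)\<bar> \<le> 0 + e" if "e > 0" for e
    using main[of "e / C"] C that by simp
  hence "\<bar>curl2 (D x\<^sub>0)\<bar> \<le> 0" by (rule field_le_epsilon)
  thus ?thesis by (simp add: x\<^sub>0_def)
qed

section \<open>Vector fields without divergence and curl\<close>

text \<open>
  The two conditions on \<open>D\<close> are the Cauchy--Riemann equations for \<open>V\<^sub>1 - i V\<^sub>2\<close>.
\<close>

lemma irrotational_solenoidal_field_vanishes:
  fixes V :: "real ^ 2 \<Rightarrow> real ^ 2"
  assumes D: "\<And>x. (V has_derivative D x) (at x)"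
    and div: "\<And>x. D x (axis 1 1) $ 1 + D x (axis 2 1) $ 2 = 0"
    and curl: "\<And>x. curl2 (D x) = 0"
    and lim: "(V \<longlongrightarrow> 0) at_infinity"
  shows "V x = 0"
proof -
  define e :: "complex \<Rightarrow> real ^ 2" where "e z = Re z *\<^sub>R axis 1 1 + Im z *\<^sub>R axis 2 1" for z
  define f where "f z = Complex (V (e z) $ 1) (- (V (e z) $ 2))" for z
  have e_lin: "bounded_linear e"
    unfolding e_def by (intro bounded_linear_intros bounded_linear_Re bounded_linear_Im bounded_linear_add bounded_linear_scaleR_const)
  have norm_e: "norm (e z) = norm z" for z
    by (simp add: norm_vec_2 e_def axis_def cmod_def)
  have norm_f: "norm (f z) = norm (V (e z))" for z
    by (simp add: f_def norm_vec_2 cmod_def)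
  have "(f has_field_derivative Complex (D (e z) (axis 1 1) $ 1) (- (D (e z) (axis 1 1) $ 2))) (at z)" for z
  proof -
    define D11 D21 D12 D22 where "D11 = D (e z) (axis 1 1) $ 1" and "D21 = D (e z) (axis 1 1) $ 2"
      and "D12 = D (e z) (axis 2 1) $ 1" and "D22 = D (e z) (axis 2 1) $ 2"
    have CR: "D12 = D21" "D22 = - D11"
      using curl[of "e z"] div[of "e z"] by (simp_all add: curl2_def D11_def D21_def D12_def D22_def)
    have lin: "linear (D (e z))" using has_derivative_linear[OF D] .
    have V: "((\<lambda>z. V (e z)) has_derivative (\<lambda>h. D (e z) (e h))) (at z)"
      by (rule has_derivative_compose[OF bounded_linear_imp_has_derivative[OF e_lin] D])
    have comp: "((\<lambda>z. V (e z) $ i) has_derivative (\<lambda>h. D (e z) (e h) $ i)) (at z)" for i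
      using bounded_linear.has_derivative[OF bounded_linear_vec_nth V] .
    have "((\<lambda>z. of_real (V (e z) $ 1) + \<i> * of_real (- (V (e z) $ 2))) has_derivative
        (\<lambda>h. of_real (D (e z) (e h) $ 1) + \<i> * of_real (- (D (e z) (e h) $ 2)))) (at z)"
      by (intro derivative_intros comp)
    hence "(f has_derivative (\<lambda>h. of_real (D (e z) (e h) $ 1) + \<i> * of_real (- (D (e z) (e h) $ 2)))) (at z)"
      by (simp add: f_def[abs_def] Complex_eq)
    moreover have "of_real (D (e z) (e h) $ 1) + \<i> * of_real (- (D (e z) (e h) $ 2)) = Complex D11 (- D21) * h" for h
    proof -
      have "D (e z) (e h) = Re h *\<^sub>R D (e z) (axis 1 1) + Im h *\<^sub>R D (e z) (axis 2 1)"
        by (subst (2) e_def) (simp add: linear_add[OF lin] linear_scale[OF lin])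
      hence "D (e z) (e h) $ 1 = Re h * D11 + Im h * D21" "D (e z) (e h) $ 2 = Re h * D21 - Im h * D11"
        using CR by (simp_all add: D11_def D21_def D12_def D22_def)
      thus ?thesis by (simp add: complex_eq_iff algebra_simps)
    qed
    ultimately show ?thesis by (simp add: has_field_derivative_def D11_def D21_def)
  qed
  hence hol: "f holomorphic_on UNIV"
    by (auto simp: holomorphic_on_def field_differentiable_def intro: has_field_derivative_at_within)
  have "(f \<longlongrightarrow> 0) at_infinity"
    using lim unfolding Lim_at_infinity dist_norm by (metis diff_zero norm_e norm_f)
  hence f0: "f z = 0" for z using Liouville_weak_0[OF hol] by blast
  have "V (e z) = 0" for z using norm_f[of z] f0[of z] by simp
  moreover have "e (Complex (x $ 1) (x $ 2)) = x"
    by (simp add: e_def vec_eq_iff forall_2 axis_def)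
  ultimately show ?thesis by metis
qed

section \<open>Equations for the self-similar profile\<close>

lemma at_0_within_Ico_neq_bot:
  fixes T :: real
  assumes "T > 0" shows "at 0 within {0..<T} \<noteq> bot"
proof -
  have "0 islimpt {0..<T}"
    unfolding islimpt_approachable
  proof (intro allI impI)
    fix e :: real assume "e > 0"
    thus "\<exists>x'\<in>{0..<T}. x' \<noteq> 0 \<and> dist x' 0 < e"
      using assms by (intro bexI[of _ "min (e / 2) (T / 2)"]) auto
  qed
  thus ?thesis by (simp add: trivial_limit_within)
qed

text \<open>
  The point \<open>x = T\<^sup>b y\<close> is the one that the initial slice maps to the profile variable \<open>y\<close>.
\<close>

lemma self_similar_time_derivative:
  fixes F :: "'a::real_normed_vector \<Rightarrow> 'b::real_normed_vector"
  assumes T: "T > 0" and F: "(F has_derivative DF) (at y)"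
    and u: "\<And>s. s \<in> {0..<T} \<Longrightarrow> u s = (1 / (T - s) powr \<kappa>) *\<^sub>R F ((T powr b *\<^sub>R y) /\<^sub>R (T - s) powr b)"
  shows "vector_derivative u (at 0 within {0..<T}) = (1 / (T * T powr \<kappa>)) *\<^sub>R (\<kappa> *\<^sub>R F y + DF (b *\<^sub>R y))"
proof (rule vector_derivative_within[OF at_0_within_Ico_neq_bot[OF T]])
  have lin: "linear DF" using has_derivative_linear[OF F] .
  have pw: "((\<lambda>s. (T - s) powr (- k)) has_real_derivative k * T powr (- k - 1)) (at 0)" for k
    using T by (auto intro!: derivative_eq_intros)
  have pos: "((\<lambda>s. ((T - s) powr (- b) * T powr b) *\<^sub>R y) has_derivative (\<lambda>s. (s * (b / T)) *\<^sub>R y)) (at 0)"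
  proof -
    have "((\<lambda>s. (T - s) powr (- b) * T powr b) has_real_derivative b * T powr (- b - 1) * T powr b) (at 0)"
      by (rule DERIV_cmult_right[OF pw])
    moreover have "b * T powr (- b - 1) * T powr b = b / T"
      using T by (simp add: powr_add[symmetric] powr_minus_divide mult.assoc)
    ultimately have "((\<lambda>s. (T - s) powr (- b) * T powr b) has_derivative (\<lambda>s. s * (b / T))) (at 0)"
      by (simp only: has_field_derivative_def mult_commute_abs)
    from has_derivative_scaleR_left[OF this] show ?thesis .
  qed
  have pos0: "((T - 0) powr (- b) * T powr b) *\<^sub>R y = y" using T by (simp add: powr_minus)
  have "((\<lambda>s. F (((T - s) powr (- b) * T powr b) *\<^sub>R y)) has_derivative (\<lambda>s. DF ((s * (b / T)) *\<^sub>R y))) (at 0)"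
    by (rule has_derivative_compose[OF pos]) (unfold pos0, rule F)
  hence "((\<lambda>s. F (((T - s) powr (- b) * T powr b) *\<^sub>R y)) has_derivative (\<lambda>s. s *\<^sub>R ((1 / T) *\<^sub>R DF (b *\<^sub>R y)))) (at 0)"
    by (simp add: linear_scale[OF lin] mult.commute)
  hence 1: "((\<lambda>s. F (((T - s) powr (- b) * T powr b) *\<^sub>R y)) has_vector_derivative ((1 / T) *\<^sub>R DF (b *\<^sub>R y))) (at 0)"
    by (simp add: has_vector_derivative_def)
  have 2: "((\<lambda>s. ((T - s) powr (- \<kappa>)) *\<^sub>R F (((T - s) powr (- b) * T powr b) *\<^sub>R y)) has_vector_derivative
      ((T - 0) powr (- \<kappa>)) *\<^sub>R ((1 / T) *\<^sub>R DF (b *\<^sub>R y)) + (\<kappa> * T powr (- \<kappa> - 1)) *\<^sub>R F (((T - 0) powr (- b) * T powr b) *\<^sub>R y)) (at 0)"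
    by (rule has_vector_derivative_scaleR[OF pw 1])
  have "((\<lambda>s. ((T - s) powr (- \<kappa>)) *\<^sub>R F (((T - s) powr (- b) * T powr b) *\<^sub>R y)) has_vector_derivative
      (1 / (T * T powr \<kappa>)) *\<^sub>R (\<kappa> *\<^sub>R F y + DF (b *\<^sub>R y))) (at 0)"
  proof -
    have "T powr (- \<kappa>) = 1 / T powr \<kappa>" "T powr (- \<kappa> - 1) = 1 / (T * T powr \<kappa>)"
      using T by (simp_all add: powr_minus_divide powr_diff)
    thus ?thesis using 2 unfolding pos0
      by (simp add: scaleR_right_distrib add.commute mult.commute)
  qed
  hence "((\<lambda>s. ((T - s) powr (- \<kappa>)) *\<^sub>R F (((T - s) powr (- b) * T powr b) *\<^sub>R y)) has_vector_derivative
      (1 / (T * T powr \<kappa>)) *\<^sub>R (\<kappa> *\<^sub>R F y + DF (b *\<^sub>R y))) (at 0 within {0..<T})"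
    by (rule has_vector_derivative_at_within)
  thus "(u has_vector_derivative (1 / (T * T powr \<kappa>)) *\<^sub>R (\<kappa> *\<^sub>R F y + DF (b *\<^sub>R y))) (at 0 within {0..<T})"
  proof (rule has_vector_derivative_transform[rotated -1])
    show "0 \<in> {0..<T}" using T by simp
    fix s assume s: "s \<in> {0..<T}"
    hence "(T - s) powr (- \<kappa>) = 1 / (T - s) powr \<kappa>" "(T - s) powr (- b) * T powr b = inverse ((T - s) powr b) * T powr b"
      by (simp_all add: powr_minus_divide inverse_eq_divide)
    thus "u s = ((T - s) powr (- \<kappa>)) *\<^sub>R F (((T - s) powr (- b) * T powr b) *\<^sub>R y)"
      by (simp only: u[OF s] scaleR_scaleR)
  qed
qed

text \<open>
  A derivative within the slab still determines the spatial derivative on the slice \<open>t = 0\<close>,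
  because the whole slice lies in the slab.
\<close>

lemma C1_on_slab_rescaled_slice:
  fixes w :: "'a::real_normed_vector \<Rightarrow> real \<Rightarrow> 'b::real_normed_vector"
  assumes C1: "C1_on (UNIV \<times> {0..<T}) (\<lambda>(x, t). w x t)" and T: "T > 0"
    and F: "\<And>y. F y = \<mu> *\<^sub>R w (l *\<^sub>R y) 0"
  obtains DF where "\<And>y. (F has_derivative DF y) (at y)" "\<And>h. continuous_on UNIV (\<lambda>y. DF y h)"
proof -
  obtain w' where w': "\<forall>z\<in>UNIV \<times> {0..<T}. ((\<lambda>(x, t). w x t) has_derivative blinfun_apply (w' z)) (at z within UNIV \<times> {0..<T})"
    and cont: "continuous_on (UNIV \<times> {0..<T}) w'"
    using C1 unfolding C1_on_def by blast
  define DF where "DF y h = \<mu> *\<^sub>R w' (l *\<^sub>R y, 0) (l *\<^sub>R h, 0)" for y h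
  have "(F has_derivative DF y) (at y)" for y
  proof -
    have "((\<lambda>y. (\<lambda>(x, t). w x t) (l *\<^sub>R y, 0)) has_derivative (\<lambda>h. w' (l *\<^sub>R y, 0) (l *\<^sub>R h, 0))) (at y within UNIV)"
    proof (rule has_derivative_in_compose2[where f = "\<lambda>y. (l *\<^sub>R y, 0)" and t = "UNIV \<times> {0..<T}" and g' = "\<lambda>z. blinfun_apply (w' z)"])
      show "((\<lambda>(x, t). w x t) has_derivative blinfun_apply (w' z)) (at z within UNIV \<times> {0..<T})" if "z \<in> UNIV \<times> {0..<T}" for z
        using w' that by blast
      show "((\<lambda>y. (l *\<^sub>R y, 0)) has_derivative (\<lambda>h. (l *\<^sub>R h, 0))) (at y within UNIV)"
        by (auto intro!: derivative_eq_intros)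
    qed (use T in auto)
    from has_derivative_scaleR_right[OF this, of \<mu>] show ?thesis
      by (simp add: F[abs_def] DF_def[abs_def])
  qed
  moreover have "continuous_on UNIV (\<lambda>y. DF y h)" for h
  proof -
    have "continuous_on UNIV (\<lambda>y. w' (l *\<^sub>R y, 0))"
      by (rule continuous_on_compose2[OF cont]) (use T in \<open>auto intro!: continuous_intros\<close>)
    thus ?thesis unfolding DF_def by (intro continuous_intros)
  qed
  ultimately show ?thesis using that by blast
qed

lemma has_derivative_rescaled:
  assumes F: "(F has_derivative DF) (at y)" and "l > 0"
  shows "((\<lambda>x. (1 / m) *\<^sub>R F (x /\<^sub>R l)) has_derivative (\<lambda>h. (1 / (m * l)) *\<^sub>R DF h)) (at (l *\<^sub>R y))"
proof -
  have "((\<lambda>x. F (x /\<^sub>R l)) has_derivative (\<lambda>h. DF (h /\<^sub>R l))) (at (l *\<^sub>R y))"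
    by (rule has_derivative_compose[where f = "\<lambda>x. x /\<^sub>R l"]) (use assms in \<open>auto intro!: derivative_eq_intros\<close>)
  from has_derivative_scaleR_right[OF this, of "1 / m"] show ?thesis
    by (simp add: linear_scale[OF has_derivative_linear[OF F]] divide_inverse)
qed

text \<open>
  The equations at time \<open>0\<close> and at the point \<open>T\<^sup>b y\<close>, multiplied by the common power of \<open>T\<close>.  The
  powers of the velocity terms match because \<open>a + b = 1\<close>.  The constant \<open>k\<close> collects the
  powers of \<open>T\<close> that remain in the buoyancy term.
\<close>

lemma self_similar_profile_equations:
  fixes \<alpha> T :: real
  defines "a \<equiv> \<alpha> / (\<alpha> + 1)" and "b \<equiv> 1 / (\<alpha> + 1)" and "c \<equiv> (2 * \<alpha> + 1) / (\<alpha> + 1)"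
  assumes \<alpha>: "\<alpha> \<noteq> -1" and T: "T > 0"
    and sol: "boussinesq_solution T v0 \<theta>0 v \<theta>" and ss: "self_similar \<alpha> T V \<Theta> v \<theta>"
  obtains D D\<Theta> P gP k where
    "\<And>y. (V has_derivative D y) (at y)" "\<And>h. continuous_on UNIV (\<lambda>y. D y h)"
    "\<And>y. (\<Theta> has_derivative D\<Theta> y) (at y)" "\<And>h. continuous_on UNIV (\<lambda>y. D\<Theta> y h)"
    "\<And>y. GDERIV P y :> gP y"
    "\<And>y. a *\<^sub>R V y + D y (b *\<^sub>R y + V y) = - gP y + (k * \<Theta> y) *\<^sub>R axis 1 1"
    "\<And>y. c * \<Theta> y + D\<Theta> y (b *\<^sub>R y + V y) = 0"
    "\<And>y. D y (axis 1 1) $ 1 + D y (axis 2 1) $ 2 = 0"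
proof -
  define l where "l = T powr b"
  define \<mu> where "\<mu> = T powr a"
  define \<nu> where "\<nu> = T powr c"
  have pos: "l > 0" "\<mu> > 0" "\<nu> > 0" using T by (auto simp: l_def \<mu>_def \<nu>_def)
  have "a + b = 1" using \<alpha> by (simp add: a_def b_def add_divide_distrib[symmetric])
  hence \<mu>l: "\<mu> * l = T" using T by (simp add: \<mu>_def l_def powr_add[symmetric])
  have v: "v x t = (1 / (T - t) powr a) *\<^sub>R V (x /\<^sub>R (T - t) powr b)"
    and \<theta>: "\<theta> x t = (1 / (T - t) powr c) *\<^sub>R \<Theta> (x /\<^sub>R (T - t) powr b)" if "t \<in> {0..<T}" for x t
    using ss that unfolding self_similar_def a_def b_def c_def by auto
  have v0: "v x 0 = (1 / \<mu>) *\<^sub>R V (x /\<^sub>R l)" and \<theta>0: "\<theta> x 0 = (1 / \<nu>) *\<^sub>R \<Theta> (x /\<^sub>R l)" for x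
    using v[of 0 x] \<theta>[of 0 x] T by (simp_all add: \<mu>_def l_def \<nu>_def)
  have V: "V y = \<mu> *\<^sub>R v (l *\<^sub>R y) 0" and \<Theta>: "\<Theta> y = \<nu> *\<^sub>R \<theta> (l *\<^sub>R y) 0" for y
    using pos by (simp_all add: v0 \<theta>0)
  have C1: "C1_on (UNIV \<times> {0..<T}) (\<lambda>(x, t). v x t)" "C1_on (UNIV \<times> {0..<T}) (\<lambda>(x, t). \<theta> x t)"
    using sol unfolding boussinesq_solution_def by auto
  obtain D where D: "\<And>y. (V has_derivative D y) (at y)" "\<And>h. continuous_on UNIV (\<lambda>y. D y h)"
    using C1_on_slab_rescaled_slice[OF C1(1) T V] by blast
  obtain D\<Theta> where D\<Theta>: "\<And>y. (\<Theta> has_derivative D\<Theta> y) (at y)" "\<And>h. continuous_on UNIV (\<lambda>y. D\<Theta> y h)"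
    using C1_on_slab_rescaled_slice[OF C1(2) T \<Theta>] by blast
  have linD: "linear (D y)" "linear (D\<Theta> y)" for y
    using has_derivative_linear[OF D(1)] has_derivative_linear[OF D\<Theta>(1)] by auto
  have fv: "frechet_derivative (\<lambda>x. v x 0) (at (l *\<^sub>R y)) = (\<lambda>h. (1 / T) *\<^sub>R D y h)" for y
    using frechet_derivative_at[OF has_derivative_rescaled[OF D(1) pos(1), of \<mu> y]] by (simp add: v0[abs_def] \<mu>l)
  have f\<theta>: "frechet_derivative (\<lambda>x. \<theta> x 0) (at (l *\<^sub>R y)) = (\<lambda>h. (1 / (\<nu> * l)) *\<^sub>R D\<Theta> y h)" for y
    using frechet_derivative_at[OF has_derivative_rescaled[OF D\<Theta>(1) pos(1), of \<nu> y]] by (simp add: \<theta>0[abs_def])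
  have tv: "vector_derivative (\<lambda>s. v (l *\<^sub>R y) s) (at 0 within {0..<T}) = (1 / (T * \<mu>)) *\<^sub>R (a *\<^sub>R V y + D y (b *\<^sub>R y))" for y
    using self_similar_time_derivative[OF T D(1), of "\<lambda>s. v (l *\<^sub>R y) s" a b y] v by (simp add: \<mu>_def l_def)
  have t\<theta>: "vector_derivative (\<lambda>s. \<theta> (l *\<^sub>R y) s) (at 0 within {0..<T}) = (1 / (T * \<nu>)) *\<^sub>R (c *\<^sub>R \<Theta> y + D\<Theta> y (b *\<^sub>R y))" for y
    using self_similar_time_derivative[OF T D\<Theta>(1), of "\<lambda>s. \<theta> (l *\<^sub>R y) s" c b y] \<theta> by (simp add: \<nu>_def l_def)
  have v0y: "v (l *\<^sub>R y) 0 = (1 / \<mu>) *\<^sub>R V y" and \<theta>0y: "\<theta> (l *\<^sub>R y) 0 = (1 / \<nu>) *\<^sub>R \<Theta> y" for y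
    using pos by (simp_all add: v0 \<theta>0)
  obtain p grad_p where p: "\<And>x t. t \<in> {0..<T} \<Longrightarrow> GDERIV (\<lambda>y. p y t) x :> grad_p x t"
    and mom: "\<And>x t. t \<in> {0..<T} \<Longrightarrow> vector_derivative (\<lambda>s. v x s) (at t within {0..<T})
            + frechet_derivative (\<lambda>y. v y t) (at x) (v x t) = - grad_p x t + \<theta> x t *\<^sub>R axis 1 1"
    using sol unfolding boussinesq_solution_def by blast
  have "\<forall>x. \<forall>t\<in>{0..<T}. vector_derivative (\<lambda>s. \<theta> x s) (at t within {0..<T})
          + frechet_derivative (\<lambda>y. \<theta> y t) (at x) (v x t) = 0 \<and> divergence (\<lambda>y. v y t) x = 0"
    using sol unfolding boussinesq_solution_def by blast
  hence heat: "vector_derivative (\<lambda>s. \<theta> x s) (at 0 within {0..<T})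
          + frechet_derivative (\<lambda>y. \<theta> y 0) (at x) (v x 0) = 0"
    and divv: "divergence (\<lambda>y. v y 0) x = 0" for x
    using T by auto
  define P where "P y = (T * \<mu> / l) * p (l *\<^sub>R y) 0" for y
  define gP where "gP y = (T * \<mu>) *\<^sub>R grad_p (l *\<^sub>R y) 0" for y
  show ?thesis
  proof (rule that[OF D D\<Theta>, of P gP "T * \<mu> / \<nu>"])
    fix y
    have "((\<lambda>y. p (l *\<^sub>R y) 0) has_derivative (\<lambda>h. (l *\<^sub>R h) \<bullet> grad_p (l *\<^sub>R y) 0)) (at y)"
      by (rule has_derivative_compose[where f = "\<lambda>x. l *\<^sub>R x", OF _ p[unfolded gderiv_def]])
        (use T in \<open>auto intro!: derivative_eq_intros\<close>)
    from has_derivative_mult_right[OF this, of "T * \<mu> / l"]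
    show "GDERIV P y :> gP y"
      using pos by (simp add: gderiv_def P_def[abs_def] gP_def mult.assoc)
    have "(1 / (T * \<mu>)) *\<^sub>R (a *\<^sub>R V y + D y (b *\<^sub>R y)) + (1 / T) *\<^sub>R D y ((1 / \<mu>) *\<^sub>R V y)
        = - grad_p (l *\<^sub>R y) 0 + ((1 / \<nu>) * \<Theta> y) *\<^sub>R axis 1 1"
      using mom[of 0 "l *\<^sub>R y"] T unfolding tv fv v0y \<theta>0y by simp
    hence "(1 / (T * \<mu>)) *\<^sub>R (a *\<^sub>R V y + D y (b *\<^sub>R y + V y)) = - grad_p (l *\<^sub>R y) 0 + ((1 / \<nu>) * \<Theta> y) *\<^sub>R axis 1 1"
      by (simp add: linear_add[OF linD(1)] linear_scale[OF linD(1)] scaleR_right_distrib add.assoc)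
    hence "(T * \<mu>) *\<^sub>R ((1 / (T * \<mu>)) *\<^sub>R (a *\<^sub>R V y + D y (b *\<^sub>R y + V y)))
        = (T * \<mu>) *\<^sub>R (- grad_p (l *\<^sub>R y) 0 + ((1 / \<nu>) * \<Theta> y) *\<^sub>R axis 1 1)" by simp
    thus "a *\<^sub>R V y + D y (b *\<^sub>R y + V y) = - gP y + (T * \<mu> / \<nu> * \<Theta> y) *\<^sub>R axis 1 1"
      using T pos by (simp add: gP_def scaleR_right_diff_distrib scaleR_right_distrib)
    have "(1 / (T * \<nu>)) *\<^sub>R (c *\<^sub>R \<Theta> y + D\<Theta> y (b *\<^sub>R y)) + (1 / (\<nu> * l)) *\<^sub>R D\<Theta> y ((1 / \<mu>) *\<^sub>R V y) = 0"
      using heat[of "l *\<^sub>R y"] unfolding t\<theta> f\<theta> v0y .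
    moreover have "(1 / (\<nu> * l)) *\<^sub>R D\<Theta> y ((1 / \<mu>) *\<^sub>R V y) = (1 / (T * \<nu>)) *\<^sub>R D\<Theta> y (V y)"
      by (simp add: linear_scale[OF linD(2)] \<mu>l[symmetric] mult_ac)
    ultimately have "(1 / (T * \<nu>)) *\<^sub>R (c *\<^sub>R \<Theta> y + D\<Theta> y (b *\<^sub>R y + V y)) = 0"
      by (simp only: linear_add[OF linD(2)] scaleR_right_distrib add.assoc)
    thus "c * \<Theta> y + D\<Theta> y (b *\<^sub>R y + V y) = 0" using T pos by simp
    have "(1 / T) * (D y (axis 1 1) $ 1 + D y (axis 2 1) $ 2) = 0"
      using divv[of "l *\<^sub>R y"] unfolding divergence_def fv by (simp add: sum_2 distrib_left)
    thus "D y (axis 1 1) $ 1 + D y (axis 2 1) $ 2 = 0" using T by simp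
  qed
qed

section \<open>Vanishing of the profile\<close>

lemma self_similar_profile_vanishes:
  fixes \<alpha> T :: real and V :: "real ^ 2 \<Rightarrow> real ^ 2" and \<Theta> :: "real ^ 2 \<Rightarrow> real"
  assumes \<alpha>: "\<alpha> \<noteq> -1" and T: "T > 0"
    and sol: "boussinesq_solution T v0 \<theta>0 v \<theta>" and ss: "self_similar \<alpha> T V \<Theta> v \<theta>"
    and p: "0 < p1" "p1 < p2" "in_Lp p1 \<Theta>" "in_Lp p2 \<Theta>"
    and V: "m > 2" "in_Hs_vec m V"
  shows "\<Theta> x = 0" "V x = 0"
proof -
  define a where "a = \<alpha> / (\<alpha> + 1)"
  define b where "b = 1 / (\<alpha> + 1)"
  define c where "c = (2 * \<alpha> + 1) / (\<alpha> + 1)"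
  have ab: "a + b \<noteq> 0" using \<alpha> by (simp add: a_def b_def add_divide_distrib[symmetric])
  have b: "b \<noteq> 0" using \<alpha> by (simp add: b_def)
  obtain D D\<Theta> P gP k where
    D: "\<And>y. (V has_derivative D y) (at y)" "\<And>h. continuous_on UNIV (\<lambda>y. D y h)" and
    D\<Theta>: "\<And>y. (\<Theta> has_derivative D\<Theta> y) (at y)" "\<And>h. continuous_on UNIV (\<lambda>y. D\<Theta> y h)" and
    P: "\<And>y. GDERIV P y :> gP y" and
    mom: "\<And>y. a *\<^sub>R V y + D y (b *\<^sub>R y + V y) = - gP y + (k * \<Theta> y) *\<^sub>R axis 1 1" and
    heat: "\<And>y. c * \<Theta> y + D\<Theta> y (b *\<^sub>R y + V y) = 0" and
    div: "\<And>y. D y (axis 1 1) $ 1 + D y (axis 2 1) $ 2 = 0"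
    using self_similar_profile_equations[OF \<alpha> T sol ss] unfolding a_def b_def c_def by metis
  have V_lim: "(V \<longlongrightarrow> 0) at_infinity"
    and uc: "\<And>e. e > 0 \<Longrightarrow> \<exists>d>0. \<forall>x y. dist x y < d \<longrightarrow> (\<forall>h. norm (D x h - D y h) \<le> e * norm h)"
    using Sobolev_embedding_C1_vec[OF V(2) V(1) D(1)] by blast+
  obtain B where B: "\<And>x h. norm (D x h) \<le> B * norm h"
    using Sobolev_embedding_C1_vec(2)[OF V(2) V(1) D(1)] by blast
  have lin: "linear (D y)" for y using has_derivative_linear[OF D(1)] .
  have "0 \<le> B * norm (axis 1 1 :: real ^ 2)" by (rule order_trans[OF norm_ge_zero B])
  hence B0: "B \<ge> 0" by (simp add: zero_le_mult_iff axis_eq_0_iff)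
  have "continuous_on UNIV \<Theta>"
    using D\<Theta>(1) by (meson continuous_at_imp_continuous_on has_derivative_continuous)
  hence "\<Theta> \<in> borel_measurable borel" by (rule borel_measurable_continuous_onI)
  then obtain q1 q2 where q: "0 < q1" "q1 < q2"
    "integrable lborel (\<lambda>x. \<bar>\<Theta> x\<bar> powr q1)" "integrable lborel (\<lambda>x. \<bar>\<Theta> x\<bar> powr q2)"
    using in_two_Lp_imp_two_real_exponents[OF p] by blast
  obtain q where q: "q > 0" "integrable lborel (\<lambda>x. \<bar>\<Theta> x\<bar> powr q)" "c * q \<noteq> 2 * b"
  proof (cases "c * q1 = 2 * b")
    case True
    have "c * q2 \<noteq> 2 * b"
    proof
      assume "c * q2 = 2 * b"
      with True have "c * (q2 - q1) = 0" by (simp add: right_diff_distrib)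
      hence "c = 0" using q by simp
      thus False using True b by simp
    qed
    thus ?thesis using that[of q2] q by simp
  qed (use that[of q1] q in simp)
  show \<Theta>0: "\<Theta> x = 0" for x
  proof (rule steady_transport_Lp_imp_0[OF D\<Theta>, where W = "\<lambda>y. b *\<^sub>R y + V y"
        and DW = "\<lambda>y h. b *\<^sub>R h + D y h" and M = "\<bar>b\<bar> + B + norm (V 0)" and p = q and c = c and \<delta> = "2 * b"])
    show "((\<lambda>y. b *\<^sub>R y + V y) has_derivative (\<lambda>h. b *\<^sub>R h + D y h)) (at y)" for y
      by (intro derivative_intros D(1))
    show "continuous_on UNIV (\<lambda>y. b *\<^sub>R h + D y h)" for h by (intro continuous_intros D(2))
    have Basis2: "(Basis :: (real ^ 2) set) = {axis 1 1, axis 2 1}"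
      by (auto simp: Basis_vec_def UNIV_2)
    have ne: "axis 1 1 \<noteq> (axis 2 1 :: real ^ 2)" by (simp add: axis_eq_axis)
    show "(\<Sum>e\<in>Basis. (b *\<^sub>R e + D y e) \<bullet> e) = 2 * b" for y
      using div[of y] ne by (simp add: Basis2 inner_axis inner_add_left)
    show "norm (b *\<^sub>R y + V y) \<le> (\<bar>b\<bar> + B + norm (V 0)) * (1 + norm y)" for y
    proof -
      have "norm (V y - V 0) \<le> B * norm (y - 0)"
        by (rule differentiable_bound[of UNIV V D])
          (use D B in \<open>auto intro!: onorm_bound B0 has_derivative_at_withinI\<close>)
      hence "norm (V y) \<le> B * norm y + norm (V 0)" using norm_triangle_ineq2[of "V y" "V 0"] by simp
      hence "norm (b *\<^sub>R y + V y) \<le> \<bar>b\<bar> * norm y + (B * norm y + norm (V 0))"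
        by (intro order_trans[OF norm_triangle_ineq]) simp
      moreover have "(\<bar>b\<bar> + B + norm (V 0)) * (1 + norm y)
          = \<bar>b\<bar> + B + norm (V 0) + \<bar>b\<bar> * norm y + B * norm y + norm (V 0) * norm y"
        by (simp add: algebra_simps)
      moreover have "0 \<le> norm (V 0) * norm y" by simp
      ultimately show ?thesis using B0 abs_ge_zero[of b] by linarith
    qed
    show "c * \<Theta> y + D\<Theta> y (b *\<^sub>R y + V y) = 0" for y by (rule heat)
  qed (use q in auto)
  have euler: "a *\<^sub>R V y + D y (b *\<^sub>R y + V y) = - gP y" for y
    using mom[of y] by (simp add: \<Theta>0)
  have curl: "curl2 (D y) = 0" for y
    by (rule curl2_of_self_similar_Euler_profile[OF D(1) uc B V_lim div P euler ab])
  show "V x = 0"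
    by (rule irrotational_solenoidal_field_vanishes[OF D(1) div curl V_lim])
qed

theorem theorem2p4:
  fixes \<alpha> T :: real
  assumes "\<alpha> \<noteq> -1" and "T > 0"
  shows "\<not> (\<exists>v0 \<theta>0 v \<theta> V \<Theta>.
    boussinesq_solution T v0 \<theta>0 v \<theta> \<and> nontrivial_on T v \<theta> \<and> self_similar \<alpha> T V \<Theta> v \<theta> \<and>
    (\<exists>p1 p2 :: ennreal. 0 < p1 \<and> p1 < p2 \<and> in_Lp p1 \<Theta> \<and> in_Lp p2 \<Theta>) \<and>
    (\<exists>m :: real. m > 2 \<and> in_Hs_vec m V))"
proof (rule notI, elim exE conjE)
  fix v0 \<theta>0 v \<theta> V \<Theta> p1 p2 m
  assume sol: "boussinesq_solution T v0 \<theta>0 v \<theta>" and nontrivial: "nontrivial_on T v \<theta>"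
    and ss: "self_similar \<alpha> T V \<Theta> v \<theta>"
    and "0 < p1" "p1 < p2" "in_Lp p1 \<Theta>" "in_Lp p2 \<Theta>" "m > 2" "in_Hs_vec m V"
  hence "\<Theta> x = 0" "V x = 0" for x
    using self_similar_profile_vanishes[OF assms sol ss] by blast+
  hence "v x t = 0 \<and> \<theta> x t = 0" if "t \<in> {0..<T}" for x t
    using ss that unfolding self_similar_def by simp
  thus False using nontrivial unfolding nontrivial_on_def by blast
qed

end
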